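(* Let $G$ be a discrete countable group which admits a proper quasi-1-cocycle $c\colon G\to\ell^2 G^{\oplus\infty}$, and let $H$ be a group which (i) is boundedly generated by a finite set of amenable subgroups, and (ii) has Kazhdan's property (T). Then every group homomorphism $\phi\colon H\to G$ has finite image.
   Context: $\ell^2 G$ is the Hilbert space with orthonormal basis $G$ with the left regular representation; $\ell^2G^{\oplus\infty}$ is the Hilbert space direct sum of countably infinitely many copies. For a unitary representation $\pi\colon G\to U(H_\pi)$, a quasi-1-cocycle is a map $c\colon G\to H_\pi$ such that $(g,h)\mapsto \pi(g)c(h)-c(gh)+c(g)$ is uniformly bounded on $G\times G$. It is proper if for every $R>0$ the set $\{g\in G: \|c(g)\|\le R\}$ is finite. A group $H$ is boundedly generated by a subset $X$ if there is $k\in\mathbb N$ such that each element of $H$ is a product of less than $k$ elements of $X\cup X^{-1}$. It is boundedly generated by a finite set of subgroups $\{H_i\}_{i\in I}$ if it is boundedly generated by $\bigcup_{i\in I}H_i$. All groups are considered as discrete groups. *)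

theory Defs
  imports "HOL-Analysis.Analysis" "HOL-Algebra.Module"
begin

section \<open>Complex Hilbert spaces with explicit carrier\<close>

abbreviation complex_ring :: "complex ring"
  where "complex_ring \<equiv> \<lparr>carrier = UNIV, mult = (*), one = 1, zero = 0, add = (+)\<rparr>"

text \<open>A complex vector space is a HOL-Algebra module over \<^term>\<open>complex_ring\<close>; the record fields
  \<^term>\<open>mult\<close> and \<^term>\<open>one\<close>, inherited from rings, play no role in a module. The inner product is
  linear in the second argument.\<close>

record 'v hilbert = "(complex, 'v) module" +
  ip :: "'v \<Rightarrow> 'v \<Rightarrow> complex"

definition hnorm :: "'v hilbert \<Rightarrow> 'v \<Rightarrow> real"
  where "hnorm V x = sqrt (Re (ip V x x))"

locale hilbert_space = module complex_ring V for V :: "'v hilbert" +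
  assumes ip_add_right:
      "\<lbrakk>x \<in> carrier V; y \<in> carrier V; z \<in> carrier V\<rbrakk> \<Longrightarrow> ip V x (y \<oplus>\<^bsub>V\<^esub> z) = ip V x y + ip V x z"
    and ip_smult_right:
      "\<lbrakk>x \<in> carrier V; y \<in> carrier V\<rbrakk> \<Longrightarrow> ip V x (a \<odot>\<^bsub>V\<^esub> y) = a * ip V x y"
    and ip_commute:
      "\<lbrakk>x \<in> carrier V; y \<in> carrier V\<rbrakk> \<Longrightarrow> ip V x y = cnj (ip V y x)"
    and ip_pos:
      "\<lbrakk>x \<in> carrier V; x \<noteq> \<zero>\<^bsub>V\<^esub>\<rbrakk> \<Longrightarrow> 0 < Re (ip V x x)"
    and complete:
      "\<lbrakk>\<And>n :: nat. s n \<in> carrier V;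
        \<And>e. 0 < e \<Longrightarrow> \<exists>N. \<forall>m\<ge>N. \<forall>n\<ge>N. hnorm V (s m \<ominus>\<^bsub>V\<^esub> s n) < e\<rbrakk>
       \<Longrightarrow> \<exists>l\<in>carrier V. (\<lambda>n. hnorm V (s n \<ominus>\<^bsub>V\<^esub> l)) \<longlonglongrightarrow> 0"

definition complex_line :: "complex hilbert"
  where "complex_line = \<lparr>carrier = UNIV, mult = (*), one = 1, zero = 0, add = (+),
           smult = (*), ip = (\<lambda>x y. cnj x * y)\<rparr>"

text \<open>The Hilbert space direct sum of copies of \<open>V\<close> indexed by \<open>I\<close>. Families are normalised to
  be \<open>0\<close> outside \<open>I\<close>.\<close>

definition hilbert_copies :: "'i set \<Rightarrow> 'v hilbert \<Rightarrow> ('i \<Rightarrow> 'v) hilbert"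
  where "hilbert_copies I V =
    \<lparr>carrier = {f. (\<forall>i\<in>I. f i \<in> carrier V) \<and> (\<forall>i. i \<notin> I \<longrightarrow> f i = \<zero>\<^bsub>V\<^esub>) \<and>
                   (\<lambda>i. (hnorm V (f i))\<^sup>2) summable_on I},
     mult = undefined, one = undefined,
     zero = (\<lambda>i. \<zero>\<^bsub>V\<^esub>),
     add = (\<lambda>f g i. f i \<oplus>\<^bsub>V\<^esub> g i),
     smult = (\<lambda>a f i. a \<odot>\<^bsub>V\<^esub> f i),
     ip = (\<lambda>f g. \<Sum>\<^sub>\<infinity>i\<in>I. ip V (f i) (g i))\<rparr>"

definition ell2 :: "'i set \<Rightarrow> ('i \<Rightarrow> complex) hilbert"
  where "ell2 I = hilbert_copies I complex_line"


section \<open>Unitary representations\<close>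

definition unitary_op :: "'v hilbert \<Rightarrow> ('v \<Rightarrow> 'v) \<Rightarrow> bool"
  where "unitary_op V T \<longleftrightarrow>
    bij_betw T (carrier V) (carrier V) \<and>
    (\<forall>x\<in>carrier V. \<forall>y\<in>carrier V. T (x \<oplus>\<^bsub>V\<^esub> y) = T x \<oplus>\<^bsub>V\<^esub> T y) \<and>
    (\<forall>a. \<forall>x\<in>carrier V. T (a \<odot>\<^bsub>V\<^esub> x) = a \<odot>\<^bsub>V\<^esub> T x) \<and>
    (\<forall>x\<in>carrier V. \<forall>y\<in>carrier V. ip V (T x) (T y) = ip V x y)"

definition unitary_rep :: "('g, 'm) monoid_scheme \<Rightarrow> 'v hilbert \<Rightarrow> ('g \<Rightarrow> 'v \<Rightarrow> 'v) \<Rightarrow> bool"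
  where "unitary_rep G V \<pi> \<longleftrightarrow>
    (\<forall>g\<in>carrier G. unitary_op V (\<pi> g)) \<and>
    (\<forall>g\<in>carrier G. \<forall>h\<in>carrier G. \<forall>x\<in>carrier V. \<pi> (g \<otimes>\<^bsub>G\<^esub> h) x = \<pi> g (\<pi> h x))"

definition left_regular :: "('g, 'm) monoid_scheme \<Rightarrow> 'g \<Rightarrow> ('g \<Rightarrow> complex) \<Rightarrow> 'g \<Rightarrow> complex"
  where "left_regular G g f = (\<lambda>x. if x \<in> carrier G then f (inv\<^bsub>G\<^esub> g \<otimes>\<^bsub>G\<^esub> x) else 0)"

definition ell2_infinite_sum :: "('g, 'm) monoid_scheme \<Rightarrow> (nat \<Rightarrow> 'g \<Rightarrow> complex) hilbert"
  where "ell2_infinite_sum G = hilbert_copies (UNIV :: nat set) (ell2 (carrier G))"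

definition left_regular_infinite_sum ::
    "('g, 'm) monoid_scheme \<Rightarrow> 'g \<Rightarrow> (nat \<Rightarrow> 'g \<Rightarrow> complex) \<Rightarrow> nat \<Rightarrow> 'g \<Rightarrow> complex"
  where "left_regular_infinite_sum G g f = (\<lambda>n. left_regular G g (f n))"


section \<open>The sum of copies of the regular representation is a unitary representation\<close>

lemma cring_complex_ring: "cring complex_ring"
proof (rule cringI)
  show "abelian_group complex_ring"
    by (rule abelian_groupI) (auto simp: add_ac, metis add.right_inverse)
  show "Group.comm_monoid complex_ring"
    by (simp add: Group.monoid.intro monoid.monoid_comm_monoidI)
qed (auto simp: distrib_right)

lemma complex_line_minus: "x \<ominus>\<^bsub>complex_line\<^esub> y = x - y"
proof -
  interpret abelian_group complex_line
    by (rule abelian_groupI) (auto simp: add_ac complex_line_def, metis add.right_inverse)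
  have "\<ominus>\<^bsub>complex_line\<^esub> y = - y"
    by (rule minus_equality) (auto simp: complex_line_def)
  then show ?thesis by (simp add: a_minus_def complex_line_def)
qed

lemma hnorm_complex_line: "hnorm complex_line x = cmod x"
  by (simp add: hnorm_def complex_line_def cmod_def power2_eq_square)

lemma hilbert_space_complex_line: "hilbert_space complex_line"
proof (intro hilbert_space.intro hilbert_space_axioms.intro)
  show "module complex_ring complex_line"
  proof (rule moduleI[OF cring_complex_ring])
    show "abelian_group complex_line"
      by (rule abelian_groupI) (auto simp: add_ac complex_line_def, metis add.right_inverse)
  qed (auto simp: complex_line_def algebra_simps)
next
  fix s :: "nat \<Rightarrow> complex"
  assume "\<And>e. 0 < e \<Longrightarrow> \<exists>N. \<forall>m\<ge>N. \<forall>n\<ge>N. hnorm complex_line (s m \<ominus>\<^bsub>complex_line\<^esub> s n) < e"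
  then have "Cauchy s" by (simp add: hnorm_complex_line complex_line_minus CauchyI)
  then obtain l where "s \<longlonglongrightarrow> l" using Cauchy_convergent convergent_def by blast
  then have "(\<lambda>n. cmod (s n - l)) \<longlonglongrightarrow> 0" by (simp add: LIM_zero tendsto_norm_zero)
  then show "\<exists>l\<in>carrier complex_line. (\<lambda>n. hnorm complex_line (s n \<ominus>\<^bsub>complex_line\<^esub> l)) \<longlonglongrightarrow> 0"
    by (intro bexI[of _ l]) (simp_all add: hnorm_complex_line complex_line_minus, simp add: complex_line_def)
next
  fix x assume "x \<noteq> \<zero>\<^bsub>complex_line\<^esub>"
  then show "0 < Re (ip complex_line x x)"
    by (simp add: complex_line_def complex_eq_iff sum_power2_gt_zero_iff flip: power2_eq_square)
qed (auto simp: complex_line_def algebra_simps)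

context hilbert_space begin

lemma smult_in [simp]: "x \<in> carrier V \<Longrightarrow> a \<odot>\<^bsub>V\<^esub> x \<in> carrier V"
  by (rule smult_closed) auto

lemma uminus_eq: "x \<in> carrier V \<Longrightarrow> \<ominus>\<^bsub>V\<^esub> x = (-1) \<odot>\<^bsub>V\<^esub> x"
proof -
  assume x: "x \<in> carrier V"
  have "(-1) \<odot>\<^bsub>V\<^esub> x \<oplus>\<^bsub>V\<^esub> 1 \<odot>\<^bsub>V\<^esub> x = (-1+1) \<odot>\<^bsub>V\<^esub> x"
    using smult_l_distr[of "-1" 1 x] x by simp
  also have "\<dots> = \<zero>\<^bsub>V\<^esub>" using smult_l_null[of x] x by simp
  finally have "(-1) \<odot>\<^bsub>V\<^esub> x \<oplus>\<^bsub>V\<^esub> x = \<zero>\<^bsub>V\<^esub>" using smult_one[of x] x by simp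
  then show ?thesis using M.minus_equality[of "(-1) \<odot>\<^bsub>V\<^esub> x" x] x by simp
qed

lemma minus_eq': "x \<in> carrier V \<Longrightarrow> y \<in> carrier V \<Longrightarrow> x \<ominus>\<^bsub>V\<^esub> y = x \<oplus>\<^bsub>V\<^esub> (-1) \<odot>\<^bsub>V\<^esub> y"
  by (simp add: a_minus_def uminus_eq)

lemma ip_add_left:
  assumes "x \<in> carrier V" "y \<in> carrier V" "z \<in> carrier V"
  shows "ip V (y \<oplus>\<^bsub>V\<^esub> z) x = ip V y x + ip V z x"
  using assms ip_commute[of "y \<oplus>\<^bsub>V\<^esub> z" x] ip_add_right[of x y z] ip_commute[of y x] ip_commute[of z x]
  by simp

lemma ip_smult_left:
  assumes "x \<in> carrier V" "y \<in> carrier V"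
  shows "ip V (a \<odot>\<^bsub>V\<^esub> y) x = cnj a * ip V y x"
  using assms ip_commute[of "a \<odot>\<^bsub>V\<^esub> y" x] ip_smult_right[of x y a] ip_commute[of y x]
  by simp

lemma ip_zero [simp]: "ip V \<zero>\<^bsub>V\<^esub> x = 0" "ip V x \<zero>\<^bsub>V\<^esub> = 0" if "x \<in> carrier V"
  using ip_smult_left[of x x 0] ip_smult_right[of x x 0] smult_l_null[of x] that by auto

lemma ip_self_nonneg: "x \<in> carrier V \<Longrightarrow> 0 \<le> Re (ip V x x)"
  using ip_pos[of x] by (cases "x = \<zero>\<^bsub>V\<^esub>") auto

lemma hnorm_sq: "x \<in> carrier V \<Longrightarrow> (hnorm V x)\<^sup>2 = Re (ip V x x)"
  by (simp add: hnorm_def ip_self_nonneg)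

lemma ip_self: "x \<in> carrier V \<Longrightarrow> ip V x x = of_real ((hnorm V x)\<^sup>2)"
proof -
  assume x: "x \<in> carrier V"
  then have "Im (ip V x x) = Im (cnj (ip V x x))" using ip_commute[of x x] by metis
  then show ?thesis using x by (simp add: hnorm_sq complex_eq_iff)
qed

lemma hnorm_nonneg [simp]: "x \<in> carrier V \<Longrightarrow> 0 \<le> hnorm V x"
  by (simp add: hnorm_def ip_self_nonneg)

lemma hnorm_add_sq:
  assumes "x \<in> carrier V" "y \<in> carrier V"
  shows "(hnorm V (x \<oplus>\<^bsub>V\<^esub> y))\<^sup>2 = (hnorm V x)\<^sup>2 + 2 * Re (ip V x y) + (hnorm V y)\<^sup>2"
proof -
  have "Re (ip V y x) = Re (ip V x y)" using ip_commute[of y x] assms by simp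
  then show ?thesis using assms by (simp add: hnorm_sq ip_add_left ip_add_right)
qed

lemma hnorm_smult:
  assumes "x \<in> carrier V" shows "hnorm V (a \<odot>\<^bsub>V\<^esub> x) = cmod a * hnorm V x"
proof -
  have "ip V (a \<odot>\<^bsub>V\<^esub> x) (a \<odot>\<^bsub>V\<^esub> x) = (cnj a * a) * of_real ((hnorm V x)\<^sup>2)"
    using assms by (simp only: ip_smult_left ip_smult_right smult_in ip_self[OF assms] mult.assoc mult.left_commute)
  also have "cnj a * a = of_real ((cmod a)\<^sup>2)" using complex_norm_square[of a] by (simp add: mult.commute)
  finally have "ip V (a \<odot>\<^bsub>V\<^esub> x) (a \<odot>\<^bsub>V\<^esub> x) = of_real ((cmod a * hnorm V x)\<^sup>2)"
    by (simp add: power_mult_distrib)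
  then have "hnorm V (a \<odot>\<^bsub>V\<^esub> x) = sqrt ((cmod a * hnorm V x)\<^sup>2)" by (simp only: hnorm_def Re_complex_of_real)
  then show ?thesis using assms by simp
qed

lemma cauchy_schwarz:
  assumes "x \<in> carrier V" "y \<in> carrier V"
  shows "cmod (ip V x y) \<le> hnorm V x * hnorm V y"
proof (cases "hnorm V x = 0")
  case True
  then have "x = \<zero>\<^bsub>V\<^esub>" using ip_pos[of x] assms by (auto simp: hnorm_def)
  then show ?thesis using assms by (simp add: hnorm_def)
next
  case False
  define p where "p = ip V x y"
  define N where "N = (hnorm V x)\<^sup>2"
  define a where "a = - p / of_real N"
  have N: "N > 0" using False by (simp add: N_def)
  have "0 \<le> (hnorm V (y \<oplus>\<^bsub>V\<^esub> a \<odot>\<^bsub>V\<^esub> x))\<^sup>2" by simp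
  also have "\<dots> = (hnorm V y)\<^sup>2 + 2 * Re (a * cnj p) + (cmod a)\<^sup>2 * N"
    using assms ip_commute[of y x]
    by (simp add: hnorm_add_sq ip_smult_right hnorm_smult p_def N_def power_mult_distrib)
  also have "a * cnj p = of_real (- (cmod p)\<^sup>2 / N)"
    using complex_norm_square[of p] by (simp add: a_def)
  also have "(cmod a)\<^sup>2 * N = (cmod p)\<^sup>2 / N"
    using N by (simp add: a_def norm_divide power_divide power2_eq_square)
  finally have "(cmod p)\<^sup>2 / N \<le> (hnorm V y)\<^sup>2" by simp
  then have "(cmod p)\<^sup>2 \<le> (hnorm V x * hnorm V y)\<^sup>2"
    using N by (simp add: divide_le_eq power_mult_distrib N_def mult.commute)
  then show ?thesis unfolding p_def by (rule power2_le_imp_le) (use assms in simp)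
qed

lemma hnorm_triangle:
  assumes "x \<in> carrier V" "y \<in> carrier V"
  shows "hnorm V (x \<oplus>\<^bsub>V\<^esub> y) \<le> hnorm V x + hnorm V y"
proof -
  have "Re (ip V x y) \<le> hnorm V x * hnorm V y"
    using cauchy_schwarz[OF assms] complex_Re_le_cmod order_trans by blast
  then have "(hnorm V (x \<oplus>\<^bsub>V\<^esub> y))\<^sup>2 \<le> (hnorm V x + hnorm V y)\<^sup>2"
    using assms by (simp add: hnorm_add_sq power2_sum)
  then show ?thesis by (rule power2_le_imp_le) (use assms in simp)
qed

lemma hnorm_diff_triangle:
  assumes "x \<in> carrier V" "y \<in> carrier V" "z \<in> carrier V"
  shows "hnorm V (x \<ominus>\<^bsub>V\<^esub> z) \<le> hnorm V (x \<ominus>\<^bsub>V\<^esub> y) + hnorm V (y \<ominus>\<^bsub>V\<^esub> z)"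
proof -
  have "x \<ominus>\<^bsub>V\<^esub> z = (x \<ominus>\<^bsub>V\<^esub> y) \<oplus>\<^bsub>V\<^esub> (y \<ominus>\<^bsub>V\<^esub> z)"
    using assms by (simp add: a_minus_def M.a_assoc M.r_neg1)
  then show ?thesis using hnorm_triangle[of "x \<ominus>\<^bsub>V\<^esub> y" "y \<ominus>\<^bsub>V\<^esub> z"] assms by simp
qed

end

lemma copies_simps:
  "f \<in> carrier (hilbert_copies I V) \<longleftrightarrow> (\<forall>i\<in>I. f i \<in> carrier V) \<and> (\<forall>i. i \<notin> I \<longrightarrow> f i = \<zero>\<^bsub>V\<^esub>) \<and>
                   (\<lambda>i. (hnorm V (f i))\<^sup>2) summable_on I"
  "\<zero>\<^bsub>hilbert_copies I V\<^esub> = (\<lambda>i. \<zero>\<^bsub>V\<^esub>)"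
  "f \<oplus>\<^bsub>hilbert_copies I V\<^esub> g = (\<lambda>i. f i \<oplus>\<^bsub>V\<^esub> g i)"
  "a \<odot>\<^bsub>hilbert_copies I V\<^esub> f = (\<lambda>i. a \<odot>\<^bsub>V\<^esub> f i)"
  "ip (hilbert_copies I V) f g = (\<Sum>\<^sub>\<infinity>i\<in>I. ip V (f i) (g i))"
  by (auto simp: hilbert_copies_def)

lemma (in hilbert_space) hilbert_space_copies: "hilbert_space (hilbert_copies I V)"
proof -
  let ?K = "hilbert_copies I V"
  note cs = copies_simps
  have inV: "f i \<in> carrier V" if "f \<in> carrier ?K" for f i
    using that by (cases "i \<in> I") (auto simp: cs)
  have add: "f \<oplus>\<^bsub>?K\<^esub> g \<in> carrier ?K" if "f \<in> carrier ?K" "g \<in> carrier ?K" for f g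
  proof -
    have "(\<lambda>i. (hnorm V (f i \<oplus>\<^bsub>V\<^esub> g i))\<^sup>2) summable_on I"
    proof (rule summable_on_comparison_test)
      show "(\<lambda>i. 2 * (hnorm V (f i))\<^sup>2 + 2 * (hnorm V (g i))\<^sup>2) summable_on I"
        using that by (intro summable_on_add summable_on_cmult_right) (auto simp: cs)
      fix i
      have "(hnorm V (f i \<oplus>\<^bsub>V\<^esub> g i))\<^sup>2 \<le> (hnorm V (f i) + hnorm V (g i))\<^sup>2"
        using that by (intro power_mono hnorm_triangle) (auto simp: inV)
      also have "\<dots> \<le> 2 * (hnorm V (f i))\<^sup>2 + 2 * (hnorm V (g i))\<^sup>2"
        using zero_le_power2[of "hnorm V (f i) - hnorm V (g i)"] unfolding power2_sum power2_diff by linarith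
      finally show "(hnorm V (f i \<oplus>\<^bsub>V\<^esub> g i))\<^sup>2 \<le> 2 * (hnorm V (f i))\<^sup>2 + 2 * (hnorm V (g i))\<^sup>2" .
    qed auto
    then show ?thesis using that by (auto simp: cs)
  qed
  have smult: "a \<odot>\<^bsub>?K\<^esub> f \<in> carrier ?K" if "f \<in> carrier ?K" for a f
  proof -
    have "(\<lambda>i. (cmod a)\<^sup>2 * (hnorm V (f i))\<^sup>2) summable_on I"
      using that by (intro summable_on_cmult_right) (auto simp: cs)
    then have "(\<lambda>i. (hnorm V (a \<odot>\<^bsub>V\<^esub> f i))\<^sup>2) summable_on I"
      using that by (simp add: hnorm_smult inV power_mult_distrib)
    then show ?thesis using that smult_r_null[of a] by (auto simp: cs)
  qed
  have zero: "\<zero>\<^bsub>?K\<^esub> \<in> carrier ?K" by (simp add: cs hnorm_def)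
  have ab: "abelian_group ?K"
  proof (rule abelian_groupI)
    fix x assume x: "x \<in> carrier ?K"
    have "(-1) \<odot>\<^bsub>V\<^esub> x i \<oplus>\<^bsub>V\<^esub> x i = \<zero>\<^bsub>V\<^esub>" for i
      using inV[OF x, of i] by (simp add: M.l_neg flip: uminus_eq)
    then show "\<exists>y\<in>carrier ?K. y \<oplus>\<^bsub>?K\<^esub> x = \<zero>\<^bsub>?K\<^esub>"
      using smult[OF x, of "-1"] by (intro bexI[of _ "(-1) \<odot>\<^bsub>?K\<^esub> x"]) (auto simp: cs)
  qed (auto simp: add zero, auto simp: cs(2-) inV M.a_ac)
  have mod: "module complex_ring ?K"
  proof (rule moduleI[OF cring_complex_ring ab])
    show "(a \<oplus>\<^bsub>complex_ring\<^esub> b) \<odot>\<^bsub>?K\<^esub> x = a \<odot>\<^bsub>?K\<^esub> x \<oplus>\<^bsub>?K\<^esub> b \<odot>\<^bsub>?K\<^esub> x"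
      if "x \<in> carrier ?K" for a b x
      using inV[OF that] smult_l_distr[of a b] by (simp add: cs)
    show "a \<odot>\<^bsub>?K\<^esub> (x \<oplus>\<^bsub>?K\<^esub> y) = a \<odot>\<^bsub>?K\<^esub> x \<oplus>\<^bsub>?K\<^esub> a \<odot>\<^bsub>?K\<^esub> y"
      if "x \<in> carrier ?K" "y \<in> carrier ?K" for a x y
      using inV[OF that(1)] inV[OF that(2)] smult_r_distr[of a] by (simp add: cs)
    show "(a \<otimes>\<^bsub>complex_ring\<^esub> b) \<odot>\<^bsub>?K\<^esub> x = a \<odot>\<^bsub>?K\<^esub> (b \<odot>\<^bsub>?K\<^esub> x)" if "x \<in> carrier ?K" for a b x
      using inV[OF that] smult_assoc1[of a b] by (simp add: cs)
    show "\<one>\<^bsub>complex_ring\<^esub> \<odot>\<^bsub>?K\<^esub> x = x" if "x \<in> carrier ?K" for x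
      using inV[OF that] smult_one by (simp add: cs)
  qed (auto intro: smult)
  interpret K: module complex_ring ?K by (rule mod)
  have minus: "f \<ominus>\<^bsub>?K\<^esub> g = (\<lambda>i. f i \<ominus>\<^bsub>V\<^esub> g i)" if "f \<in> carrier ?K" "g \<in> carrier ?K" for f g
  proof -
    have "(-1) \<odot>\<^bsub>V\<^esub> g i \<oplus>\<^bsub>V\<^esub> g i = \<zero>\<^bsub>V\<^esub>" for i
      using inV[OF that(2), of i] by (simp add: M.l_neg flip: uminus_eq)
    then have "\<ominus>\<^bsub>?K\<^esub> g = (-1) \<odot>\<^bsub>?K\<^esub> g"
      using smult[OF that(2), of "-1"] that by (intro K.M.minus_equality) (auto simp: cs(2-))
    then show ?thesis using that by (simp add: a_minus_def cs(2-) uminus_eq inV)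
  qed
  have ips: "(\<lambda>i. ip V (f i) (g i)) summable_on I" if "f \<in> carrier ?K" "g \<in> carrier ?K" for f g
  proof (rule abs_summable_summable, rule summable_on_comparison_test)
    show "(\<lambda>i. (hnorm V (f i))\<^sup>2 + (hnorm V (g i))\<^sup>2) summable_on I"
      using that by (intro summable_on_add) (auto simp: cs)
    fix i
    have "cmod (ip V (f i) (g i)) \<le> hnorm V (f i) * hnorm V (g i)"
      using that by (intro cauchy_schwarz) (auto simp: inV)
    also have "\<dots> \<le> (hnorm V (f i))\<^sup>2 + (hnorm V (g i))\<^sup>2"
    proof -
      have "0 \<le> hnorm V (f i) * hnorm V (g i)" using that by (simp add: inV)
      then show ?thesis using zero_le_power2[of "hnorm V (f i) - hnorm V (g i)"]
        unfolding power2_diff by linarith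
    qed
    finally show "norm (ip V (f i) (g i)) \<le> (hnorm V (f i))\<^sup>2 + (hnorm V (g i))\<^sup>2" .
  qed auto
  have Reip: "Re (ip ?K f f) = (\<Sum>\<^sub>\<infinity>i\<in>I. (hnorm V (f i))\<^sup>2)" if "f \<in> carrier ?K" for f
    using infsum_Re[OF ips[OF that that]] that by (simp add: cs(5) hnorm_sq inV)
  have pos: "0 < Re (ip ?K f f)" if f: "f \<in> carrier ?K" and nz: "f \<noteq> \<zero>\<^bsub>?K\<^esub>" for f
  proof -
    obtain i where i: "f i \<noteq> \<zero>\<^bsub>V\<^esub>" using nz unfolding cs(2) by blast
    then have iI: "i \<in> I" using f by (auto simp: cs)
    have "0 < (hnorm V (f i))\<^sup>2" using ip_pos[OF inV[OF f] i] f by (simp add: hnorm_sq inV)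
    also have "\<dots> = (\<Sum>i\<in>{i}. (hnorm V (f i))\<^sup>2)" by simp
    also have "\<dots> \<le> (\<Sum>\<^sub>\<infinity>i\<in>I. (hnorm V (f i))\<^sup>2)"
      using f iI by (intro finite_sum_le_infsum) (auto simp: cs)
    finally show ?thesis by (simp add: Reip f)
  qed
  have compl: "\<exists>l\<in>carrier ?K. (\<lambda>n. hnorm ?K (s n \<ominus>\<^bsub>?K\<^esub> l)) \<longlonglongrightarrow> 0"
    if s: "\<And>n :: nat. s n \<in> carrier ?K"
      and C: "\<And>e. 0 < e \<Longrightarrow> \<exists>N. \<forall>m\<ge>N. \<forall>n\<ge>N. hnorm ?K (s m \<ominus>\<^bsub>?K\<^esub> s n) < e" for s
  proof -
    have fin: "(\<Sum>i\<in>F. (hnorm V (f i))\<^sup>2) \<le> (hnorm ?K f)\<^sup>2"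
      if "f \<in> carrier ?K" "finite F" "F \<subseteq> I" for f F
    proof -
      have "(hnorm ?K f)\<^sup>2 = (\<Sum>\<^sub>\<infinity>i\<in>I. (hnorm V (f i))\<^sup>2)"
        using that by (simp add: hnorm_def[of ?K] Reip infsum_nonneg)
      then show ?thesis using that by (auto intro!: finite_sum_le_infsum simp: cs)
    qed
    have dif: "s m \<ominus>\<^bsub>?K\<^esub> s n \<in> carrier ?K" for m n using s by simp
    have nn: "0 \<le> hnorm ?K (s m \<ominus>\<^bsub>?K\<^esub> s n)" for m n
      by (simp add: hnorm_def[of ?K] Reip[OF dif] infsum_nonneg)
    have coord: "hnorm V (s m i \<ominus>\<^bsub>V\<^esub> s n i) \<le> hnorm ?K (s m \<ominus>\<^bsub>?K\<^esub> s n)" if "i \<in> I" for m n i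
    proof (rule power2_le_imp_le[OF _ nn])
      have "s m i \<ominus>\<^bsub>V\<^esub> s n i = (s m \<ominus>\<^bsub>?K\<^esub> s n) i" using minus[OF s s, of m n] by simp
      then show "(hnorm V (s m i \<ominus>\<^bsub>V\<^esub> s n i))\<^sup>2 \<le> (hnorm ?K (s m \<ominus>\<^bsub>?K\<^esub> s n))\<^sup>2"
        using fin[OF dif, of "{i}" m n] that by simp
    qed
    have "\<exists>l\<in>carrier V. (\<lambda>n. hnorm V (s n i \<ominus>\<^bsub>V\<^esub> l)) \<longlonglongrightarrow> 0" if "i \<in> I" for i
    proof (rule complete)
      show "s n i \<in> carrier V" for n using s inV by blast
      show "\<exists>N. \<forall>m\<ge>N. \<forall>n\<ge>N. hnorm V (s m i \<ominus>\<^bsub>V\<^esub> s n i) < e" if "e > 0" for e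
        using C[OF that] coord[OF \<open>i \<in> I\<close>] order_le_less_trans by meson
    qed
    then obtain l0 where l0: "\<And>i. i \<in> I \<Longrightarrow> l0 i \<in> carrier V"
        "\<And>i. i \<in> I \<Longrightarrow> (\<lambda>n. hnorm V (s n i \<ominus>\<^bsub>V\<^esub> l0 i)) \<longlonglongrightarrow> 0" by metis
    define l where "l i = (if i \<in> I then l0 i else \<zero>\<^bsub>V\<^esub>)" for i
    have lV: "l i \<in> carrier V" for i using l0 by (simp add: l_def)
    have sV: "s n i \<in> carrier V" for n i using s inV by blast
    have bound: "(\<Sum>i\<in>F. (hnorm V (s m i \<ominus>\<^bsub>V\<^esub> l i))\<^sup>2) \<le> e\<^sup>2"
      if N: "\<forall>m\<ge>N. \<forall>n\<ge>N. hnorm ?K (s m \<ominus>\<^bsub>?K\<^esub> s n) < e" and "m \<ge> N" "finite F" "F \<subseteq> I" for e N m F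
    proof -
      have lim: "(\<lambda>n. hnorm V (s m i \<ominus>\<^bsub>V\<^esub> s n i)) \<longlonglongrightarrow> hnorm V (s m i \<ominus>\<^bsub>V\<^esub> l i)" if "i \<in> I" for i
      proof -
        have z: "(\<lambda>n. hnorm V (s n i \<ominus>\<^bsub>V\<^esub> l i)) \<longlonglongrightarrow> 0" using l0 that by (simp add: l_def)
        have sym: "hnorm V (l i \<ominus>\<^bsub>V\<^esub> s n i) = hnorm V (s n i \<ominus>\<^bsub>V\<^esub> l i)" for n
        proof -
          have "l i \<ominus>\<^bsub>V\<^esub> s n i = (-1) \<odot>\<^bsub>V\<^esub> (s n i \<ominus>\<^bsub>V\<^esub> l i)"
            using lV[of i] sV[of n i] by (simp add: M.minus_add a_minus_def M.a_comm flip: uminus_eq)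
          then show ?thesis using lV[of i] sV[of n i] by (simp add: hnorm_smult)
        qed
        have "norm (hnorm V (s m i \<ominus>\<^bsub>V\<^esub> s n i) - hnorm V (s m i \<ominus>\<^bsub>V\<^esub> l i)) \<le> hnorm V (s n i \<ominus>\<^bsub>V\<^esub> l i)" for n
          using hnorm_diff_triangle[OF sV[of m i] lV[of i] sV[of n i]]
                hnorm_diff_triangle[OF sV[of m i] sV[of n i] lV[of i]]
          by (simp add: sym)
        then show ?thesis
          by (rule LIM_zero_cancel[OF Lim_null_comparison[OF always_eventually[OF allI] z]])
      qed
      have "(\<lambda>n. \<Sum>i\<in>F. (hnorm V (s m i \<ominus>\<^bsub>V\<^esub> s n i))\<^sup>2) \<longlonglongrightarrow> (\<Sum>i\<in>F. (hnorm V (s m i \<ominus>\<^bsub>V\<^esub> l i))\<^sup>2)"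
        using that by (intro tendsto_sum tendsto_power lim) auto
      moreover have "(\<Sum>i\<in>F. (hnorm V (s m i \<ominus>\<^bsub>V\<^esub> s n i))\<^sup>2) \<le> e\<^sup>2" if "n \<ge> N" for n
      proof -
        have "(\<Sum>i\<in>F. (hnorm V (s m i \<ominus>\<^bsub>V\<^esub> s n i))\<^sup>2) \<le> (hnorm ?K (s m \<ominus>\<^bsub>?K\<^esub> s n))\<^sup>2"
          using fin[OF dif[of m n] \<open>finite F\<close> \<open>F \<subseteq> I\<close>] by (simp add: minus s)
        also have "\<dots> \<le> e\<^sup>2" using N \<open>m \<ge> N\<close> that nn by (intro power_mono) (auto intro: less_imp_le)
        finally show ?thesis .
      qed
      ultimately show ?thesis by (meson LIMSEQ_le_const2)
    qed
    have key: "(\<lambda>i. s m i \<ominus>\<^bsub>V\<^esub> l i) \<in> carrier ?K \<and> hnorm ?K (\<lambda>i. s m i \<ominus>\<^bsub>V\<^esub> l i) \<le> e"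
      if N: "\<forall>m\<ge>N. \<forall>n\<ge>N. hnorm ?K (s m \<ominus>\<^bsub>?K\<^esub> s n) < e" and "m \<ge> N" "e > 0" for e N m
    proof -
      have sum: "(\<lambda>i. (hnorm V (s m i \<ominus>\<^bsub>V\<^esub> l i))\<^sup>2) summable_on I"
        using bound[OF that(1,2)] by (intro nonneg_bdd_above_summable_on bdd_aboveI[of _ "e\<^sup>2"]) auto
      have z: "s m i \<ominus>\<^bsub>V\<^esub> l i = \<zero>\<^bsub>V\<^esub>" if "i \<notin> I" for i
        using s[of m] that by (simp add: l_def cs a_minus_def)
      have mem: "(\<lambda>i. s m i \<ominus>\<^bsub>V\<^esub> l i) \<in> carrier ?K" using sum z lV sV by (auto simp: cs)
      have "(\<Sum>\<^sub>\<infinity>i\<in>I. (hnorm V (s m i \<ominus>\<^bsub>V\<^esub> l i))\<^sup>2) \<le> e\<^sup>2"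
        using bound[OF that(1,2)] sum by (intro infsum_le_finite_sums) auto
      then have "hnorm ?K (\<lambda>i. s m i \<ominus>\<^bsub>V\<^esub> l i) \<le> e"
        using \<open>e > 0\<close> by (simp add: hnorm_def[of ?K] Reip[OF mem] real_le_lsqrt)
      then show ?thesis using mem by simp
    qed
    have lK: "l \<in> carrier ?K"
    proof -
      obtain N where N: "\<forall>m\<ge>N. \<forall>n\<ge>N. hnorm ?K (s m \<ominus>\<^bsub>?K\<^esub> s n) < 1" using C[of 1] by auto
      then have *: "(\<lambda>i. s N i \<ominus>\<^bsub>V\<^esub> l i) \<in> carrier ?K" using key[of N 1 N] by simp
      have "s N i \<ominus>\<^bsub>V\<^esub> (s N i \<ominus>\<^bsub>V\<^esub> l i) = l i" for i
        using lV[of i] sV[of N i] by (simp add: a_minus_def M.minus_add M.r_neg2 flip: M.a_assoc) (simp add: M.r_neg)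
      then have eq: "s N \<ominus>\<^bsub>?K\<^esub> (\<lambda>i. s N i \<ominus>\<^bsub>V\<^esub> l i) = l" using minus[OF s *] by simp
      show ?thesis using K.M.minus_closed[OF s[of N] *] unfolding eq .
    qed
    have "(\<lambda>n. hnorm ?K (s n \<ominus>\<^bsub>?K\<^esub> l)) \<longlonglongrightarrow> 0"
    proof (rule LIMSEQ_I)
      fix r :: real assume r: "r > 0"
      obtain N where N: "\<forall>m\<ge>N. \<forall>n\<ge>N. hnorm ?K (s m \<ominus>\<^bsub>?K\<^esub> s n) < r/2" using C[of "r/2"] r by auto
      have "norm (hnorm ?K (s n \<ominus>\<^bsub>?K\<^esub> l) - 0) < r" if "n \<ge> N" for n
      proof -
        have "hnorm ?K (\<lambda>i. s n i \<ominus>\<^bsub>V\<^esub> l i) \<le> r/2" and m: "(\<lambda>i. s n i \<ominus>\<^bsub>V\<^esub> l i) \<in> carrier ?K"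
          using key[OF N that] r by auto
        moreover have "0 \<le> hnorm ?K (\<lambda>i. s n i \<ominus>\<^bsub>V\<^esub> l i)"
          by (simp add: hnorm_def[of ?K] Reip[OF m] infsum_nonneg)
        ultimately show ?thesis using r by (simp add: minus[OF s lK])
      qed
      then show "\<exists>no. \<forall>n\<ge>no. norm (hnorm ?K (s n \<ominus>\<^bsub>?K\<^esub> l) - 0) < r" by blast
    qed
    then show ?thesis using lK by blast
  qed
  show ?thesis
  proof (intro hilbert_space.intro hilbert_space_axioms.intro mod pos compl)
    show "ip ?K x (y \<oplus>\<^bsub>?K\<^esub> z) = ip ?K x y + ip ?K x z"
      if "x \<in> carrier ?K" "y \<in> carrier ?K" "z \<in> carrier ?K" for x y z
      using infsum_add[OF ips[OF that(1,2)] ips[OF that(1,3)]] that by (simp add: cs(2-) ip_add_right inV)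
    show "ip ?K x (a \<odot>\<^bsub>?K\<^esub> y) = a * ip ?K x y" if "x \<in> carrier ?K" "y \<in> carrier ?K" for x y a
      using that by (simp add: cs(2-) ip_smult_right inV infsum_cmult_right')
    show "ip ?K x y = cnj (ip ?K y x)" if "x \<in> carrier ?K" "y \<in> carrier ?K" for x y
    proof -
      have "ip V (x i) (y i) = cnj (ip V (y i) (x i))" for i
        using that by (intro ip_commute) (auto simp: inV)
      then show ?thesis by (simp only: cs(5) infsum_cnj)
    qed
  qed auto
qed

lemma hilbert_space_ell2: "hilbert_space (ell2 I)"
  unfolding ell2_def by (rule hilbert_space.hilbert_space_copies[OF hilbert_space_complex_line])

lemma hilbert_space_ell2_infinite_sum: "hilbert_space (ell2_infinite_sum G)"
  unfolding ell2_infinite_sum_def by (rule hilbert_space.hilbert_space_copies[OF hilbert_space_ell2])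

lemma unitary_rep_copies:
  assumes "hilbert_space V" "unitary_rep G V \<pi>" 
  shows "unitary_rep G (hilbert_copies (UNIV::nat set) V) (\<lambda>g f n. \<pi> g (f n))"
proof -
  let ?K = "hilbert_copies (UNIV::nat set) V"
  note cs = copies_simps
  interpret hilbert_space V by fact
  have u: "unitary_op V (\<pi> g)" if "g \<in> carrier G" for g using assms that by (simp add: unitary_rep_def)
  have inV: "f i \<in> carrier V" if "f \<in> carrier ?K" for f i using that by (auto simp: cs)
  have nrm: "hnorm V (\<pi> g x) = hnorm V x" if "g \<in> carrier G" "x \<in> carrier V" for g x
    using u[of g] that by (simp add: unitary_op_def hnorm_def)
  have "unitary_op ?K (\<lambda>f n. \<pi> g (f n))" if g: "g \<in> carrier G" for g
  proof -
    have b: "bij_betw (\<pi> g) (carrier V) (carrier V)" using u[OF g] by (simp add: unitary_op_def)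
    let ?h = "inv_into (carrier V) (\<pi> g)"
    have h: "?h x \<in> carrier V" "\<pi> g (?h x) = x" "hnorm V (?h x) = hnorm V x" if "x \<in> carrier V" for x
      using b that nrm[OF g, of "?h x"]
      by (auto simp: bij_betw_def inv_into_into f_inv_into_f)
    have p: "\<pi> g x \<in> carrier V" if "x \<in> carrier V" for x using b that by (auto simp: bij_betw_def)
    have "bij_betw (\<lambda>f n. \<pi> g (f n)) (carrier ?K) (carrier ?K)"
      by (rule bij_betw_byWitness[where f' = "\<lambda>f n. ?h (f n)"])
         (use b in \<open>auto simp: cs h p nrm[OF g] bij_betw_def\<close>)
    then show ?thesis using u[OF g] by (auto simp: unitary_op_def cs(2-) inV)
  qed
  then show ?thesis using assms by (auto simp: unitary_rep_def inV)
qed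

lemma unitary_rep_left_regular:
  fixes G (structure)
  assumes "group G"
  shows "unitary_rep G (ell2 (carrier G)) (left_regular G)"
proof -
  interpret group G by fact
  let ?K = "ell2 (carrier G)"
  have cs: "f \<in> carrier ?K \<longleftrightarrow> (\<forall>i. i \<notin> carrier G \<longrightarrow> f i = 0) \<and> (\<lambda>i. (cmod (f i))\<^sup>2) summable_on carrier G"
    "f \<oplus>\<^bsub>?K\<^esub> h = (\<lambda>i. f i + h i)" "a \<odot>\<^bsub>?K\<^esub> f = (\<lambda>i. a * f i)"
    "ip ?K f h = (\<Sum>\<^sub>\<infinity>i\<in>carrier G. cnj (f i) * h i)" for f h a
    by (auto simp: ell2_def copies_simps hnorm_complex_line) (auto simp: complex_line_def)
  have bij: "bij_betw (\<lambda>x. inv g \<otimes> x) (carrier G) (carrier G)" if "g \<in> carrier G" for g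
    using that by (intro bij_betw_byWitness[where f' = "\<lambda>x. g \<otimes> x"]) (auto simp: m_assoc[symmetric])
  have mul: "left_regular G (g \<otimes> h) f = left_regular G g (left_regular G h f)"
    if "g \<in> carrier G" "h \<in> carrier G" for g h f
    using that by (auto simp: left_regular_def inv_mult_group m_assoc)
  have one: "left_regular G \<one> f = f" if "f \<in> carrier ?K" for f
    using that by (auto simp: left_regular_def cs)
  have cl: "left_regular G g f \<in> carrier ?K" if "g \<in> carrier G" "f \<in> carrier ?K" for g f
  proof -
    have "(\<lambda>i. (cmod (f (inv g \<otimes> i)))\<^sup>2) summable_on carrier G"
      using summable_on_reindex_bij_betw[OF bij[OF that(1)], of "\<lambda>i. (cmod (f i))\<^sup>2"] that by (simp add: cs)
    then have "(\<lambda>i. (cmod (left_regular G g f i))\<^sup>2) summable_on carrier G"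
      by (rule summable_on_cong[THEN iffD1, rotated]) (simp add: left_regular_def)
    then show ?thesis by (simp add: cs) (simp add: left_regular_def)
  qed
  have "unitary_op ?K (left_regular G g)" if g: "g \<in> carrier G" for g
    unfolding unitary_op_def
  proof (intro conjI ballI allI)
    show "bij_betw (left_regular G g) (carrier ?K) (carrier ?K)"
      by (rule bij_betw_byWitness[where f' = "left_regular G (inv g)"])
         (use g in \<open>auto simp: cl one mul[symmetric]\<close>)
    fix x y
    have "(\<Sum>\<^sub>\<infinity>i\<in>carrier G. cnj (left_regular G g x i) * left_regular G g y i)
        = (\<Sum>\<^sub>\<infinity>i\<in>carrier G. cnj (x (inv g \<otimes> i)) * y (inv g \<otimes> i))"
      by (rule infsum_cong) (simp add: left_regular_def)
    also have "\<dots> = (\<Sum>\<^sub>\<infinity>i\<in>carrier G. cnj (x i) * y i)"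
      using infsum_reindex_bij_betw[OF bij[OF g], of "\<lambda>i. cnj (x i) * y i"] .
    finally show "ip ?K (left_regular G g x) (left_regular G g y) = ip ?K x y" by (simp add: cs)
  qed (auto simp: cs left_regular_def)
  then show ?thesis by (auto simp: unitary_rep_def mul)
qed

lemma unitary_rep_left_regular_infinite_sum:
  "group G \<Longrightarrow> unitary_rep G (ell2_infinite_sum G) (left_regular_infinite_sum G)"
  unfolding ell2_infinite_sum_def left_regular_infinite_sum_def
  by (intro unitary_rep_copies hilbert_space_ell2 unitary_rep_left_regular)


section \<open>Quasi-1-cocycles\<close>

definition quasi_cocycle ::
    "('g, 'm) monoid_scheme \<Rightarrow> 'v hilbert \<Rightarrow> ('g \<Rightarrow> 'v \<Rightarrow> 'v) \<Rightarrow> ('g \<Rightarrow> 'v) \<Rightarrow> bool"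
  where "quasi_cocycle G V \<pi> c \<longleftrightarrow>
    c \<in> carrier G \<rightarrow> carrier V \<and>
    (\<exists>C. \<forall>g\<in>carrier G. \<forall>h\<in>carrier G.
       hnorm V (\<pi> g (c h) \<ominus>\<^bsub>V\<^esub> c (g \<otimes>\<^bsub>G\<^esub> h) \<oplus>\<^bsub>V\<^esub> c g) \<le> C)"

definition proper_cocycle :: "('g, 'm) monoid_scheme \<Rightarrow> 'v hilbert \<Rightarrow> ('g \<Rightarrow> 'v) \<Rightarrow> bool"
  where "proper_cocycle G V c \<longleftrightarrow> (\<forall>R>0. finite {g \<in> carrier G. hnorm V (c g) \<le> R})"


section \<open>Properties of discrete groups\<close>

definition boundedly_generated :: "('g, 'm) monoid_scheme \<Rightarrow> 'g set \<Rightarrow> bool"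
  where "boundedly_generated G X \<longleftrightarrow>
    (\<exists>k::nat. \<forall>g\<in>carrier G. \<exists>xs. length xs < k \<and> set xs \<subseteq> X \<union> (\<lambda>x. inv\<^bsub>G\<^esub> x) ` X \<and>
       g = foldr (\<otimes>\<^bsub>G\<^esub>) xs \<one>\<^bsub>G\<^esub>)"

text \<open>Amenability: existence of a left invariant mean on the bounded real functions on the group.
  By positivity, the value of \<open>\<mu>\<close> only depends on the restriction of its argument to the carrier.\<close>

definition amenable :: "('g, 'm) monoid_scheme \<Rightarrow> bool"
  where "amenable G \<longleftrightarrow> group G \<and>
    (let B = {f :: 'g \<Rightarrow> real. bounded (f ` carrier G)} in
     \<exists>\<mu> :: ('g \<Rightarrow> real) \<Rightarrow> real.
       (\<forall>f\<in>B. \<forall>f'\<in>B. \<mu> (\<lambda>x. f x + f' x) = \<mu> f + \<mu> f') \<and>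
       (\<forall>a. \<forall>f\<in>B. \<mu> (\<lambda>x. a * f x) = a * \<mu> f) \<and>
       (\<forall>f\<in>B. (\<forall>x\<in>carrier G. 0 \<le> f x) \<longrightarrow> 0 \<le> \<mu> f) \<and>
       \<mu> (\<lambda>x. 1) = 1 \<and>
       (\<forall>g\<in>carrier G. \<forall>f\<in>B. \<mu> (\<lambda>x. f (inv\<^bsub>G\<^esub> g \<otimes>\<^bsub>G\<^esub> x)) = \<mu> f))"

text \<open>Kazhdan's property (T) for a discrete group: there are a finite set \<open>Q\<close> and \<open>\<epsilon> > 0\<close> such that
  every unitary representation with a \<open>(Q, \<epsilon>)\<close>-invariant vector has a nonzero invariant vector.

  HOL cannot quantify over all types inside a definition, so the representation spaces range over
  all Hilbert spaces whose carrier is a set of functions \<open>'g \<times> nat \<Rightarrow> complex\<close> (with arbitrary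
  operations). This is no restriction. The closed span \<open>W\<close> of the orbit of a \<open>(Q, \<epsilon>)\<close>-invariant
  vector is a subrepresentation, and an invariant vector in \<open>W\<close> is one in the whole space; and
  \<open>W\<close> has an orthonormal basis of cardinality at most that of \<open>'g \<times> nat\<close>, so it is isometric
  to \<open>ell2 J\<close> for some \<open>J :: ('g \<times> nat) set\<close>.\<close>

definition kazhdan_property_T :: "('g, 'm) monoid_scheme \<Rightarrow> bool"
  where "kazhdan_property_T G \<longleftrightarrow>
    (\<exists>Q \<epsilon>. finite Q \<and> Q \<subseteq> carrier G \<and> (0::real) < \<epsilon> \<and>
       (\<forall>(V :: ('g \<times> nat \<Rightarrow> complex) hilbert) \<pi>.
          hilbert_space V \<longrightarrow> unitary_rep G V \<pi> \<longrightarrow>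
          (\<exists>\<xi>\<in>carrier V. \<xi> \<noteq> \<zero>\<^bsub>V\<^esub> \<and> (\<forall>q\<in>Q. hnorm V (\<pi> q \<xi> \<ominus>\<^bsub>V\<^esub> \<xi>) < \<epsilon> * hnorm V \<xi>)) \<longrightarrow>
          (\<exists>\<eta>\<in>carrier V. \<eta> \<noteq> \<zero>\<^bsub>V\<^esub> \<and> (\<forall>g\<in>carrier G. \<pi> g \<eta> = \<eta>))))"

end

theory Submission
  imports Defs
begin

text \<open>
Let \<open>V\<close> be the sum of copies of the regular representation, let \<open>C\<close> bound the defect of \<open>c\<close>, and
suppose that \<open>\<phi>(H)\<close> is infinite. The aim is to bound \<open>c\<close> on \<open>\<phi>(H)\<close>, which contradicts
properness.

On an amenable subgroup \<open>K\<close> of \<open>G\<close>, an average of the defect turns \<open>c\<close> into a genuine cocycle at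
bounded distance (\<open>quasi_cocycle_near_cocycle\<close>). This cocycle can be unbounded, already for the
integers. But there are contractions \<open>T\<close> of \<open>V\<close> that commute with \<open>G\<close>, come close to the
identity on any given vector, and make \<open>T \<circ> c\<close> bounded on \<open>K\<close>. The map \<open>T \<circ> c\<close> is again a
quasi-cocycle with defect at most \<open>C\<close>, so such contractions can be composed, one amenable
subgroup after the other (\<open>common_bounded_multiplier\<close>). For the images of the given subgroups of
\<open>H\<close>, bounded generation makes \<open>T \<circ> c\<close> bounded on \<open>\<phi>(H)\<close>, by a number that depends on \<open>T\<close>.

The dependence on \<open>T\<close> disappears in two steps. First, a bounded quasi-cocycle with defect \<open>C\<close> is
within \<open>18 C\<close> of a coboundary \<open>h \<mapsto> \<xi> - h \<xi>\<close>, however large its bound is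
(\<open>bounded_quasi_cocycle_near_coboundary\<close>). Second, \<open>V\<close> has no nonzero vector invariant under the
infinite group \<open>\<phi>(H)\<close>, so property (T) bounds the norm of \<open>\<xi>\<close> by its displacement under a finite
set \<open>Q\<close> (\<open>kazhdan_inequality\<close>), hence by \<open>C\<close> and the values of \<open>c\<close> on \<open>\<phi>(Q)\<close>. Thus \<open>T \<circ> c\<close>
is bounded on \<open>\<phi>(H)\<close> independently of \<open>T\<close>; letting \<open>T\<close> tend to the identity bounds \<open>c\<close>.

It remains to find \<open>T\<close> for a cocycle \<open>c\<close> on an infinite amenable subgroup \<open>K\<close>, where one may keep
only \<open>n\<close> of the coordinates of \<open>V\<close> (\<open>cocycle_bounded_multiplier\<close>). Let
\<open>w b = (c b, \<delta>\<^sub>b - \<delta>\<^sub>1)\<close>, a cocycle with \<open>n + 1\<close> coordinates, and let \<open>D\<close> be the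
orthogonal complement of all translates of its values. The projection \<open>P\<close> onto \<open>D\<close> commutes
with \<open>G\<close> and kills \<open>w b\<close>, so the norm of \<open>P (c b, 0) = - P (0, \<delta>\<^sub>b - \<delta>\<^sub>1)\<close> is at most \<open>2\<close>. If
\<open>a\<close> is the compression of \<open>P\<close> to the \<open>n\<close> coordinates of \<open>c\<close>, then
\<open>1 - (1 - a)\<^sup>m = a (1 + (1 - a) + \<dots> + (1 - a)\<^sup>m\<^sup>-\<^sup>1)\<close> is bounded on \<open>c\<close> as well, and it tends to the
identity as soon as \<open>a\<close> is injective.

Injectivity of \<open>a\<close> is a dimension count. The values of \<open>w\<close> span a space of von Neumann dimension
at most \<open>1\<close>, because over a Foelner set \<open>F\<close> of \<open>K\<close> a cocycle is determined by about \<open>card F\<close>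
values of a primitive; this is where amenability enters (\<open>cocycle_space_dim\<close>). Hence \<open>D\<close> has
dimension at least \<open>n\<close> (\<open>annihilator_dim\<close>). A vector of \<open>D\<close> that lives on the last coordinate is
constant on the cosets of the infinite group \<open>K\<close>, so it is \<open>0\<close>, and \<open>D\<close> embeds into \<open>n\<close>
coordinates, with dense image by the count (\<open>dense_of_dim_ge\<close>). The dimension theory that this
needs is rank-nullity for coordinate projections of invariant subspaces. It follows from the
identity \<open>trace_compression_identity\<close>, which compares traces of powers of two corners of a
projection.

Scalars are real throughout the argument: a complex coordinate counts as two real ones.
\<close>

section \<open>Projections and positive contractions in Hilbert space\<close>

lemma norm_diff_sq: "(norm (x - y))\<^sup>2 = (norm x)\<^sup>2 - 2 * (x \<bullet> y) + (norm (y::'h::real_inner))\<^sup>2"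
  by (simp add: power2_norm_eq_inner inner_diff_left inner_diff_right inner_commute)

lemma parallelogram_midpoint:
  fixes x y z :: "'h::real_inner"
  shows "(norm (y - z))\<^sup>2 = 2 * (norm (x - y))\<^sup>2 + 2 * (norm (x - z))\<^sup>2
           - 4 * (norm (x - (1/2) *\<^sub>R (y + z)))\<^sup>2"
  by (simp add: norm_diff_sq power2_norm_eq_inner inner_add_left inner_add_right
      inner_diff_left inner_diff_right inner_commute algebra_simps)

lemma orthogonal_projection_exists:
  fixes S :: "'h::{real_inner,complete_space} set"
  assumes "subspace S" "closed S"
  shows "\<exists>y\<in>S. \<forall>z\<in>S. (x - y) \<bullet> z = 0"
proof -
  define Q where "Q = (\<lambda>z. (norm (x - z))\<^sup>2) ` S"
  define d where "d = Inf Q"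
  have ne: "Q \<noteq> {}" using subspace_0[OF assms(1)] by (auto simp: Q_def)
  have bdd: "bdd_below Q" by (auto simp: Q_def intro!: bdd_belowI[of _ 0])
  have dle: "d \<le> (norm (x - z))\<^sup>2" if "z \<in> S" for z
    unfolding d_def by (rule cInf_lower[OF _ bdd]) (use that in \<open>auto simp: Q_def\<close>)
  have "\<exists>z\<in>S. (norm (x - z))\<^sup>2 < d + 1 / real (Suc n)" for n
  proof -
    have "Inf Q < d + 1 / real (Suc n)" by (simp add: d_def)
    from cInf_lessD[OF ne this] show ?thesis by (auto simp: Q_def)
  qed
  then obtain s where s: "\<And>n. s n \<in> S" "\<And>n. (norm (x - s n))\<^sup>2 < d + 1 / real (Suc n)" by metis
  have close: "(norm (s m - s n))\<^sup>2 \<le> 4 / real (Suc N)" if "m \<ge> N" "n \<ge> N" for m n N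
  proof -
    have "(1/2) *\<^sub>R (s m + s n) \<in> S" using s assms(1) by (intro subspace_scale subspace_add)
    then have "(norm (s m - s n))\<^sup>2 \<le> 2 / real (Suc m) + 2 / real (Suc n)"
      using parallelogram_midpoint[of "s m" "s n" x] dle[of "(1/2) *\<^sub>R (s m + s n)"] s(2)[of m] s(2)[of n]
      by (simp add: algebra_simps) 
    also have "\<dots> \<le> 2 / real (Suc N) + 2 / real (Suc N)"
      using that by (intro add_mono divide_left_mono) auto
    finally show ?thesis by simp
  qed
  have "Cauchy s"
  proof (rule CauchyI)
    fix e :: real assume e: "e > 0"
    obtain N where N: "4 / e\<^sup>2 < real (Suc N)" by (meson reals_Archimedean2 less_trans lessI of_nat_less_iff)
    have "norm (s m - s n) < e" if "m \<ge> N" "n \<ge> N" for m n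
    proof (rule power2_less_imp_less)
      show "(norm (s m - s n))\<^sup>2 < e\<^sup>2"
        using close[OF that] N e by (smt (verit) divide_less_eq mult.commute of_nat_0_less_iff zero_less_Suc zero_less_power)
    qed (use e in simp)
    then show "\<exists>M. \<forall>m\<ge>M. \<forall>n\<ge>M. norm (s m - s n) < e" by blast
  qed
  then obtain y where y: "s \<longlonglongrightarrow> y" using Cauchy_convergent_iff convergent_def by blast
  have yS: "y \<in> S" using closed_sequentially[OF assms(2)] s(1) y by blast
  have "(\<lambda>n. (norm (x - s n))\<^sup>2) \<longlonglongrightarrow> (norm (x - y))\<^sup>2" by (intro tendsto_intros y)
  moreover have "(\<lambda>n. d + 1 / real (Suc n)) \<longlonglongrightarrow> d + 0"
    by (intro tendsto_intros LIMSEQ_inverse_real_of_nat[unfolded inverse_eq_divide])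
  ultimately have yd: "(norm (x - y))\<^sup>2 \<le> d"
    using s(2) by (simp add: LIMSEQ_le less_imp_le)
  have "(x - y) \<bullet> z = 0" if z: "z \<in> S" for z
  proof (cases "z = 0")
    case False
    define t where "t = ((x - y) \<bullet> z) / (z \<bullet> z)"
    have zz: "z \<bullet> z > 0" using False by simp
    have "y + t *\<^sub>R z \<in> S" using yS z assms(1) by (intro subspace_scale subspace_add)
    from dle[OF this] have "(norm ((x - y) - t *\<^sub>R z))\<^sup>2 \<ge> (norm (x - y))\<^sup>2"
      using yd unfolding diff_diff_eq by linarith
    then have "2 * t * ((x - y) \<bullet> z) \<le> t\<^sup>2 * (z \<bullet> z)"
      unfolding norm_diff_sq[of "x - y" "t *\<^sub>R z"]
      by (simp add: power_mult_distrib flip: power2_norm_eq_inner)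
    then have "((x - y) \<bullet> z)\<^sup>2 \<le> 0" using zz by (simp add: t_def power2_eq_square field_simps)
    then show ?thesis by simp
  qed simp
  with yS show ?thesis by blast
qed

definition proj :: "'h::real_inner set \<Rightarrow> 'h \<Rightarrow> 'h"
  where "proj S x = (SOME y. y \<in> S \<and> (\<forall>z\<in>S. (x - y) \<bullet> z = 0))"

locale closed_subspace =
  fixes S :: "'h::{real_inner,complete_space} set"
  assumes subspace: "subspace S" and closed: "closed S"
begin

lemma proj_in [simp]: "proj S x \<in> S" and proj_orth: "z \<in> S \<Longrightarrow> (x - proj S x) \<bullet> z = 0"
proof -
  have "proj S x \<in> S \<and> (\<forall>z\<in>S. (x - proj S x) \<bullet> z = 0)"
    unfolding proj_def using orthogonal_projection_exists[OF subspace closed, of x] by (rule_tac someI_ex) auto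
  then show "proj S x \<in> S" "z \<in> S \<Longrightarrow> (x - proj S x) \<bullet> z = 0" by auto
qed

lemma proj_inner: "z \<in> S \<Longrightarrow> proj S x \<bullet> z = x \<bullet> z"
  using proj_orth[of z x] by (simp add: inner_diff_left)

lemma proj_unique: assumes "y \<in> S" "\<And>z. z \<in> S \<Longrightarrow> x \<bullet> z = y \<bullet> z" shows "proj S x = y"
proof -
  have "(proj S x - y) \<bullet> (proj S x - y) = 0"
    using assms proj_inner[of "proj S x - y" x] subspace_diff[OF subspace proj_in assms(1), of x]
    by (simp add: inner_diff_left)
  then show ?thesis by simp
qed

lemma proj_id: "x \<in> S \<Longrightarrow> proj S x = x"
  by (rule proj_unique) auto

lemma proj_zero: "(\<And>z. z \<in> S \<Longrightarrow> x \<bullet> z = 0) \<Longrightarrow> proj S x = 0"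
  by (rule proj_unique) (auto simp: subspace_0[OF subspace])

lemma proj_sym: "proj S x \<bullet> y = x \<bullet> proj S y"
  by (metis inner_commute proj_in proj_inner)

lemma proj_norm_sq: "(norm (proj S x))\<^sup>2 = proj S x \<bullet> x"
  by (metis inner_commute power2_norm_eq_inner proj_in proj_inner)

lemma proj_norm: "norm (proj S x) \<le> norm x"
proof -
  have "(norm (proj S x))\<^sup>2 \<le> norm (proj S x) * norm x"
    unfolding proj_norm_sq by (rule norm_cauchy_schwarz)
  then show ?thesis by (cases "norm (proj S x) = 0") (auto simp: power2_eq_square)
qed

lemma proj_linear: "linear (proj S)"
proof (rule linearI)
  show "proj S (x + y) = proj S x + proj S y" for x y
    by (rule proj_unique) (auto simp: subspace_add[OF subspace] inner_add_left proj_inner)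
  show "proj S (r *\<^sub>R x) = r *\<^sub>R proj S x" for r x
    by (rule proj_unique) (auto simp: subspace_scale[OF subspace] proj_inner)
qed

lemma proj_proj [simp]: "proj S (proj S x) = proj S x"
  by (rule proj_id) simp

lemmas proj_add = linear_add[OF proj_linear] and proj_diff = linear_diff[OF proj_linear]
  and proj_scale = linear_scale[OF proj_linear]

end

text \<open>The inequality \<open>firm\<close> says that \<open>0 \<le> A \<le> 1\<close>. In this form it is immediate for corners of
projections and gives both bounds without a square root of \<open>A\<close>.\<close>

locale positive_contraction =
  fixes A :: "'h::{real_inner,complete_space} \<Rightarrow> 'h"
  assumes linear: "linear A"
    and sym: "A x \<bullet> y = x \<bullet> A y"
    and firm: "(norm (A x))\<^sup>2 \<le> A x \<bullet> x"
begin

lemma contract: "norm (A x) \<le> norm x"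
proof -
  have "(norm (A x))\<^sup>2 \<le> norm (A x) * norm x"
    using firm[of x] norm_cauchy_schwarz[of "A x" x] by linarith
  then show ?thesis by (cases "norm (A x) = 0") (auto simp: power2_eq_square)
qed

lemma bounded_linear: "bounded_linear A"
  using linear contract by (intro bounded_linear_intro[of A 1]) (auto simp: linear_add linear_scale)

lemma pow_linear: "linear (A ^^ n)"
proof (induction n)
  case 0 show ?case by (simp add: linear_id flip: id_def)
next
  case (Suc n) then show ?case using linear_compose[OF Suc linear] by (simp add: o_def)
qed

lemma pow_sym: "(A ^^ n) x \<bullet> y = x \<bullet> (A ^^ n) y"
proof (induction n arbitrary: x y)
  case (Suc n)
  have "(A ^^ Suc n) x \<bullet> y = (A ^^ n) x \<bullet> A y" by (simp add: sym)
  also have "\<dots> = x \<bullet> (A ^^ n) (A y)" by (rule Suc)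
  finally show ?case by (simp add: funpow_swap1)
qed simp

lemma pow_inner: "(A ^^ m) x \<bullet> (A ^^ n) x = (A ^^ (m + n)) x \<bullet> x"
  by (metis (no_types, lifting) funpow_add comp_apply inner_commute pow_sym)

lemma pow_decr: "(A ^^ Suc n) x \<bullet> x \<le> (A ^^ n) x \<bullet> x" and pow_nonneg: "0 \<le> (A ^^ n) x \<bullet> x"
proof -
  obtain k where "n = k + k \<or> n = Suc (k + k)" by (metis evenE oddE mult_2 Suc_eq_plus1)
  then have "(A ^^ Suc n) x \<bullet> x \<le> (A ^^ n) x \<bullet> x \<and> 0 \<le> (A ^^ n) x \<bullet> x"
  proof
    assume n: "n = k + k"
    let ?y = "(A ^^ k) x"
    have "(A ^^ n) x \<bullet> x = ?y \<bullet> ?y" by (simp add: n pow_inner)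
    moreover have "(A ^^ Suc n) x \<bullet> x = A ?y \<bullet> ?y" using pow_inner[of "Suc k" x k] by (simp add: n)
    moreover have "A ?y \<bullet> ?y \<le> ?y \<bullet> ?y"
      using norm_cauchy_schwarz[of "A ?y" ?y] contract[of ?y]
      by (metis mult_right_mono norm_ge_zero order_trans power2_eq_square power2_norm_eq_inner)
    ultimately show ?thesis by simp
  next
    assume n: "n = Suc (k + k)"
    let ?y = "(A ^^ k) x"
    have "(A ^^ n) x \<bullet> x = A ?y \<bullet> ?y" using pow_inner[of "Suc k" x k] by (simp add: n)
    moreover have "(A ^^ Suc n) x \<bullet> x = A ?y \<bullet> A ?y" using pow_inner[of "Suc k" x "Suc k"] by (simp add: n)
    ultimately show ?thesis using firm[of ?y] by (metis order_trans power2_norm_eq_inner zero_le_power2)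
  qed
  then show "(A ^^ Suc n) x \<bullet> x \<le> (A ^^ n) x \<bullet> x" "0 \<le> (A ^^ n) x \<bullet> x" by auto
qed

lemma pow_antimono: "m \<le> n \<Longrightarrow> (A ^^ n) x \<bullet> x \<le> (A ^^ m) x \<bullet> x"
  by (rule lift_Suc_antimono_le[of "\<lambda>n. (A ^^ n) x \<bullet> x"]) (rule pow_decr)

lemma one_minus_pow_contract: "norm (x - (A ^^ n) x) \<le> norm x"
proof -
  have "(norm (x - (A ^^ n) x))\<^sup>2 = (norm x)\<^sup>2 - 2 * ((A ^^ n) x \<bullet> x) + (A ^^ (n + n)) x \<bullet> x"
    using pow_inner[of n x n] unfolding norm_diff_sq by (simp add: power2_norm_eq_inner inner_commute)
  also have "\<dots> \<le> (norm x)\<^sup>2"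
    using pow_antimono[of n "n + n" x] pow_nonneg[of n x] by simp
  finally show ?thesis by (rule power2_le_imp_le) simp
qed

sublocale fixp: closed_subspace "{x. A x = x}"
proof
  show "subspace {x. A x = x}"
    using linear by (auto simp: subspace_def linear_add linear_scale linear_0)
  have "closed ((\<lambda>x. A x - x) -` {0})"
    by (intro continuous_closed_vimage continuous_intros linear_continuous_at bounded_linear) auto
  then show "closed {x. A x = x}" by (simp add: vimage_def)
qed

lemma pow_fix: "A f = f \<Longrightarrow> (A ^^ n) f = f"
  by (induction n) auto

text \<open>The numbers \<open>A\<^sup>n x \<bullet> x\<close> decrease, and the squared distance of \<open>A\<^sup>m x\<close> and \<open>A\<^sup>n x\<close> is a
combination of three of them; so the powers converge, and the limit is fixed by \<open>A\<close>.\<close>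

lemma pow_tendsto: "(\<lambda>n. (A ^^ n) x) \<longlonglongrightarrow> proj {x. A x = x} x"
proof -
  define p where "p n = (A ^^ n) x \<bullet> x" for n
  have "monoseq p" unfolding monoseq_def p_def using pow_antimono by blast
  moreover have "Bseq p"
  proof (rule BseqI'[of _ "p 0"])
    show "norm (p n) \<le> p 0" for n using pow_nonneg[of n x] pow_antimono[of 0 n x] by (simp add: p_def)
  qed
  ultimately have "convergent p" by (rule Bseq_monoseq_convergent[rotated])
  then have Cp: "Cauchy p" by (rule convergent_Cauchy)
  have "Cauchy (\<lambda>n. (A ^^ n) x)"
  proof (rule CauchyI)
    fix e :: real assume e: "e > 0"
    then have "e\<^sup>2 / 2 > 0" by simp
    from CauchyD[OF Cp this] obtain N where N: "\<And>m n. m \<ge> N \<Longrightarrow> n \<ge> N \<Longrightarrow> norm (p m - p n) < e\<^sup>2 / 2" by blast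
    have "norm ((A ^^ m) x - (A ^^ n) x) < e" if mn: "m \<ge> N" "n \<ge> N" for m n
    proof (rule power2_less_imp_less)
      have "(norm ((A ^^ m) x - (A ^^ n) x))\<^sup>2 = (p (m + m) - p (m + n)) + (p (n + n) - p (m + n))"
        unfolding p_def norm_diff_sq by (simp add: power2_norm_eq_inner pow_inner)
      also have "\<dots> < e\<^sup>2"
        using N[of "m + m" "m + n"] N[of "n + n" "m + n"] mn unfolding real_norm_def by linarith
      finally show "(norm ((A ^^ m) x - (A ^^ n) x))\<^sup>2 < e\<^sup>2" .
    qed (use e in simp)
    then show "\<exists>M. \<forall>m\<ge>M. \<forall>n\<ge>M. norm ((A ^^ m) x - (A ^^ n) x) < e" by blast
  qed
  then obtain y where y: "(\<lambda>n. (A ^^ n) x) \<longlonglongrightarrow> y" using Cauchy_convergent_iff convergent_def by blast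
  have "(\<lambda>n. A ((A ^^ n) x)) \<longlonglongrightarrow> A y" by (rule bounded_linear.tendsto[OF bounded_linear y])
  moreover have "(\<lambda>n. A ((A ^^ n) x)) \<longlonglongrightarrow> y" using LIMSEQ_Suc[OF y] by simp
  ultimately have "A y = y" by (rule LIMSEQ_unique)
  moreover have "x \<bullet> z = y \<bullet> z" if "A z = z" for z
  proof -
    have "(\<lambda>n. (A ^^ n) x \<bullet> z) \<longlonglongrightarrow> y \<bullet> z" by (intro tendsto_intros y)
    then have "(\<lambda>n. x \<bullet> z) \<longlonglongrightarrow> y \<bullet> z" by (simp add: pow_sym pow_fix[OF that])
    then show ?thesis by (simp add: LIMSEQ_const_iff)
  qed
  ultimately have "proj {x. A x = x} x = y" by (intro fixp.proj_unique) auto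
  with y show ?thesis by simp
qed

text \<open>\<open>A\<close> respects the splitting of \<open>x\<close> into the fixed vector \<open>y\<close> and a vector orthogonal to it, and
is positive on the second part.\<close>

lemma pow_lower:
  assumes "A y = y" "(x - y) \<bullet> y = 0"
  shows "(norm y)\<^sup>2 \<le> (A ^^ n) x \<bullet> x"
proof -
  let ?z = "x - y"
  have y: "(A ^^ n) y = y" using assms(1) by (rule pow_fix)
  have 1: "(A ^^ n) ?z \<bullet> y = 0" using assms(2) by (simp add: pow_sym y)
  have "(A ^^ n) x = (A ^^ n) ?z + y" using linear_add[OF pow_linear, of n ?z y] y by simp
  then have "(A ^^ n) x \<bullet> x = ((A ^^ n) ?z + y) \<bullet> (?z + y)" by simp
  also have "\<dots> = (A ^^ n) ?z \<bullet> ?z + y \<bullet> y"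
    using assms(2) 1 by (simp only: inner_add_left inner_add_right inner_commute[of y ?z])
  finally show ?thesis using pow_nonneg[of n ?z] by (simp add: power2_norm_eq_inner)
qed

lemma pow_inner_tendsto:
  "(\<lambda>n. (A ^^ Suc n) x \<bullet> x) \<longlonglongrightarrow> (norm (proj {x. A x = x} x))\<^sup>2"
  unfolding fixp.proj_norm_sq by (rule LIMSEQ_Suc) (intro tendsto_intros pow_tendsto)

end

lemma bessel:
  fixes e :: "'m \<Rightarrow> 'h::real_inner"
  assumes "finite M" "\<And>m n. m \<in> M \<Longrightarrow> n \<in> M \<Longrightarrow> e m \<bullet> e n = (if m = n then 1 else 0)"
  shows "(\<Sum>m\<in>M. (e m \<bullet> b)\<^sup>2) \<le> (norm b)\<^sup>2"
proof -
  define s where "s = (\<Sum>m\<in>M. (e m \<bullet> b) *\<^sub>R e m)"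
  have "s \<bullet> s = (\<Sum>m\<in>M. \<Sum>n\<in>M. (e m \<bullet> b) * (e n \<bullet> b) * (e m \<bullet> e n))"
    by (simp add: s_def inner_sum_left inner_sum_right sum_distrib_left inner_commute algebra_simps)
  also have "\<dots> = (\<Sum>m\<in>M. \<Sum>n\<in>M. if n = m then (e m \<bullet> b)\<^sup>2 else 0)"
    by (intro sum.cong refl) (auto simp: assms(2) power2_eq_square)
  also have "\<dots> = (\<Sum>m\<in>M. (e m \<bullet> b)\<^sup>2)" using assms(1) by simp
  finally have ss: "s \<bullet> s = (\<Sum>m\<in>M. (e m \<bullet> b)\<^sup>2)" .
  have bs: "b \<bullet> s = (\<Sum>m\<in>M. (e m \<bullet> b)\<^sup>2)"
    by (simp add: s_def inner_sum_right power2_eq_square inner_commute)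
  have "0 \<le> (norm (b - s))\<^sup>2" by simp
  then show ?thesis unfolding norm_diff_sq using ss bs by (simp add: power2_norm_eq_inner)
qed

text \<open>Trace at most rank. In the application \<open>q m\<close> is the projection of \<open>e m\<close> onto a closed subspace;
the projections onto that subspace and onto the span of \<open>S\<close> then agree on the vectors \<open>e m\<close>.\<close>

lemma sum_norm_sq_le_card:
  fixes e q :: "'m \<Rightarrow> 'h::real_inner"
  assumes M: "finite M" and on: "\<And>m n. m \<in> M \<Longrightarrow> n \<in> M \<Longrightarrow> e m \<bullet> e n = (if m = n then 1 else 0)"
    and S: "finite S" and q: "\<And>m. m \<in> M \<Longrightarrow> q m \<in> span S"
    and qe: "\<And>m s. m \<in> M \<Longrightarrow> s \<in> span S \<Longrightarrow> q m \<bullet> s = e m \<bullet> s"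
  shows "(\<Sum>m\<in>M. (norm (q m))\<^sup>2) \<le> real (card S)"
proof -
  obtain C0 where C0: "finite C0" "card C0 \<le> card S" "span C0 = span S" "pairwise orthogonal C0"
    using basis_orthogonal[OF S] by blast
  define C where "C = C0 - {0}"
  have C: "finite C" "card C \<le> card S" "span C = span S"
    using C0 card_mono[of C0 C] by (auto simp: C_def span_delete_0)
  have orth: "c \<bullet> d = 0" if "c \<in> C" "d \<in> C" "c \<noteq> d" for c d
    using C0(4) that by (auto simp: C_def pairwise_def orthogonal_def)
  have nz: "c \<noteq> 0" if "c \<in> C" for c using that by (auto simp: C_def)
  have expand: "(norm v)\<^sup>2 = (\<Sum>c\<in>C. (v \<bullet> c)\<^sup>2 / (norm c)\<^sup>2)" if "v \<in> span S" for v
  proof -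
    define p where "p = (\<Sum>c\<in>C. ((v \<bullet> c) / (norm c)\<^sup>2) *\<^sub>R c)"
    have pc: "p \<bullet> d = v \<bullet> d" if d: "d \<in> C" for d
    proof -
      have "p \<bullet> d = (\<Sum>c\<in>C. ((v \<bullet> c) / (norm c)\<^sup>2) * (c \<bullet> d))" by (simp add: p_def inner_sum_left)
      also have "\<dots> = (\<Sum>c\<in>C. if c = d then v \<bullet> d else 0)"
        using d nz by (intro sum.cong refl) (auto simp: orth power2_norm_eq_inner)
      finally show ?thesis using C d by simp
    qed
    have "v - p \<in> span C"
      unfolding p_def by (intro span_diff span_sum span_scale) (use that C in \<open>auto intro: span_base\<close>)
    moreover have "span C \<subseteq> {w. (v - p) \<bullet> w = 0}"
      by (rule span_minimal) (auto simp: pc inner_diff_left inner_diff_right subspace_def inner_add_right)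
    ultimately have "(v - p) \<bullet> (v - p) = 0" by blast
    then have "v = p" by simp
    then have "(norm v)\<^sup>2 = v \<bullet> p" by (simp add: power2_norm_eq_inner)
    also have "\<dots> = (\<Sum>c\<in>C. (v \<bullet> c)\<^sup>2 / (norm c)\<^sup>2)" by (simp add: p_def inner_sum_right power2_eq_square)
    finally show ?thesis .
  qed
  have "(\<Sum>m\<in>M. (norm (q m))\<^sup>2) = (\<Sum>m\<in>M. \<Sum>c\<in>C. (e m \<bullet> c)\<^sup>2 / (norm c)\<^sup>2)"
  proof (intro sum.cong refl)
    fix m assume m: "m \<in> M"
    have "q m \<bullet> c = e m \<bullet> c" if "c \<in> C" for c using qe[OF m] span_base[OF that] C(3) by simp
    then show "(norm (q m))\<^sup>2 = (\<Sum>c\<in>C. (e m \<bullet> c)\<^sup>2 / (norm c)\<^sup>2)" by (simp add: expand[OF q[OF m]])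
  qed
  also have "\<dots> = (\<Sum>c\<in>C. (\<Sum>m\<in>M. (e m \<bullet> c)\<^sup>2) / (norm c)\<^sup>2)"
    by (subst sum.swap) (simp add: sum_divide_distrib)
  also have "\<dots> \<le> (\<Sum>c\<in>C. 1)"
    using bessel[OF M on] nz by (intro sum_mono) (auto simp: divide_le_eq)
  also have "\<dots> \<le> real (card S)" using C by simp
  finally show ?thesis .
qed

section \<open>Real square summable functions\<close>

typedef 's l2 = "{f :: 's \<Rightarrow> real. (\<lambda>x. (f x)\<^sup>2) summable_on UNIV}"
  morphisms coef Abs_l2
  by (rule exI[of _ "\<lambda>_. 0"]) simp

setup_lifting type_definition_l2

lemma coef_sq_summable: "(\<lambda>x. (coef f x)\<^sup>2) summable_on X"
  using coef[of f] by (auto intro: summable_on_subset_banach)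

lemma coef_Abs: "(\<lambda>x. (f x)\<^sup>2) summable_on UNIV \<Longrightarrow> coef (Abs_l2 f) = f"
  by (simp add: Abs_l2_inverse)

lemma l2_eqI: "(\<And>x. coef f x = coef g x) \<Longrightarrow> f = g"
  by (rule coef_inject[THEN iffD1], rule ext)

lemma square_summable_add:
  fixes f g :: "'s \<Rightarrow> real"
  assumes "(\<lambda>x. (f x)\<^sup>2) summable_on X" "(\<lambda>x. (g x)\<^sup>2) summable_on X"
  shows "(\<lambda>x. (f x + g x)\<^sup>2) summable_on X"
proof (rule summable_on_comparison_test)
  show "(\<lambda>x. 2 * (f x)\<^sup>2 + 2 * (g x)\<^sup>2) summable_on X"
    by (intro summable_on_add summable_on_cmult_right assms)
  show "(f x + g x)\<^sup>2 \<le> 2 * (f x)\<^sup>2 + 2 * (g x)\<^sup>2" for x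
    using sum_squares_ge_zero[of "f x - g x" 0] by (simp add: power2_eq_square algebra_simps)
qed auto

lemma square_summable_mult:
  fixes f g :: "'s \<Rightarrow> real"
  assumes "(\<lambda>x. (f x)\<^sup>2) summable_on X" "(\<lambda>x. (g x)\<^sup>2) summable_on X"
  shows "(\<lambda>x. f x * g x) summable_on X"
proof -
  have "(\<lambda>x. norm (f x * g x)) summable_on X"
  proof (rule summable_on_comparison_test)
    show "(\<lambda>x. (f x)\<^sup>2 + (g x)\<^sup>2) summable_on X" by (intro summable_on_add assms)
    show "norm (f x * g x) \<le> (f x)\<^sup>2 + (g x)\<^sup>2" for x
    proof -
      have "0 \<le> \<bar>f x\<bar> * \<bar>g x\<bar>" by simp
      then show ?thesis using sum_squares_bound[of "\<bar>f x\<bar>" "\<bar>g x\<bar>"]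
        unfolding real_norm_def abs_mult power2_abs by linarith
    qed
  qed auto
  then show ?thesis by (rule abs_summable_summable)
qed

instantiation l2 :: (type) real_vector
begin

lift_definition zero_l2 :: "'a l2" is "\<lambda>_. 0" by simp
lift_definition plus_l2 :: "'a l2 \<Rightarrow> 'a l2 \<Rightarrow> 'a l2" is "\<lambda>f g x. f x + g x"
  by (rule square_summable_add)
lift_definition uminus_l2 :: "'a l2 \<Rightarrow> 'a l2" is "\<lambda>f x. - f x" by simp
lift_definition minus_l2 :: "'a l2 \<Rightarrow> 'a l2 \<Rightarrow> 'a l2" is "\<lambda>f g x. f x - g x"
  using square_summable_add[of _ UNIV "\<lambda>x. - _ x"] by simp
lift_definition scaleR_l2 :: "real \<Rightarrow> 'a l2 \<Rightarrow> 'a l2" is "\<lambda>r f x. r * f x"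
  by (simp add: power_mult_distrib summable_on_cmult_right)

instance
  by standard (transfer, simp add: algebra_simps)+

end

lemmas coef_simps [simp] = zero_l2.rep_eq plus_l2.rep_eq uminus_l2.rep_eq minus_l2.rep_eq scaleR_l2.rep_eq

instantiation l2 :: (type) real_inner
begin

definition inner_l2 :: "'a l2 \<Rightarrow> 'a l2 \<Rightarrow> real"
  where "inner_l2 f g = (\<Sum>\<^sub>\<infinity>x. coef f x * coef g x)"
definition norm_l2 :: "'a l2 \<Rightarrow> real"
  where "norm_l2 f = sqrt (inner f f)"
definition dist_l2 :: "'a l2 \<Rightarrow> 'a l2 \<Rightarrow> real"
  where "dist_l2 f g = norm (f - g)"
definition sgn_l2 :: "'a l2 \<Rightarrow> 'a l2"
  where "sgn_l2 f = f /\<^sub>R norm f"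
definition uniformity_l2 :: "('a l2 \<times> 'a l2) filter"
  where "uniformity_l2 = (INF e\<in>{0 <..}. principal {(x, y). dist x y < e})"
definition open_l2 :: "'a l2 set \<Rightarrow> bool"
  where "open_l2 U = (\<forall>x\<in>U. eventually (\<lambda>(x', y). x' = x \<longrightarrow> y \<in> U) uniformity)"

instance
proof
  fix x y z :: "'a l2" and r s :: real
  have mult: "(\<lambda>i. coef f i * coef g i) summable_on UNIV" for f g :: "'a l2"
    by (intro square_summable_mult coef_sq_summable)
  show "sgn x = x /\<^sub>R norm x" by (simp add: sgn_l2_def)
  show "dist x y = norm (x - y)" by (simp add: dist_l2_def)
  show "(uniformity :: ('a l2 \<times> 'a l2) filter) = (INF e\<in>{0 <..}. principal {(x, y). dist x y < e})"
    by (simp add: uniformity_l2_def)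
  show "open U = (\<forall>x\<in>U. eventually (\<lambda>(x', y). x' = x \<longrightarrow> y \<in> U) uniformity)" for U :: "'a l2 set"
    by (simp add: open_l2_def)
  show "inner x y = inner y x" by (simp add: inner_l2_def mult.commute)
  show "inner (x + y) z = inner x z + inner y z"
    using infsum_add[OF mult[of x z] mult[of y z]] by (simp add: inner_l2_def algebra_simps)
  show "inner (r *\<^sub>R x) y = r * inner x y"
    by (simp add: inner_l2_def mult.assoc infsum_cmult_right')
  show "0 \<le> inner x x" by (simp add: inner_l2_def infsum_nonneg)
  show "(inner x x = 0) = (x = 0)"
  proof
    assume "inner x x = 0"
    then have "coef x i * coef x i = 0" for i
      by (intro nonneg_infsum_le_0D[where A = UNIV]) (auto simp: inner_l2_def mult)
    then show "x = 0" by (intro l2_eqI) simp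
  qed (simp add: inner_l2_def)
  show "norm x = sqrt (inner x x)" by (simp add: norm_l2_def)
qed

end

lemma has_sum_inner_l2: "((\<lambda>x. coef f x * coef g x) has_sum (f \<bullet> g)) UNIV"
  unfolding inner_l2_def by (intro has_sum_infsum square_summable_mult coef_sq_summable)

lemma has_sum_norm_l2: "((\<lambda>x. (coef f x)\<^sup>2) has_sum (norm f)\<^sup>2) UNIV"
  using has_sum_inner_l2[of f f] by (simp add: power2_norm_eq_inner flip: power2_eq_square)

lemma sum_sq_le_norm_l2: "finite X \<Longrightarrow> (\<Sum>x\<in>X. (coef f x)\<^sup>2) \<le> (norm f)\<^sup>2"
  using finite_sum_le_has_sum[OF has_sum_norm_l2, of X f] by auto

lemma abs_coef_le_norm: "\<bar>coef f x\<bar> \<le> norm f"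
  using sum_sq_le_norm_l2[of "{x}" f] by (simp add: abs_le_square_iff[symmetric])

lemma norm_l2_le:
  assumes "\<And>X. finite X \<Longrightarrow> (\<Sum>x\<in>X. (coef f x)\<^sup>2) \<le> e\<^sup>2" "0 \<le> e"
  shows "norm f \<le> e"
proof (rule power2_le_imp_le)
  show "(norm f)\<^sup>2 \<le> e\<^sup>2"
    by (rule has_sum_le_finite_sums[OF has_sum_norm_l2]) (rule assms(1))
qed fact

lemma square_summableI:
  fixes f :: "'s \<Rightarrow> real"
  assumes "\<And>X. finite X \<Longrightarrow> (\<Sum>x\<in>X. (f x)\<^sup>2) \<le> e"
  shows "(\<lambda>x. (f x)\<^sup>2) summable_on UNIV"
  by (rule nonneg_bdd_above_summable_on) (auto intro!: bdd_aboveI[of _ e] assms)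

instance l2 :: (type) complete_space
proof
  fix s :: "nat \<Rightarrow> 'a l2" assume C: "Cauchy s"
  have "Cauchy (\<lambda>n. coef (s n) x)" for x
  proof (rule CauchyI)
    fix e :: real assume "e > 0"
    then obtain N where N: "\<And>m n. m \<ge> N \<Longrightarrow> n \<ge> N \<Longrightarrow> norm (s m - s n) < e" using CauchyD[OF C] by blast
    have "norm (coef (s m) x - coef (s n) x) < e" if "m \<ge> N" "n \<ge> N" for m n
      using N[OF that] abs_coef_le_norm[of "s m - s n" x] by simp
    then show "\<exists>M. \<forall>m\<ge>M. \<forall>n\<ge>M. norm (coef (s m) x - coef (s n) x) < e" by blast
  qed
  then obtain l where l: "\<And>x. (\<lambda>n. coef (s n) x) \<longlonglongrightarrow> l x"
    unfolding Cauchy_convergent_iff convergent_def by metis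
  have bound: "(\<Sum>x\<in>X. (coef (s m) x - l x)\<^sup>2) \<le> e\<^sup>2"
    if N: "\<And>n. n \<ge> N \<Longrightarrow> norm (s m - s n) < e" and "finite X" for e N m X
  proof (rule LIMSEQ_le_const2)
    show "(\<lambda>n. \<Sum>x\<in>X. (coef (s m) x - coef (s n) x)\<^sup>2) \<longlonglongrightarrow> (\<Sum>x\<in>X. (coef (s m) x - l x)\<^sup>2)"
      by (intro tendsto_intros l)
    have "(\<Sum>x\<in>X. (coef (s m) x - coef (s n) x)\<^sup>2) \<le> e\<^sup>2" if "n \<ge> N" for n
    proof -
      have "(norm (s m - s n))\<^sup>2 \<le> e\<^sup>2" using N[OF that] by (simp add: power_mono)
      then show ?thesis using sum_sq_le_norm_l2[OF \<open>finite X\<close>, of "s m - s n"] by simp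
    qed
    then show "\<exists>N. \<forall>n\<ge>N. (\<Sum>x\<in>X. (coef (s m) x - coef (s n) x)\<^sup>2) \<le> e\<^sup>2" by blast
  qed
  obtain N1 where N1: "\<And>m n. m \<ge> N1 \<Longrightarrow> n \<ge> N1 \<Longrightarrow> norm (s m - s n) < 1" using CauchyD[OF C, of 1] by auto
  have "(\<lambda>x. (coef (s N1) x - l x)\<^sup>2) summable_on UNIV"
    by (rule square_summableI[of _ "1\<^sup>2"]) (rule bound[of N1], use N1 in auto)
  then have "(\<lambda>x. (coef (s N1) x + - (coef (s N1) x - l x))\<^sup>2) summable_on UNIV"
    by (intro square_summable_add coef_sq_summable) (simp only: power2_minus)
  then have L: "coef (Abs_l2 l) = l" by (intro coef_Abs) simp
  have "s \<longlonglongrightarrow> Abs_l2 l"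
  proof (rule LIMSEQ_I)
    fix e :: real assume e: "e > 0"
    then obtain N where N: "\<And>m n. m \<ge> N \<Longrightarrow> n \<ge> N \<Longrightarrow> norm (s m - s n) < e / 2"
      using CauchyD[OF C, of "e / 2"] by auto
    have "norm (s m - Abs_l2 l) < e" if "m \<ge> N" for m
    proof -
      have "norm (s m - Abs_l2 l) \<le> e / 2"
        by (rule norm_l2_le) (use e bound[of N m "e / 2"] N that in \<open>auto simp: L\<close>)
      then show ?thesis using e by simp
    qed
    then show "\<exists>no. \<forall>n\<ge>no. norm (s n - Abs_l2 l) < e" by blast
  qed
  then show "convergent s" by (auto simp: convergent_def)
qed

lift_definition delta :: "'s \<Rightarrow> 's l2" is "\<lambda>y x. if x = y then 1 else 0"
  by (rule summable_on_cong_neutral[THEN iffD1, of UNIV "{y}" for y, rotated 3, of "\<lambda>_. 1"]) (auto simp: summable_on_finite)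

lemma coef_delta: "coef (delta y) x = (if x = y then 1 else 0)"
  by (simp add: delta.rep_eq)

lemma inner_delta [simp]: "f \<bullet> delta x = coef f x" "delta x \<bullet> f = coef f x"
proof -
  have "((\<lambda>y. coef f y * coef (delta x) y) has_sum (coef f x)) UNIV"
    by (rule has_sum_cong_neutral[where S = "{x}" and f = "\<lambda>_. coef f x", THEN iffD1])
       (auto simp: coef_delta intro: has_sum_finiteI)
  then show "f \<bullet> delta x = coef f x" using has_sum_inner_l2 has_sum_unique by blast
  then show "delta x \<bullet> f = coef f x" by (simp add: inner_commute)
qed

lemma norm_delta [simp]: "norm (delta x) = 1"
  by (simp add: norm_eq_sqrt_inner coef_delta)

lemma delta_orthonormal: "delta x \<bullet> delta y = (if x = y then 1 else 0)"
  by (auto simp: coef_delta)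

lift_definition cut :: "'s set \<Rightarrow> 's l2 \<Rightarrow> 's l2" is "\<lambda>X f x. if x \<in> X then f x else 0"
  by (rule summable_on_comparison_test) auto

definition supp_in :: "'s set \<Rightarrow> 's l2 set"
  where "supp_in X = {f. \<forall>x. x \<notin> X \<longrightarrow> coef f x = 0}"

lemmas coef_cut [simp] = cut.rep_eq

lemma cut_in [simp]: "cut X f \<in> supp_in X" by (simp add: supp_in_def)

lemma cut_id: "f \<in> supp_in X \<Longrightarrow> cut X f = f"
  by (rule l2_eqI) (auto simp: supp_in_def)

lemma cut_linear: "linear (cut X)"
  by (rule linearI) (auto intro!: l2_eqI)

lemmas cut_add = linear_add[OF cut_linear] and cut_diff = linear_diff[OF cut_linear]
  and cut_scale = linear_scale[OF cut_linear] and cut_0 [simp] = linear_0[OF cut_linear]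

lemma cut_cut [simp]: "cut X (cut Y f) = cut (X \<inter> Y) f"
  by (rule l2_eqI) auto

lemma cut_sym: "cut X f \<bullet> g = f \<bullet> cut X g"
proof -
  have "(\<lambda>x. coef (cut X f) x * coef g x) = (\<lambda>x. coef f x * coef (cut X g) x)" by auto
  then show ?thesis by (simp add: inner_l2_def)
qed

lemma cut_norm: "norm (cut X f) \<le> norm f"
proof (rule norm_l2_le)
  fix Y :: "'a set" assume "finite Y"
  have "(\<Sum>x\<in>Y. (coef (cut X f) x)\<^sup>2) \<le> (\<Sum>x\<in>Y. (coef f x)\<^sup>2)" by (rule sum_mono) auto
  also have "\<dots> \<le> (norm f)\<^sup>2" by (rule sum_sq_le_norm_l2) fact
  finally show "(\<Sum>x\<in>Y. (coef (cut X f) x)\<^sup>2) \<le> (norm f)\<^sup>2" .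
qed simp

lemma cut_disjoint: "X \<inter> Y = {} \<Longrightarrow> cut (X \<union> Y) f = cut X f + cut Y f"
  by (rule l2_eqI) auto

lemma supp_in_mono: "f \<in> supp_in X \<Longrightarrow> X \<subseteq> Y \<Longrightarrow> f \<in> supp_in Y"
  by (auto simp: supp_in_def)

lemma supp_inD: "f \<in> supp_in X \<Longrightarrow> y \<notin> X \<Longrightarrow> coef f y = 0"
  by (simp add: supp_in_def)

lemma delta_in: "x \<in> X \<Longrightarrow> delta x \<in> supp_in X"
  by (auto simp: supp_in_def coef_delta)

lemma bounded_linear_coef: "bounded_linear (\<lambda>f. coef f x)"
  using bounded_linear_inner_left[of "delta x"] by simp

text \<open>Every closed subspace below is the common kernel of a family of continuous functionals.\<close>

lemma closed_subspace_kernels: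
  assumes "\<And>h. h \<in> \<F> \<Longrightarrow> bounded_linear h"
  shows "closed_subspace {f :: 'h::{real_inner,complete_space}. \<forall>h\<in>\<F>. h f = (0::real)}"
proof
  show "subspace {f. \<forall>h\<in>\<F>. h f = 0}"
    using assms[THEN bounded_linear.linear]
    by (auto simp: subspace_def linear_add linear_scale linear_0)
  have "closed (h -` {0})" if "h \<in> \<F>" for h
    by (intro continuous_closed_vimage linear_continuous_at assms that) simp
  moreover have "{f. \<forall>h\<in>\<F>. h f = 0} = (\<Inter>h\<in>\<F>. h -` {0})" by auto
  ultimately show "closed {f. \<forall>h\<in>\<F>. h f = 0}" by (simp add: closed_INT)
qed

lemma closed_subspace_supp_in: "closed_subspace (supp_in X)"
proof -
  have "supp_in X = {f. \<forall>h\<in>(\<lambda>x f. coef f x) ` (- X). h f = 0}" by (auto simp: supp_in_def)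
  also have "closed_subspace \<dots>" by (rule closed_subspace_kernels) (auto simp: bounded_linear_coef)
  finally show ?thesis .
qed

text \<open>This excludes vectors that are invariant under an infinite group of translations.\<close>

lemma l2_infinite_constant:
  assumes "infinite Y" "\<And>y. y \<in> Y \<Longrightarrow> coef f y = v"
  shows "v = 0"
proof (rule ccontr)
  assume "v \<noteq> 0"
  obtain n :: nat where n: "(norm f)\<^sup>2 < real n * v\<^sup>2"
    using \<open>v \<noteq> 0\<close> ex_less_of_nat_mult[of "v\<^sup>2" "(norm f)\<^sup>2"] by auto
  obtain X where X: "X \<subseteq> Y" "finite X" "card X = n" using infinite_arbitrarily_large[OF assms(1)] by blast
  have "(\<Sum>x\<in>X. (coef f x)\<^sup>2) = (\<Sum>x\<in>X. v\<^sup>2)" using X assms(2) by (intro sum.cong) auto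
  with sum_sq_le_norm_l2[OF X(2), of f] n X show False by simp
qed

section \<open>Translation by group elements\<close>

text \<open>The left regular representation on each column \<open>k\<close>. The value \<open>0\<close> outside the carrier makes it a
partial isometry of the whole space, with adjoint the translation by the inverse.\<close>

definition translate :: "('a, 'm) monoid_scheme \<Rightarrow> 'a \<Rightarrow> ('a \<times> 'k) l2 \<Rightarrow> ('a \<times> 'k) l2"
  where "translate G g f =
    Abs_l2 (\<lambda>(x, k). if x \<in> carrier G then coef f (inv\<^bsub>G\<^esub> g \<otimes>\<^bsub>G\<^esub> x, k) else 0)"

context group
begin

lemma coef_translate:
  fixes f :: "('a \<times> 'k) l2"
  assumes "g \<in> carrier G"
  shows "coef (translate G g f) (x, k) = (if x \<in> carrier G then coef f (inv g \<otimes> x, k) else 0)"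
proof -
  define p where "p = (\<lambda>(x, k :: 'k). (inv g \<otimes> x, k))"
  have inj: "inj_on p (carrier G \<times> UNIV)"
    by (rule inj_onI) (use assms in \<open>auto simp: p_def\<close>)
  have "(\<lambda>y. (case y of (x, k) \<Rightarrow> if x \<in> carrier G then coef f (inv g \<otimes> x, k) else 0)\<^sup>2) summable_on UNIV"
  proof (rule square_summableI)
    fix X :: "('a \<times> 'k) set" assume X: "finite X"
    let ?Y = "X \<inter> carrier G \<times> UNIV"
    have "(\<Sum>y\<in>X. (case y of (x, k) \<Rightarrow> if x \<in> carrier G then coef f (inv g \<otimes> x, k) else 0)\<^sup>2)
        = (\<Sum>y\<in>?Y. (coef f (p y))\<^sup>2)"
      using X by (intro sum.mono_neutral_cong_right) (auto simp: p_def split: if_splits)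
    also have "\<dots> = (\<Sum>y\<in>p ` ?Y. (coef f y)\<^sup>2)"
      by (subst sum.reindex) (auto intro: inj_on_subset[OF inj])
    also have "\<dots> \<le> (norm f)\<^sup>2" using X by (intro sum_sq_le_norm_l2) auto
    finally show "(\<Sum>y\<in>X. (case y of (x, k) \<Rightarrow> if x \<in> carrier G then coef f (inv g \<otimes> x, k) else 0)\<^sup>2)
      \<le> (norm f)\<^sup>2" .
  qed
  from coef_Abs[OF this] show ?thesis by (simp add: translate_def)
qed

lemma translate_linear: "g \<in> carrier G \<Longrightarrow> linear (translate G g)"
  by (rule linearI) (auto intro!: l2_eqI simp: coef_translate)

lemma translate_translate:
  "g \<in> carrier G \<Longrightarrow> h \<in> carrier G \<Longrightarrow> translate G g (translate G h f) = translate G (g \<otimes> h) f"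
  by (auto intro!: l2_eqI simp: coef_translate inv_mult_group m_assoc)

lemma translate_one: "translate G \<one> f = cut (carrier G \<times> UNIV) f"
  by (auto intro!: l2_eqI simp: coef_translate)

lemma translate_inner:
  fixes f h :: "('a \<times> 'k) l2"
  assumes "g \<in> carrier G"
  shows "translate G g f \<bullet> h = f \<bullet> translate G (inv g) h"
proof -
  let ?C = "carrier G \<times> (UNIV :: 'k set)"
  have "((\<lambda>y. coef (translate G g f) y * coef h y) has_sum (translate G g f \<bullet> h)) ?C"
    by (rule has_sum_cong_neutral[where S = UNIV, THEN iffD1, OF _ _ _ has_sum_inner_l2])
       (auto simp: coef_translate assms split: if_splits)
  moreover have "((\<lambda>y. coef f y * coef (translate G (inv g) h) y) has_sum (f \<bullet> translate G (inv g) h)) ?C"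
    by (rule has_sum_cong_neutral[where S = UNIV, THEN iffD1, OF _ _ _ has_sum_inner_l2])
       (auto simp: coef_translate assms split: if_splits)
  moreover have "((\<lambda>y. coef (translate G g f) y * coef h y) has_sum s) ?C
      \<longleftrightarrow> ((\<lambda>y. coef f y * coef (translate G (inv g) h) y) has_sum s) ?C" for s
    by (rule has_sum_reindex_bij_witness[where i = "\<lambda>(x, k). (g \<otimes> x, k)" and j = "\<lambda>(x, k). (inv g \<otimes> x, k)"])
       (auto simp: coef_translate assms m_assoc[symmetric])
  ultimately show ?thesis using has_sum_unique by blast
qed

lemma translate_inner_inv:
  "g \<in> carrier G \<Longrightarrow> f \<bullet> translate G g h = translate G (inv g) f \<bullet> h"
  by (simp add: translate_inner)

lemma translate_norm:
  assumes "g \<in> carrier G" "f \<in> supp_in (carrier G \<times> UNIV)"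
  shows "norm (translate G g f) = norm f"
  using assms by (simp add: norm_eq_sqrt_inner translate_inner translate_translate translate_one cut_id)

lemma translate_in:
  "g \<in> carrier G \<Longrightarrow> f \<in> supp_in (carrier G \<times> A) \<Longrightarrow> translate G g f \<in> supp_in (carrier G \<times> A)"
  by (auto simp: supp_in_def coef_translate)

lemma translate_delta:
  "g \<in> carrier G \<Longrightarrow> x \<in> carrier G \<Longrightarrow> translate G g (delta (x, k)) = delta (g \<otimes> x, k)"
  by (rule l2_eqI) (auto simp: coef_translate coef_delta m_assoc[symmetric] split: if_splits)

lemma translate_cut:
  "g \<in> carrier G \<Longrightarrow> cut (carrier G \<times> A) (translate G g f) = translate G g (cut (carrier G \<times> A) f)"
  by (rule l2_eqI) (auto simp: coef_translate split: if_splits)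

lemma proj_translate:
  assumes D: "closed_subspace D" and inv: "\<And>g f. g \<in> carrier G \<Longrightarrow> f \<in> D \<Longrightarrow> translate G g f \<in> D"
    and g: "g \<in> carrier G"
  shows "proj D (translate G g f) = translate G g (proj D f)"
proof -
  interpret closed_subspace D by fact
  show ?thesis
    by (rule proj_unique) (use g inv in \<open>auto simp: translate_inner proj_inner\<close>)
qed

end

section \<open>Von Neumann dimension\<close>

text \<open>The corner of the projection onto \<open>D\<close> that belongs to the coordinates in \<open>X\<close>.\<close>

definition compress :: "'s set \<Rightarrow> 's l2 set \<Rightarrow> 's l2 \<Rightarrow> 's l2"
  where "compress X D v = cut X (proj D (cut X v))"

lemma compress_inner:
  assumes "closed_subspace D"
  shows "compress X D v \<bullet> v = (norm (proj D (cut X v)))\<^sup>2"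
proof -
  interpret closed_subspace D by fact
  show ?thesis by (simp add: compress_def cut_sym proj_norm_sq)
qed

lemma compress_positive_contraction:
  assumes "closed_subspace D"
  shows "positive_contraction (compress X D)"
proof -
  interpret closed_subspace D by fact
  show ?thesis
  proof (rule positive_contraction.intro)
    show "linear (compress X D)"
      by (rule linearI) (simp_all add: compress_def cut_add cut_scale proj_add proj_scale)
    show "compress X D x \<bullet> y = x \<bullet> compress X D y" for x y
      by (simp add: compress_def cut_sym proj_sym)
    show "(norm (compress X D x))\<^sup>2 \<le> compress X D x \<bullet> x" for x
      unfolding compress_inner[OF assms] by (simp add: compress_def cut_norm power_mono)
  qed
qed

lemma co_compress_positive_contraction:
  assumes "closed_subspace D"
  shows "positive_contraction (\<lambda>v. cut X v - compress X D v)"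
proof -
  interpret A: positive_contraction "compress X D" by (rule compress_positive_contraction[OF assms])
  show ?thesis
  proof (rule positive_contraction.intro)
    show "linear (\<lambda>v. cut X v - compress X D v)"
      using cut_linear A.linear by (rule linear_compose_sub)
    show "(cut X x - compress X D x) \<bullet> y = x \<bullet> (cut X y - compress X D y)" for x y
      by (simp add: inner_diff_left inner_diff_right A.sym cut_sym)
    show "(norm (cut X x - compress X D x))\<^sup>2 \<le> (cut X x - compress X D x) \<bullet> x" for x
    proof -
      have 1: "cut X x \<bullet> compress X D x = compress X D x \<bullet> x"
        by (simp add: cut_sym compress_def inner_commute)
      have 2: "cut X x \<bullet> x = (norm (cut X x))\<^sup>2"
        using cut_sym[of X x "cut X x"] by (simp add: power2_norm_eq_inner inner_commute)
      show ?thesis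
        using A.firm[of x] 1 2 by (simp add: norm_diff_sq inner_diff_left)
    qed
  qed
qed

context group
begin

text \<open>Traciality: up to adjoints, both sides are the trace of the product of \<open>U\<close> and the adjoint of \<open>V\<close>,
on the columns \<open>I\<close> and on the columns \<open>J\<close>. Equivariance identifies the \<open>(x, j)\<close> coefficient of
\<open>U\<close> at the unit vector of column \<open>i\<close> with the \<open>(x\<inverse>, i)\<close> coefficient of the adjoint at the unit
vector of column \<open>j\<close>. Finiteness of \<open>I\<close> makes all sums converge.\<close>

lemma trace_swap:
  fixes U V :: "('a \<times> 'k) l2 \<Rightarrow> ('a \<times> 'k) l2"
  assumes I: "finite I"
    and adjU: "\<And>x y. U x \<bullet> y = x \<bullet> U' y" and adjV: "\<And>x y. V x \<bullet> y = x \<bullet> V' y"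
    and eqU: "\<And>g x. g \<in> carrier G \<Longrightarrow> U' (translate G g x) = translate G g (U' x)"
    and eqV: "\<And>g x. g \<in> carrier G \<Longrightarrow> V' (translate G g x) = translate G g (V' x)"
    and rU: "\<And>x. U x \<in> supp_in (carrier G \<times> J)" and rU': "\<And>x. U' x \<in> supp_in (carrier G \<times> I)"
  shows "((\<lambda>j. U' (delta (\<one>, j)) \<bullet> V' (delta (\<one>, j))) has_sum
          (\<Sum>i\<in>I. U (delta (\<one>, i)) \<bullet> V (delta (\<one>, i)))) J"
proof -
  define g where "g i j x = coef (U' (delta (\<one>, j))) (x, i) * coef (V' (delta (\<one>, j))) (x, i)" for i j x
  have co: "coef (W (delta (\<one>, i))) (x, j) = coef (W' (delta (\<one>, j))) (inv x, i)"
    if adj: "\<And>x y. W x \<bullet> y = x \<bullet> W' y" and eq: "\<And>g x. g \<in> carrier G \<Longrightarrow> W' (translate G g x) = translate G g (W' x)"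
      and x: "x \<in> carrier G" for W W' :: "('a \<times> 'k) l2 \<Rightarrow> ('a \<times> 'k) l2" and x i j
  proof -
    have "coef (W (delta (\<one>, i))) (x, j) = W (delta (\<one>, i)) \<bullet> delta (x, j)" by simp
    also have "\<dots> = delta (\<one>, i) \<bullet> W' (translate G x (delta (\<one>, j)))"
      using x by (simp only: adj translate_delta one_closed r_one)
    also have "\<dots> = coef (W' (delta (\<one>, j))) (inv x, i)"
      using x by (simp only: eq) (simp add: coef_translate)
    finally show ?thesis .
  qed
  have T: "((\<lambda>j. \<Sum>\<^sub>\<infinity>x\<in>carrier G. g i j x) has_sum (U (delta (\<one>, i)) \<bullet> V (delta (\<one>, i)))) J" for i
  proof -
    have "((\<lambda>y. coef (U (delta (\<one>, i))) y * coef (V (delta (\<one>, i))) y)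
        has_sum (U (delta (\<one>, i)) \<bullet> V (delta (\<one>, i)))) (carrier G \<times> J)"
      by (rule has_sum_cong_neutral[where S = UNIV, THEN iffD1, OF _ _ _ has_sum_inner_l2])
         (use rU in \<open>auto simp: supp_in_def\<close>)
    then have "((\<lambda>(j, x). g i j x) has_sum (U (delta (\<one>, i)) \<bullet> V (delta (\<one>, i)))) (J \<times> carrier G)"
      by (subst has_sum_reindex_bij_witness[where i = "\<lambda>(x, j). (j, inv x)" and j = "\<lambda>(j, x). (inv x, j)"
            and T = "carrier G \<times> J" and h = "\<lambda>y. coef (U (delta (\<one>, i))) y * coef (V (delta (\<one>, i))) y"])
         (auto simp: g_def co[OF adjU eqU] co[OF adjV eqV])
    then show ?thesis
      using infsum_Sigma'_banach[of "\<lambda>j x. g i j x" J "\<lambda>_. carrier G"]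
        summable_on_Sigma_banach[of "\<lambda>j x. g i j x" J "\<lambda>_. carrier G"] by (auto simp: has_sum_iff)
  qed
  have S: "(\<Sum>i\<in>I. \<Sum>\<^sub>\<infinity>x\<in>carrier G. g i j x) = U' (delta (\<one>, j)) \<bullet> V' (delta (\<one>, j))" for j
  proof -
    have "((\<lambda>y. coef (U' (delta (\<one>, j))) y * coef (V' (delta (\<one>, j))) y)
        has_sum (U' (delta (\<one>, j)) \<bullet> V' (delta (\<one>, j)))) (carrier G \<times> I)"
      by (rule has_sum_cong_neutral[where S = UNIV, THEN iffD1, OF _ _ _ has_sum_inner_l2])
         (use rU' in \<open>auto simp: supp_in_def\<close>)
    then have *: "((\<lambda>(i, x). g i j x) has_sum (U' (delta (\<one>, j)) \<bullet> V' (delta (\<one>, j)))) (I \<times> carrier G)"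
      by (subst has_sum_reindex_bij_witness[where i = prod.swap and j = prod.swap and T = "carrier G \<times> I"
            and h = "\<lambda>y. coef (U' (delta (\<one>, j))) y * coef (V' (delta (\<one>, j))) y"])
         (auto simp: g_def)
    then have "((\<lambda>i. \<Sum>\<^sub>\<infinity>x\<in>carrier G. g i j x) has_sum (U' (delta (\<one>, j)) \<bullet> V' (delta (\<one>, j)))) I"
      using infsum_Sigma'_banach[of "\<lambda>i x. g i j x" I "\<lambda>_. carrier G"] I
      by (intro has_sum_finiteI) (auto simp: has_sum_iff)
    then show ?thesis using I by (simp add: has_sum_iff)
  qed
  have "((\<lambda>j. \<Sum>i\<in>I. \<Sum>\<^sub>\<infinity>x\<in>carrier G. g i j x) has_sum
      (\<Sum>i\<in>I. U (delta (\<one>, i)) \<bullet> V (delta (\<one>, i)))) J"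
    using I by (induction I rule: finite_induct) (auto intro: has_sum_add T)
  then show ?thesis by (simp only: S)
qed

end

lemma compress_fix_iff:
  assumes "closed_subspace D"
  shows "compress X D x = x \<longleftrightarrow> x \<in> D \<and> x \<in> supp_in X"
proof
  interpret closed_subspace D by fact
  assume x: "compress X D x = x"
  then have s: "x \<in> supp_in X" by (metis compress_def cut_in)
  have "(norm (x - proj D x))\<^sup>2 = (norm x)\<^sup>2 - (norm (proj D x))\<^sup>2"
    unfolding norm_diff_sq using proj_norm_sq[of x] by (simp add: inner_commute)
  also have "\<dots> = 0"
    using compress_inner[OF assms, of X x] x s by (simp add: cut_id power2_norm_eq_inner)
  finally have "x = proj D x" by simp
  then show "x \<in> D \<and> x \<in> supp_in X" using s proj_in[of x] by simp
next
  interpret closed_subspace D by fact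
  assume "x \<in> D \<and> x \<in> supp_in X"
  then show "compress X D x = x" by (simp add: compress_def cut_id proj_id)
qed

lemma co_compress_fix_iff:
  assumes "closed_subspace D"
  shows "cut X x - compress X D x = x \<longleftrightarrow> x \<in> supp_in X \<and> (\<forall>f\<in>D. x \<bullet> f = 0)"
proof
  interpret closed_subspace D by fact
  assume x: "cut X x - compress X D x = x"
  have "cut X (cut X x - compress X D x) = cut X x - compress X D x"
    by (simp add: cut_diff compress_def)
  then have s: "x \<in> supp_in X" using x by (metis cut_in)
  then have "compress X D x = 0" using x by (simp add: cut_id)
  then have "proj D x = 0" using compress_inner[OF assms, of X x] s by (simp add: cut_id)
  then show "x \<in> supp_in X \<and> (\<forall>f\<in>D. x \<bullet> f = 0)" using s proj_inner[of _ x] by simp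
next
  interpret closed_subspace D by fact
  assume "x \<in> supp_in X \<and> (\<forall>f\<in>D. x \<bullet> f = 0)"
  then show "cut X x - compress X D x = x" by (simp add: compress_def cut_id proj_zero)
qed

context group
begin

text \<open>The trace of an equivariant operator \<open>A\<close> on the columns \<open>I\<close> is the sum of \<open>A (unit_vec i) \<bullet> unit_vec i\<close>
over \<open>i \<in> I\<close>. The von Neumann dimension of an invariant subspace \<open>D\<close> is the trace of \<open>proj D\<close>,
that is, the sum of the squared norms of \<open>proj D (unit_vec i)\<close>.\<close>

abbreviation unit_vec :: "'k \<Rightarrow> ('a \<times> 'k) l2"
  where "unit_vec k \<equiv> delta (\<one>, k)"

lemma cut_unit_vec: "k \<in> A \<Longrightarrow> cut (carrier G \<times> A) (unit_vec k) = unit_vec k"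
  by (intro cut_id delta_in) simp

definition invariant_subspace :: "('a \<times> 'k) l2 set \<Rightarrow> bool"
  where "invariant_subspace D \<longleftrightarrow>
    closed_subspace D \<and> (\<forall>g\<in>carrier G. \<forall>f\<in>D. translate G g f \<in> D)"

text \<open>Let \<open>a\<close> and \<open>d\<close> be the corners of \<open>P = proj D\<close> on \<open>I\<close> and \<open>J\<close>, let \<open>N\<close> be its corner from \<open>I\<close>
to \<open>J\<close>, and put \<open>E = 1 - a\<close>. Reading \<open>P P = P\<close> in blocks gives \<open>N E = d N\<close>, \<open>N\<^sup>* N = E - E\<^sup>2\<close>
and \<open>N N\<^sup>* = d - d\<^sup>2\<close>. By traciality, \<open>E\<^sup>k N\<^sup>* N\<close> and \<open>d\<^sup>k N N\<^sup>*\<close> have the same trace, and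
the sum over \<open>k < n\<close> telescopes.\<close>

lemma trace_compression_identity:
  fixes D :: "('a \<times> 'k) l2 set"
  assumes D: "invariant_subspace D" and supp: "D \<subseteq> supp_in (carrier G \<times> (I \<union> J))"
    and disj: "I \<inter> J = {}" and I: "finite I"
  defines "E \<equiv> \<lambda>v. cut (carrier G \<times> I) v - compress (carrier G \<times> I) D v"
    and "d \<equiv> compress (carrier G \<times> J) D"
  shows "((\<lambda>j. (d (unit_vec j) - (d ^^ Suc n) (unit_vec j)) \<bullet> unit_vec j) has_sum
          (\<Sum>i\<in>I. (E (unit_vec i) - (E ^^ Suc n) (unit_vec i)) \<bullet> unit_vec i)) J"
proof -
  let ?cI = "cut (carrier G \<times> I)" and ?cJ = "cut (carrier G \<times> J)" and ?P = "proj D"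
  interpret D: closed_subspace D using D by (simp add: invariant_subspace_def)
  interpret E: positive_contraction E
    unfolding E_def by (rule co_compress_positive_contraction) unfold_locales
  interpret d: positive_contraction d
    unfolding d_def by (rule compress_positive_contraction) unfold_locales
  define N N' where "N = (\<lambda>v. ?cJ (?P (?cI v)))" and "N' = (\<lambda>v. ?cI (?P (?cJ v)))"
  have adj: "N x \<bullet> y = x \<bullet> N' y" for x y by (simp add: N_def N'_def cut_sym D.proj_sym)
  have adj': "N' x \<bullet> y = x \<bullet> N y" for x y by (simp add: N_def N'_def cut_sym D.proj_sym)
  have PP: "?P (?cI (?P v)) + ?P (?cJ (?P v)) = ?P v" for v
  proof -
    have "?cI (?P v) + ?cJ (?P v) = cut (carrier G \<times> (I \<union> J)) (?P v)"
      unfolding Sigma_Un_distrib2 by (rule cut_disjoint[symmetric]) (use disj in auto)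
    also have "\<dots> = ?P v" using supp D.proj_in by (intro cut_id) blast
    finally show ?thesis by (simp flip: D.proj_add)
  qed
  have PI: "?P (?cI (?P v)) = ?P v - ?P (?cJ (?P v))" for v
    using PP[of v] by (simp add: eq_diff_eq)
  have EN: "E (N' w) = N' (d w)" for w
    by (simp add: E_def N'_def d_def compress_def PI cut_diff)
  have NN': "N (N' w) = d w - d (d w)" for w
    by (simp add: N_def N'_def d_def compress_def PI cut_diff)
  have NN: "N' (N v) = E v - E (E v)" for v
    by (simp add: N_def N'_def E_def compress_def PI cut_diff D.proj_diff)
  have ENk: "(E ^^ k) (N' w) = N' ((d ^^ k) w)" for k w
    by (induction k arbitrary: w) (simp_all add: EN)
  have eqN: "N' (translate G g x) = translate G g (N' x)" if "g \<in> carrier G" for g x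
  proof -
    have "?P (translate G g y) = translate G g (?P y)" for y
      by (rule proj_translate) (use D that in \<open>auto simp: invariant_subspace_def\<close>)
    then show ?thesis using that by (simp add: N'_def translate_cut)
  qed
  have eqd: "d (translate G g x) = translate G g (d x)" if "g \<in> carrier G" for g x
  proof -
    have "?P (translate G g y) = translate G g (?P y)" for y
      by (rule proj_translate) (use D that in \<open>auto simp: invariant_subspace_def\<close>)
    then show ?thesis using that by (simp add: d_def compress_def translate_cut)
  qed
  have eqdk: "(d ^^ k) (translate G g x) = translate G g ((d ^^ k) x)" if "g \<in> carrier G" for g x k
    by (induction k) (simp_all add: eqd that)
  have step: "((\<lambda>j. ((d ^^ Suc k) (unit_vec j) - (d ^^ Suc (Suc k)) (unit_vec j)) \<bullet> unit_vec j) has_sum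
      (\<Sum>i\<in>I. ((E ^^ Suc k) (unit_vec i) - (E ^^ Suc (Suc k)) (unit_vec i)) \<bullet> unit_vec i)) J" for k
  proof -
    have "((\<lambda>j. N' ((d ^^ k) (unit_vec j)) \<bullet> N' (unit_vec j)) has_sum
      (\<Sum>i\<in>I. N ((E ^^ k) (unit_vec i)) \<bullet> N (unit_vec i))) J"
    proof (rule trace_swap[where U = "\<lambda>x. N ((E ^^ k) x)" and V = N and U' = "\<lambda>x. N' ((d ^^ k) x)" and V' = N'])
      show "N ((E ^^ k) x) \<bullet> y = x \<bullet> N' ((d ^^ k) y)" for x y
        by (simp add: adj E.pow_sym flip: ENk)
      show "N ((E ^^ k) x) \<in> supp_in (carrier G \<times> J)" for x by (simp add: N_def)
      show "N' ((d ^^ k) x) \<in> supp_in (carrier G \<times> I)" for x by (simp add: N'_def)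
    qed (use I in \<open>simp_all add: adj eqN eqdk\<close>)
    moreover have "N' ((d ^^ k) x) \<bullet> N' x = ((d ^^ Suc k) x - (d ^^ Suc (Suc k)) x) \<bullet> x" for x
    proof -
      have "N' ((d ^^ k) x) \<bullet> N' x = N (N' ((d ^^ k) x)) \<bullet> x" by (simp add: adj)
      then show ?thesis by (simp add: NN')
    qed
    moreover have "N ((E ^^ k) x) \<bullet> N x = ((E ^^ Suc k) x - (E ^^ Suc (Suc k)) x) \<bullet> x" for x
    proof -
      have "N ((E ^^ k) x) \<bullet> N x = N' (N ((E ^^ k) x)) \<bullet> x" by (simp add: adj')
      then show ?thesis by (simp add: NN)
    qed
    ultimately show ?thesis by simp
  qed
  show ?thesis
  proof (induction n)
    case (Suc n)
    show ?case
      using has_sum_add[OF Suc step[of n]] by (simp add: inner_diff_left sum_subtractf)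
  qed simp
qed

lemma trace_diag:
  assumes "closed_subspace D" "k \<in> A"
  shows "compress (carrier G \<times> A) D (unit_vec k) \<bullet> unit_vec k = (norm (proj D (unit_vec k)))\<^sup>2"
  using compress_inner[OF assms(1), of "carrier G \<times> A"] assms(2) by (simp only: cut_unit_vec)

text \<open>A subspace whose projection to the columns \<open>I\<close> is dense has dimension at least \<open>card I\<close>: density
says that \<open>E\<close> in the trace identity fixes no vector, so the traces of its powers tend to \<open>0\<close>.\<close>

lemma dim_ge_of_dense:
  fixes D :: "('a \<times> 'k) l2 set"
  assumes D: "invariant_subspace D" and supp: "D \<subseteq> supp_in (carrier G \<times> (I \<union> J))"
    and disj: "I \<inter> J = {}" and I: "finite I"
    and dense: "\<And>u. u \<in> supp_in (carrier G \<times> I) \<Longrightarrow> (\<And>f. f \<in> D \<Longrightarrow> u \<bullet> f = 0) \<Longrightarrow> u = 0"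
    and sum: "(\<lambda>j. (norm (proj D (unit_vec j)))\<^sup>2) summable_on J"
  shows "real (card I) \<le> (\<Sum>i\<in>I. (norm (proj D (unit_vec i)))\<^sup>2) + (\<Sum>\<^sub>\<infinity>j\<in>J. (norm (proj D (unit_vec j)))\<^sup>2)"
proof -
  define E where "E = (\<lambda>v. cut (carrier G \<times> I) v - compress (carrier G \<times> I) D v)"
  define d where "d = compress (carrier G \<times> J) D"
  have cD: "closed_subspace D" using D by (simp add: invariant_subspace_def)
  interpret E: positive_contraction E
    unfolding E_def by (rule co_compress_positive_contraction[OF cD])
  interpret d: positive_contraction d
    unfolding d_def by (rule compress_positive_contraction[OF cD])
  have fixE: "proj {x. E x = x} y = 0" for y
  proof -
    have "E (proj {x. E x = x} y) = proj {x. E x = x} y" using E.fixp.proj_in[of y] by simp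
    then show ?thesis unfolding E_def co_compress_fix_iff[OF cD] by (intro dense) auto
  qed
  have Ei: "E (unit_vec i) \<bullet> unit_vec i = 1 - (norm (proj D (unit_vec i)))\<^sup>2" if "i \<in> I" for i
    using that by (simp add: E_def inner_diff_left trace_diag[OF cD] del: inner_delta) (simp add: cut_unit_vec coef_delta)
  have le: "(\<Sum>i\<in>I. (E (unit_vec i) - (E ^^ Suc n) (unit_vec i)) \<bullet> unit_vec i) \<le> (\<Sum>\<^sub>\<infinity>j\<in>J. (norm (proj D (unit_vec j)))\<^sup>2)" for n
  proof (rule has_sum_mono)
    show "((\<lambda>j. (d (unit_vec j) - (d ^^ Suc n) (unit_vec j)) \<bullet> unit_vec j) has_sum
          (\<Sum>i\<in>I. (E (unit_vec i) - (E ^^ Suc n) (unit_vec i)) \<bullet> unit_vec i)) J"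
      unfolding E_def d_def by (rule trace_compression_identity[OF D supp disj I])
    show "((\<lambda>j. (norm (proj D (unit_vec j)))\<^sup>2) has_sum (\<Sum>\<^sub>\<infinity>j\<in>J. (norm (proj D (unit_vec j)))\<^sup>2)) J"
      using sum by simp
    show "(d (unit_vec j) - (d ^^ Suc n) (unit_vec j)) \<bullet> unit_vec j \<le> (norm (proj D (unit_vec j)))\<^sup>2"
      if "j \<in> J" for j
      using d.pow_nonneg[of "Suc n" "unit_vec j"] trace_diag[OF cD that]
      unfolding d_def inner_diff_left by linarith
  qed
  have "(\<lambda>n. \<Sum>i\<in>I. E (unit_vec i) \<bullet> unit_vec i - (E ^^ Suc n) (unit_vec i) \<bullet> unit_vec i)
      \<longlonglongrightarrow> (\<Sum>i\<in>I. E (unit_vec i) \<bullet> unit_vec i - (norm (proj {x. E x = x} (unit_vec i)))\<^sup>2)"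
    by (intro tendsto_sum tendsto_diff tendsto_const E.pow_inner_tendsto)
  then have "(\<Sum>i\<in>I. E (unit_vec i) \<bullet> unit_vec i - (norm (proj {x. E x = x} (unit_vec i)))\<^sup>2)
      \<le> (\<Sum>\<^sub>\<infinity>j\<in>J. (norm (proj D (unit_vec j)))\<^sup>2)"
    using le by (intro LIMSEQ_le_const2) (auto simp: inner_diff_left)
  also have "(\<Sum>i\<in>I. E (unit_vec i) \<bullet> unit_vec i - (norm (proj {x. E x = x} (unit_vec i)))\<^sup>2)
      = (\<Sum>i\<in>I. 1 - (norm (proj D (unit_vec i)))\<^sup>2)"
    by (intro sum.cong) (simp_all add: Ei fixE del: inner_delta)
  finally show ?thesis by (simp add: sum_subtractf)
qed

text \<open>Rank-nullity for the projection of \<open>D\<close> to the columns \<open>J\<close>, with kernel \<open>D0\<close> and with image in \<open>Z\<close>.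
It is the trace identity for the orthogonal complement \<open>D'\<close> of \<open>D\<close>: there \<open>E\<close> becomes the corner
\<open>a\<close> of \<open>D\<close>, whose powers tend to the projection onto \<open>D0\<close>, while the corner of \<open>D'\<close> on \<open>J\<close> is
the identity on the complement of \<open>Z\<close>.\<close>

lemma dim_kernel_ge:
  fixes D Z :: "('a \<times> 'k) l2 set"
  assumes D: "invariant_subspace D" and supp: "D \<subseteq> supp_in (carrier G \<times> (I \<union> J))"
    and disj: "I \<inter> J = {}" and I: "finite I"
    and Z: "closed_subspace Z" "Z \<subseteq> supp_in (carrier G \<times> J)"
      "\<And>f. f \<in> D \<Longrightarrow> cut (carrier G \<times> J) f \<in> Z"
    and sumZ: "(\<lambda>j. (norm (proj Z (unit_vec j)))\<^sup>2) summable_on J"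
    and sumD: "(\<lambda>j. (norm (proj D (unit_vec j)))\<^sup>2) summable_on J"
  defines "D0 \<equiv> D \<inter> supp_in (carrier G \<times> I)"
  shows "(\<Sum>i\<in>I. (norm (proj D (unit_vec i)))\<^sup>2) + (\<Sum>\<^sub>\<infinity>j\<in>J. (norm (proj D (unit_vec j)))\<^sup>2)
      \<le> (\<Sum>i\<in>I. (norm (proj D0 (unit_vec i)))\<^sup>2) + (\<Sum>\<^sub>\<infinity>j\<in>J. (norm (proj Z (unit_vec j)))\<^sup>2)"
proof -
  let ?X = "carrier G \<times> (I \<union> J)"
  let ?cI = "cut (carrier G \<times> I)" and ?cJ = "cut (carrier G \<times> J)" and ?P = "proj D"
  have cD: "closed_subspace D" using D by (simp add: invariant_subspace_def)
  interpret D: closed_subspace D by (rule cD)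
  interpret Z: closed_subspace Z by (rule Z)
  define D' where "D' = {f. \<forall>h\<in>(\<bullet>) ` D \<union> (\<lambda>x f. coef f x) ` (- ?X). h f = 0}"
  have D'_iff: "f \<in> D' \<longleftrightarrow> f \<in> supp_in ?X \<and> (\<forall>h\<in>D. h \<bullet> f = 0)" for f
    by (auto simp: D'_def supp_in_def)
  have cD': "closed_subspace D'"
    unfolding D'_def by (rule closed_subspace_kernels) (auto simp: bounded_linear_coef bounded_linear_inner_right)
  interpret D': closed_subspace D' by (rule cD')
  have "translate G g f \<in> D'" if g: "g \<in> carrier G" and f: "f \<in> D'" for g f
  proof -
    have "h \<bullet> translate G g f = 0" if "h \<in> D" for h
      using D f g that unfolding D'_iff invariant_subspace_def by (simp add: translate_inner_inv)
    then show ?thesis using f g unfolding D'_iff by (simp add: translate_in)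
  qed
  then have iD': "invariant_subspace D'"
    using cD' by (simp add: invariant_subspace_def)
  have sD': "D' \<subseteq> supp_in ?X" by (auto simp: D'_iff)
  have pD': "proj D' f = cut ?X f - ?P f" for f
  proof (rule D'.proj_unique)
    have PX: "?P f \<in> supp_in ?X" using supp D.proj_in by blast
    have "h \<bullet> (cut ?X f - ?P f) = 0" if "h \<in> D" for h
      using that supp D.proj_inner[OF that, of f] cut_sym[of ?X h f] cut_id[of h ?X]
      by (auto simp: inner_diff_right inner_commute)
    then show "cut ?X f - ?P f \<in> D'" using PX unfolding D'_iff by (auto simp: supp_in_def)
    show "f \<bullet> z = (cut ?X f - ?P f) \<bullet> z" if "z \<in> D'" for z
      using that D.proj_in[of f] cut_id[of z ?X] unfolding D'_iff
      by (auto simp: inner_diff_left cut_sym)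
  qed
  define a where "a = compress (carrier G \<times> I) D"
  define d where "d = (\<lambda>v. ?cJ v - compress (carrier G \<times> J) D v)"
  interpret a: positive_contraction a
    unfolding a_def by (rule compress_positive_contraction[OF cD])
  interpret d: positive_contraction d
    unfolding d_def by (rule co_compress_positive_contraction[OF cD])
  have XI: "?X \<inter> carrier G \<times> I = carrier G \<times> I" "carrier G \<times> I \<inter> ?X = carrier G \<times> I"
    "?X \<inter> carrier G \<times> J = carrier G \<times> J" "carrier G \<times> J \<inter> ?X = carrier G \<times> J" by auto
  have 1: "?cI v - compress (carrier G \<times> I) D' v = a v" for v
    by (simp add: a_def compress_def pD' cut_diff XI)
  have 2: "compress (carrier G \<times> J) D' = d"
    by (rule ext) (simp add: d_def compress_def pD' cut_diff XI)
  have ident: "((\<lambda>j. (d (unit_vec j) - (d ^^ Suc n) (unit_vec j)) \<bullet> unit_vec j) has_sum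
          (\<Sum>i\<in>I. (a (unit_vec i) - (a ^^ Suc n) (unit_vec i)) \<bullet> unit_vec i)) J" for n
    using trace_compression_identity[OF iD' sD' disj I, of n] unfolding 1 2 .
  have le: "(\<Sum>i\<in>I. (a (unit_vec i) - (a ^^ Suc n) (unit_vec i)) \<bullet> unit_vec i)
    \<le> (\<Sum>\<^sub>\<infinity>j\<in>J. (norm (proj Z (unit_vec j)))\<^sup>2) - (\<Sum>\<^sub>\<infinity>j\<in>J. (norm (?P (unit_vec j)))\<^sup>2)" for n
  proof (rule has_sum_mono[OF ident])
    show "((\<lambda>j. (norm (proj Z (unit_vec j)))\<^sup>2 - (norm (?P (unit_vec j)))\<^sup>2) has_sum
      (\<Sum>\<^sub>\<infinity>j\<in>J. (norm (proj Z (unit_vec j)))\<^sup>2) - (\<Sum>\<^sub>\<infinity>j\<in>J. (norm (?P (unit_vec j)))\<^sup>2)) J"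
      unfolding diff_conv_add_uminus
      by (intro has_sum_add has_sum_uminusI has_sum_infsum sumZ sumD)
    fix j assume j: "j \<in> J"
    define y where "y = unit_vec j - proj Z (unit_vec j)"
    have yJ: "y \<in> supp_in (carrier G \<times> J)"
    proof -
      interpret S: closed_subspace "supp_in (carrier G \<times> J)" by (rule closed_subspace_supp_in)
      have "unit_vec j \<in> supp_in (carrier G \<times> J)" using j by (intro delta_in) simp
      moreover have "proj Z (unit_vec j) \<in> supp_in (carrier G \<times> J)" using Z(2) Z.proj_in by blast
      ultimately show ?thesis unfolding y_def by (rule subspace_diff[OF S.subspace])
    qed
    have "y \<bullet> f = 0" if "f \<in> D" for f
    proof -
      have "y \<bullet> f = y \<bullet> ?cJ f" using cut_sym[of "carrier G \<times> J" y f] cut_id[OF yJ] by simp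
      also have "\<dots> = 0" unfolding y_def by (rule Z.proj_orth) (rule Z(3)[OF that])
      finally show ?thesis .
    qed
    then have "d y = y" unfolding d_def co_compress_fix_iff[OF cD] using yJ by blast
    moreover have "(unit_vec j - y) \<bullet> y = 0"
      using Z.proj_orth[OF Z.proj_in, of "unit_vec j" "unit_vec j"]
      by (simp add: y_def inner_commute del: inner_delta)
    ultimately have "(norm y)\<^sup>2 \<le> (d ^^ Suc n) (unit_vec j) \<bullet> unit_vec j" by (rule d.pow_lower)
    moreover have "(norm y)\<^sup>2 = 1 - (norm (proj Z (unit_vec j)))\<^sup>2"
      unfolding y_def norm_diff_sq Z.proj_norm_sq by (simp add: inner_commute)
    moreover have "d (unit_vec j) \<bullet> unit_vec j = 1 - (norm (?P (unit_vec j)))\<^sup>2"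
      using j by (simp add: d_def inner_diff_left trace_diag[OF cD] del: inner_delta) (simp add: cut_unit_vec coef_delta)
    ultimately show "(d (unit_vec j) - (d ^^ Suc n) (unit_vec j)) \<bullet> unit_vec j
        \<le> (norm (proj Z (unit_vec j)))\<^sup>2 - (norm (?P (unit_vec j)))\<^sup>2"
      unfolding inner_diff_left by linarith
  qed
  have fa: "{x. a x = x} = D0"
    unfolding a_def compress_fix_iff[OF cD] D0_def by blast
  have "(\<lambda>n. \<Sum>i\<in>I. a (unit_vec i) \<bullet> unit_vec i - (a ^^ Suc n) (unit_vec i) \<bullet> unit_vec i)
      \<longlonglongrightarrow> (\<Sum>i\<in>I. a (unit_vec i) \<bullet> unit_vec i - (norm (proj {x. a x = x} (unit_vec i)))\<^sup>2)"
    by (intro tendsto_sum tendsto_diff tendsto_const a.pow_inner_tendsto)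
  then have "(\<Sum>i\<in>I. a (unit_vec i) \<bullet> unit_vec i - (norm (proj {x. a x = x} (unit_vec i)))\<^sup>2)
      \<le> (\<Sum>\<^sub>\<infinity>j\<in>J. (norm (proj Z (unit_vec j)))\<^sup>2) - (\<Sum>\<^sub>\<infinity>j\<in>J. (norm (?P (unit_vec j)))\<^sup>2)"
    using le by (intro LIMSEQ_le_const2) (auto simp: inner_diff_left)
  also have "(\<Sum>i\<in>I. a (unit_vec i) \<bullet> unit_vec i - (norm (proj {x. a x = x} (unit_vec i)))\<^sup>2)
      = (\<Sum>i\<in>I. (norm (?P (unit_vec i)))\<^sup>2 - (norm (proj D0 (unit_vec i)))\<^sup>2)"
    unfolding fa by (intro sum.cong) (simp_all add: a_def trace_diag[OF cD] del: inner_delta)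
  finally show ?thesis by (simp add: sum_subtractf)
qed

text \<open>If \<open>D\<close> embeds into the columns \<open>I\<close> and has dimension at least \<open>card I\<close>, it is dense there. In the
trace identity, the powers of \<open>d\<close> tend to \<open>0\<close> by injectivity, while the powers of \<open>E\<close> stay above the
projection onto the complement of the image.\<close>

lemma dense_of_dim_ge:
  fixes D :: "('a \<times> 'k) l2 set"
  assumes D: "invariant_subspace D" and supp: "D \<subseteq> supp_in (carrier G \<times> (I \<union> {s}))"
    and s: "s \<notin> I" and I: "finite I"
    and inj: "\<And>y. y \<in> D \<Longrightarrow> y \<in> supp_in (carrier G \<times> {s}) \<Longrightarrow> y = 0"
    and dim: "real (card I) \<le> (\<Sum>i\<in>I. (norm (proj D (unit_vec i)))\<^sup>2) + (norm (proj D (unit_vec s)))\<^sup>2"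
    and u: "u \<in> supp_in (carrier G \<times> I)" "\<And>f. f \<in> D \<Longrightarrow> u \<bullet> f = 0"
  shows "u = 0"
proof -
  define E where "E = (\<lambda>v. cut (carrier G \<times> I) v - compress (carrier G \<times> I) D v)"
  define d where "d = compress (carrier G \<times> {s}) D"
  have cD: "closed_subspace D" using D by (simp add: invariant_subspace_def)
  interpret E: positive_contraction E
    unfolding E_def by (rule co_compress_positive_contraction[OF cD])
  interpret d: positive_contraction d
    unfolding d_def by (rule compress_positive_contraction[OF cD])
  let ?U = "{x. E x = x}"
  have U_iff: "x \<in> ?U \<longleftrightarrow> x \<in> supp_in (carrier G \<times> I) \<and> (\<forall>f\<in>D. x \<bullet> f = 0)" for x
    unfolding E_def using co_compress_fix_iff[OF cD] by blast
  have fixd: "proj {x. d x = x} y = 0" for y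
  proof -
    have "d (proj {x. d x = x} y) = proj {x. d x = x} y" using d.fixp.proj_in[of y] by simp
    then show ?thesis unfolding d_def compress_fix_iff[OF cD] by (intro inj) auto
  qed
  have Ei: "E (unit_vec i) \<bullet> unit_vec i = 1 - (norm (proj D (unit_vec i)))\<^sup>2" if "i \<in> I" for i
    using that by (simp add: E_def inner_diff_left trace_diag[OF cD] del: inner_delta) (simp add: cut_unit_vec coef_delta)
  have le: "d (unit_vec s) \<bullet> unit_vec s - (d ^^ Suc n) (unit_vec s) \<bullet> unit_vec s
      \<le> (\<Sum>i\<in>I. 1 - (norm (proj D (unit_vec i)))\<^sup>2 - (norm (proj ?U (unit_vec i)))\<^sup>2)" for n
  proof -
    have "I \<inter> {s} = {}" using s by simp
    then have "((\<lambda>j. (d (unit_vec j) - (d ^^ Suc n) (unit_vec j)) \<bullet> unit_vec j) has_sum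
          (\<Sum>i\<in>I. (E (unit_vec i) - (E ^^ Suc n) (unit_vec i)) \<bullet> unit_vec i)) {s}"
      unfolding E_def d_def by (intro trace_compression_identity[OF D supp _ I])
    then have "d (unit_vec s) \<bullet> unit_vec s - (d ^^ Suc n) (unit_vec s) \<bullet> unit_vec s
      = (\<Sum>i\<in>I. (E (unit_vec i) - (E ^^ Suc n) (unit_vec i)) \<bullet> unit_vec i)"
      by (simp add: has_sum_iff inner_diff_left del: inner_delta funpow.simps)
    also have "\<dots> \<le> (\<Sum>i\<in>I. 1 - (norm (proj D (unit_vec i)))\<^sup>2 - (norm (proj ?U (unit_vec i)))\<^sup>2)"
    proof (rule sum_mono)
      fix i assume i: "i \<in> I"
      have "(norm (proj ?U (unit_vec i)))\<^sup>2 \<le> (E ^^ Suc n) (unit_vec i) \<bullet> unit_vec i"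
        by (rule E.pow_lower) (use E.fixp.proj_in in \<open>auto intro: E.fixp.proj_orth simp del: inner_delta\<close>)
      then show "(E (unit_vec i) - (E ^^ Suc n) (unit_vec i)) \<bullet> unit_vec i
        \<le> 1 - (norm (proj D (unit_vec i)))\<^sup>2 - (norm (proj ?U (unit_vec i)))\<^sup>2"
        using Ei[OF i] unfolding inner_diff_left by linarith
    qed
    finally show ?thesis .
  qed
  have "(\<lambda>n. d (unit_vec s) \<bullet> unit_vec s - (d ^^ Suc n) (unit_vec s) \<bullet> unit_vec s)
      \<longlonglongrightarrow> d (unit_vec s) \<bullet> unit_vec s - (norm (proj {x. d x = x} (unit_vec s)))\<^sup>2"
    by (intro tendsto_diff tendsto_const d.pow_inner_tendsto)
  then have "d (unit_vec s) \<bullet> unit_vec s - (norm (proj {x. d x = x} (unit_vec s)))\<^sup>2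
      \<le> (\<Sum>i\<in>I. 1 - (norm (proj D (unit_vec i)))\<^sup>2 - (norm (proj ?U (unit_vec i)))\<^sup>2)"
    using le by (intro LIMSEQ_le_const2) auto
  moreover have "d (unit_vec s) \<bullet> unit_vec s = (norm (proj D (unit_vec s)))\<^sup>2"
    unfolding d_def by (rule trace_diag[OF cD]) simp
  ultimately have le0: "(\<Sum>i\<in>I. (norm (proj ?U (unit_vec i)))\<^sup>2) \<le> 0"
    using dim fixd by (simp add: sum_subtractf)
  then have PU: "proj ?U (unit_vec i) = 0" if "i \<in> I" for i
  proof -
    have "(norm (proj ?U (unit_vec i)))\<^sup>2 \<le> (\<Sum>i\<in>I. (norm (proj ?U (unit_vec i)))\<^sup>2)"
      by (rule member_le_sum) (use that I in auto)
    from order_trans[OF this le0] show ?thesis by simp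
  qed
  have Uinv: "translate G g f \<in> ?U" if "g \<in> carrier G" "f \<in> ?U" for g f
    using D that unfolding U_iff invariant_subspace_def by (auto simp: translate_in translate_inner)
  have uU: "u \<in> ?U" using u U_iff by blast
  show ?thesis
  proof (rule l2_eqI)
    fix y :: "'a \<times> 'k"
    obtain x i where y: "y = (x, i)" by (cases y)
    show "coef u y = coef 0 y"
    proof (cases "x \<in> carrier G \<and> i \<in> I")
      case True
      have "coef u (x, i) = u \<bullet> proj ?U (delta (x, i))"
        using E.fixp.proj_inner[OF uU, of "delta (x, i)"] by (simp add: inner_commute)
      also have "proj ?U (delta (x, i)) = translate G x (proj ?U (unit_vec i))"
        using proj_translate[OF E.fixp.closed_subspace_axioms Uinv, of x "unit_vec i"] True
        by (simp add: translate_delta)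
      also have "\<dots> = 0" using True by (simp add: PU linear_0[OF translate_linear])
      finally show ?thesis by (simp add: y)
    qed (use u in \<open>auto simp: supp_in_def y\<close>)
  qed
qed

end

section \<open>Amenability and Foelner sets\<close>

definition bounded_functions :: "('a, 'm) monoid_scheme \<Rightarrow> ('a \<Rightarrow> real) set"
  where "bounded_functions G = {f. bounded (f ` carrier G)}"

definition left_invariant_mean :: "('a, 'm) monoid_scheme \<Rightarrow> (('a \<Rightarrow> real) \<Rightarrow> real) \<Rightarrow> bool"
  where "left_invariant_mean G \<mu> \<longleftrightarrow>
       (\<forall>f\<in>bounded_functions G. \<forall>f'\<in>bounded_functions G. \<mu> (\<lambda>x. f x + f' x) = \<mu> f + \<mu> f') \<and>
       (\<forall>a. \<forall>f\<in>bounded_functions G. \<mu> (\<lambda>x. a * f x) = a * \<mu> f) \<and>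
       (\<forall>f\<in>bounded_functions G. (\<forall>x\<in>carrier G. 0 \<le> f x) \<longrightarrow> 0 \<le> \<mu> f) \<and>
       \<mu> (\<lambda>x. 1) = 1 \<and>
       (\<forall>g\<in>carrier G. \<forall>f\<in>bounded_functions G. \<mu> (\<lambda>x. f (inv\<^bsub>G\<^esub> g \<otimes>\<^bsub>G\<^esub> x)) = \<mu> f)"

lemma amenable_iff_mean: "amenable G \<longleftrightarrow> group G \<and> (\<exists>\<mu>. left_invariant_mean G \<mu>)"
  unfolding amenable_def left_invariant_mean_def bounded_functions_def Let_def ..

lemma amenable_mean: "amenable G \<Longrightarrow> \<exists>\<mu>. left_invariant_mean G \<mu>"
  by (simp add: amenable_iff_mean)

lemma bounded_functionsI: "(\<And>x. x \<in> carrier G \<Longrightarrow> \<bar>f x\<bar> \<le> K) \<Longrightarrow> f \<in> bounded_functions G"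
  by (auto simp: bounded_functions_def bounded_iff)

lemma bounded_functions_add:
  "f \<in> bounded_functions G \<Longrightarrow> f' \<in> bounded_functions G \<Longrightarrow> (\<lambda>x. f x + f' x) \<in> bounded_functions G"
  by (auto simp: bounded_functions_def bounded_plus_comp)

context
  fixes G :: "('a, 'm) monoid_scheme" and \<mu>
  assumes \<mu>: "left_invariant_mean G \<mu>"
begin

lemma mean_add:
  "f \<in> bounded_functions G \<Longrightarrow> f' \<in> bounded_functions G \<Longrightarrow> \<mu> (\<lambda>x. f x + f' x) = \<mu> f + \<mu> f'"
  using \<mu> by (simp add: left_invariant_mean_def)

lemma mean_scale: "f \<in> bounded_functions G \<Longrightarrow> \<mu> (\<lambda>x. a * f x) = a * \<mu> f"
  using \<mu> by (simp add: left_invariant_mean_def)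

lemma mean_nonneg:
  "f \<in> bounded_functions G \<Longrightarrow> (\<And>x. x \<in> carrier G \<Longrightarrow> 0 \<le> f x) \<Longrightarrow> 0 \<le> \<mu> f"
  using \<mu> by (simp add: left_invariant_mean_def)

lemma mean_one: "\<mu> (\<lambda>x. 1) = 1"
  using \<mu> by (simp add: left_invariant_mean_def)

lemma mean_invariant:
  "g \<in> carrier G \<Longrightarrow> f \<in> bounded_functions G \<Longrightarrow> \<mu> (\<lambda>x. f (inv\<^bsub>G\<^esub> g \<otimes>\<^bsub>G\<^esub> x)) = \<mu> f"
  using \<mu> by (simp add: left_invariant_mean_def)

end

lemma compact_unit_cube: "compact {u :: 'b \<Rightarrow> real. \<forall>p. u p \<in> {0..1}}"
proof -
  have "compactin (product_topology (\<lambda>_::'b. euclidean) UNIV) (PiE UNIV (\<lambda>_. {0..1::real}))"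
    unfolding compactin_PiE by simp
  moreover have "PiE UNIV (\<lambda>_. {0..1::real}) = {u :: 'b \<Rightarrow> real. \<forall>p. u p \<in> {0..1}}" by auto
  ultimately show ?thesis by (simp add: euclidean_product_topology)
qed

context group
begin

text \<open>The failure of the Foelner condition for \<open>e\<close> and \<open>B\<close>.\<close>

definition expanding :: "real \<Rightarrow> 'a set \<Rightarrow> bool"
  where "expanding e B \<longleftrightarrow> (\<forall>F. finite F \<longrightarrow> F \<noteq> {} \<longrightarrow> F \<subseteq> carrier G \<longrightarrow>
      e * real (card F) \<le> (\<Sum>b\<in>B. real (card {x\<in>F. b \<otimes> x \<notin> F})))"

text \<open>The coarea principle: subtracting the least positive value \<open>m\<close> of \<open>f\<close> on its support \<open>S\<close> splits
\<open>f\<close> into a function of smaller support and \<open>m\<close> times the indicator of \<open>S\<close>, and both sides of the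
inequality are additive for this splitting.\<close>

lemma isoperimetric_functional:
  fixes f :: "'a \<Rightarrow> real"
  assumes iso: "expanding e B"
    and S: "finite S" "S \<subseteq> carrier G" and f: "\<And>x. x \<in> S \<Longrightarrow> 0 < f x" "\<And>x. x \<notin> S \<Longrightarrow> f x = 0"
  shows "e * (\<Sum>x\<in>S. f x) \<le> (\<Sum>b\<in>B. \<Sum>x\<in>S. max 0 (f x - f (b \<otimes> x)))"
  using S f
proof (induction "card S" arbitrary: S f rule: less_induct)
  case less
  show ?case
  proof (cases "S = {}")
    case False
    define m where "m = Min (f ` S)"
    have m: "m \<in> f ` S" "\<And>x. x \<in> S \<Longrightarrow> m \<le> f x" unfolding m_def using less.prems False by auto
    then have m0: "m > 0" using less.prems by auto
    define f' where "f' x = (if x \<in> S then f x - m else 0)" for x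
    define S' where "S' = {x\<in>S. f x \<noteq> m}"
    have S': "S' \<subset> S" using m by (auto simp: S'_def)
    have IH: "e * (\<Sum>x\<in>S'. f' x) \<le> (\<Sum>b\<in>B. \<Sum>x\<in>S'. max 0 (f' x - f' (b \<otimes> x)))"
    proof (rule less.hyps)
      show "card S' < card S" using S' less.prems by (simp add: psubset_card_mono)
      show "finite S'" "S' \<subseteq> carrier G" using S' less.prems by (auto intro: finite_subset)
      show "0 < f' x" if "x \<in> S'" for x
        using that m(2)[of x] by (auto simp: f'_def S'_def)
      show "f' x = 0" if "x \<notin> S'" for x using that by (auto simp: f'_def S'_def)
    qed
    have f'0: "f' x \<ge> 0" for x using m by (auto simp: f'_def)
    have pt: "max 0 (f x - f (b \<otimes> x)) = max 0 (f' x - f' (b \<otimes> x)) + (if b \<otimes> x \<notin> S then m else 0)"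
      if "x \<in> S" for x b
      using that m0 f'0[of x] less.prems(4)[of "b \<otimes> x"] m(2)[of x] by (auto simp: f'_def)
    have vS: "(\<Sum>x\<in>S'. max 0 (f' x - f' (b \<otimes> x))) = (\<Sum>x\<in>S. max 0 (f' x - f' (b \<otimes> x)))" for b
      using S' less.prems(1) f'0 by (intro sum.mono_neutral_left) (auto simp: S'_def f'_def)
    have sS: "(\<Sum>x\<in>S'. f' x) = (\<Sum>x\<in>S. f' x)"
      using S' less.prems(1) by (intro sum.mono_neutral_left) (auto simp: S'_def f'_def)
    have "(\<Sum>x\<in>S. f x) = (\<Sum>x\<in>S. f' x) + m * real (card S)"
      by (simp add: f'_def sum_subtractf)
    then have "e * (\<Sum>x\<in>S. f x) = e * (\<Sum>x\<in>S. f' x) + m * (e * real (card S))"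
      by (simp add: algebra_simps)
    also have "\<dots> \<le> (\<Sum>b\<in>B. \<Sum>x\<in>S. max 0 (f' x - f' (b \<otimes> x)))
        + m * (\<Sum>b\<in>B. real (card {x\<in>S. b \<otimes> x \<notin> S}))"
      using IH iso[unfolded expanding_def, rule_format, of S] less.prems False m0 unfolding vS sS by (intro add_mono mult_left_mono) auto
    also have "\<dots> = (\<Sum>b\<in>B. \<Sum>x\<in>S. max 0 (f x - f (b \<otimes> x)))"
    proof -
      have "(\<Sum>x\<in>S. if b \<otimes> x \<notin> S then m else 0) = m * real (card {x\<in>S. b \<otimes> x \<notin> S})" for b
        using less.prems(1) by (subst sum.inter_filter[symmetric]) auto
      then show ?thesis by (simp add: pt sum.distrib sum_distrib_left)
    qed
    finally show ?thesis .
  qed simp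
qed

text \<open>\<open>u (b, x)\<close> is the amount of a flow on the edge from \<open>x\<close> to \<open>b \<otimes> x\<close>.\<close>

definition divergence :: "'a set \<Rightarrow> ('a \<times> 'a \<Rightarrow> real) \<Rightarrow> 'a \<Rightarrow> real"
  where "divergence B u x = (\<Sum>b\<in>B. u (b, x) - u (b, inv b \<otimes> x))"

lemma continuous_divergence: "continuous_on X (\<lambda>u. divergence B u x)"
  unfolding divergence_def
  by (intro continuous_intros continuous_on_subset[OF continuous_on_product_coordinates]) auto

text \<open>Max-flow min-cut. Minimise the sum \<open>\<Psi>\<close> of the squared deficits \<open>f x\<close> of the divergence over the
unit cube, and move the minimiser \<open>u\<close> towards the flow \<open>v\<close> that uses the edges along which \<open>f\<close>
decreases. To first order \<open>\<Psi>\<close> decreases by twice the difference of the pairings of \<open>f\<close> with the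
divergences of \<open>v\<close> and \<open>u\<close>. The pairing with \<open>v\<close> is the variation of \<open>f\<close>, so it is at least \<open>e\<close> times the sum
of \<open>f\<close>, and the pairing with \<open>u\<close> is smaller than this unless \<open>f = 0\<close>.\<close>

lemma flow_on_finite_set:
  fixes e :: real
  assumes iso: "expanding e B"
    and B: "finite B" "B \<subseteq> carrier G" and X: "finite X" "X \<subseteq> carrier G"
  shows "\<exists>u. (\<forall>p. u p \<in> {0..1}) \<and> (\<forall>x\<in>X. e \<le> divergence B u x)"
proof -
  let ?U = "{u :: 'a \<times> 'a \<Rightarrow> real. \<forall>p. u p \<in> {0..1}}"
  define \<Psi> where "\<Psi> u = (\<Sum>x\<in>X. (max 0 (e - divergence B u x))\<^sup>2)" for u
  have cont: "continuous_on ?U \<Psi>"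
    unfolding \<Psi>_def by (intro continuous_intros continuous_divergence)
  have ne: "?U \<noteq> {}" by (auto intro: exI[of _ "\<lambda>_. 0"])
  from continuous_attains_inf[OF compact_unit_cube ne cont]
  obtain u where u: "u \<in> ?U" and umin: "\<forall>v\<in>?U. \<Psi> u \<le> \<Psi> v" by (rule bexE)
  define f where "f x = (if x \<in> X then max 0 (e - divergence B u x) else 0)" for x
  define S where "S = {x\<in>X. f x \<noteq> 0}"
  have f0: "f x \<ge> 0" for x by (simp add: f_def)
  have fS: "x \<in> S \<Longrightarrow> 0 < f x" "x \<notin> S \<Longrightarrow> f x = 0" for x
    using f0[of x] by (auto simp: S_def f_def)
  have S: "finite S" "S \<subseteq> carrier G" "S \<subseteq> X" using X by (auto simp: S_def)
  define v where "v = (\<lambda>(b, x). if f x > f (b \<otimes> x) then 1 else 0 :: real)"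
  have v: "v \<in> ?U" by (auto simp: v_def)
  have fdiv: "(\<Sum>x\<in>S. f x * divergence B v x) = (\<Sum>b\<in>B. \<Sum>x\<in>S. max 0 (f x - f (b \<otimes> x)))"
  proof -
    have *: "(\<Sum>x\<in>S. f x * v (b, inv b \<otimes> x)) = (\<Sum>x\<in>S. f (b \<otimes> x) * v (b, x))" if b: "b \<in> B" for b
    proof -
      have bc: "b \<in> carrier G" using b B by auto
      have "(\<Sum>x\<in>S. f x * v (b, inv b \<otimes> x)) = (\<Sum>x\<in>{x\<in>S. inv b \<otimes> x \<in> S}. f x * v (b, inv b \<otimes> x))"
      proof (rule sum.mono_neutral_right)
        show "\<forall>x\<in>S - {x\<in>S. inv b \<otimes> x \<in> S}. f x * v (b, inv b \<otimes> x) = 0"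
          using fS(2) f0 by (auto simp: v_def not_less[symmetric])
      qed (use S in auto)
      also have "\<dots> = (\<Sum>x\<in>{x\<in>S. b \<otimes> x \<in> S}. f (b \<otimes> x) * v (b, x))"
        by (rule sum.reindex_bij_witness[where i = "\<lambda>x. b \<otimes> x" and j = "\<lambda>x. inv b \<otimes> x"])
           (use bc S in \<open>auto simp: subset_eq m_assoc[symmetric]\<close>)
      also have "\<dots> = (\<Sum>x\<in>S. f (b \<otimes> x) * v (b, x))"
        using S fS(2) by (intro sum.mono_neutral_left) auto
      finally show ?thesis .
    qed
    have "(\<Sum>x\<in>S. f x * divergence B v x) = (\<Sum>b\<in>B. (\<Sum>x\<in>S. f x * v (b, x)) - (\<Sum>x\<in>S. f x * v (b, inv b \<otimes> x)))"
      unfolding divergence_def sum_distrib_left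
      by (subst sum.swap) (simp add: algebra_simps sum_subtractf)
    also have "\<dots> = (\<Sum>b\<in>B. \<Sum>x\<in>S. (f x - f (b \<otimes> x)) * v (b, x))"
      by (intro sum.cong refl) (simp add: * left_diff_distrib sum_subtractf)
    also have "\<dots> = (\<Sum>b\<in>B. \<Sum>x\<in>S. max 0 (f x - f (b \<otimes> x)))"
      by (intro sum.cong refl) (auto simp: v_def)
    finally show ?thesis .
  qed
  have "\<forall>x\<in>X. e \<le> divergence B u x"
  proof (rule ccontr)
    assume "\<not> ?thesis"
    then obtain x0 where x0: "x0 \<in> X" "divergence B u x0 < e" by auto
    then have x0S: "x0 \<in> S" by (auto simp: S_def f_def)
    define k where "k x = divergence B v x - divergence B u x" for x
    have \<Psi>u: "\<Psi> u = (\<Sum>x\<in>X. (f x)\<^sup>2)" unfolding \<Psi>_def by (intro sum.cong) (auto simp: f_def)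
    have ineq: "2 * (\<Sum>x\<in>X. f x * k x) \<le> t * (\<Sum>x\<in>X. (k x)\<^sup>2)" if t: "0 < t" "t \<le> 1" for t :: real
    proof -
      define w where "w p = (1 - t) * u p + t * v p" for p
      have "w \<in> ?U"
        using u v t by (auto simp: w_def intro!: convex_bound_le)
      then have "(\<Sum>x\<in>X. (f x)\<^sup>2) \<le> \<Psi> w" using umin \<Psi>u by simp
      also have "\<dots> \<le> (\<Sum>x\<in>X. (f x - t * k x)\<^sup>2)"
        unfolding \<Psi>_def
      proof (rule sum_mono)
        fix x assume x: "x \<in> X"
        have "divergence B w x = (1 - t) * divergence B u x + t * divergence B v x"
          unfolding divergence_def w_def sum_distrib_left sum.distrib[symmetric]
          by (intro sum.cong refl) (simp add: algebra_simps)
        then have "e - divergence B w x \<le> f x - t * k x"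
          using x by (simp add: k_def f_def algebra_simps)
        then have "max 0 (e - divergence B w x) \<le> \<bar>f x - t * k x\<bar>" by linarith
        then have "(max 0 (e - divergence B w x))\<^sup>2 \<le> \<bar>f x - t * k x\<bar>\<^sup>2" by (intro power_mono) auto
        then show "(max 0 (e - divergence B w x))\<^sup>2 \<le> (f x - t * k x)\<^sup>2" by simp
      qed
      also have "\<dots> = (\<Sum>x\<in>X. (f x)\<^sup>2) - 2 * t * (\<Sum>x\<in>X. f x * k x) + t\<^sup>2 * (\<Sum>x\<in>X. (k x)\<^sup>2)"
        by (simp add: power2_eq_square algebra_simps sum.distrib sum_subtractf sum_distrib_left)
      finally have "t * (2 * (\<Sum>x\<in>X. f x * k x)) \<le> t * (t * (\<Sum>x\<in>X. (k x)\<^sup>2))"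
        by (simp add: power2_eq_square algebra_simps)
      then show ?thesis using t by simp
    qed
    \<comment> \<open>the first variation at the minimiser, from \<open>t \<rightarrow> 0\<close>\<close>
    have "((\<lambda>t. t * (\<Sum>x\<in>X. (k x)\<^sup>2)) \<longlongrightarrow> 0 * (\<Sum>x\<in>X. (k x)\<^sup>2)) (at_right 0)"
      by (intro tendsto_intros)
    moreover have "\<forall>\<^sub>F t :: real in at_right 0. 2 * (\<Sum>x\<in>X. f x * k x) \<le> t * (\<Sum>x\<in>X. (k x)\<^sup>2)"
      using eventually_at_right_real[of 0 1, OF zero_less_one]
      by (rule eventually_mono) (auto intro: ineq)
    ultimately have "2 * (\<Sum>x\<in>X. f x * k x) \<le> 0 * (\<Sum>x\<in>X. (k x)\<^sup>2)"
      by (intro tendsto_lowerbound[where F = "at_right (0::real)"]) auto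
    then have 1: "(\<Sum>x\<in>X. f x * k x) \<le> 0" by simp
    have "(\<Sum>x\<in>X. f x * k x) = (\<Sum>x\<in>S. f x * k x)"
      using X fS(2) S by (intro sum.mono_neutral_right) auto
    also have "\<dots> = (\<Sum>x\<in>S. f x * divergence B v x) - (\<Sum>x\<in>S. f x * divergence B u x)"
      by (simp add: k_def algebra_simps sum_subtractf)
    also have "\<dots> \<ge> e * (\<Sum>x\<in>S. f x) - (\<Sum>x\<in>S. f x * divergence B u x)"
      using isoperimetric_functional[OF iso S(1,2) fS] unfolding fdiv by simp
    also have "e * (\<Sum>x\<in>S. f x) - (\<Sum>x\<in>S. f x * divergence B u x) = (\<Sum>x\<in>S. (f x)\<^sup>2)"
      unfolding sum_distrib_left sum_subtractf[symmetric]
      by (intro sum.cong refl) (auto simp: S_def f_def power2_eq_square algebra_simps max_def split: if_splits)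
    finally have "(\<Sum>x\<in>S. (f x)\<^sup>2) \<le> 0" using 1 by linarith
    moreover have "(f x0)\<^sup>2 \<le> (\<Sum>x\<in>S. (f x)\<^sup>2)" by (rule member_le_sum) (use x0S S in auto)
    ultimately show False using zero_less_power[OF fS(1)[OF x0S], of 2] by linarith
  qed
  with u show ?thesis by blast
qed

text \<open>Compactness of the unit cube passes from finite sets to the whole group.\<close>

lemma flow_everywhere:
  fixes e :: real
  assumes iso: "expanding e B"
    and B: "finite B" "B \<subseteq> carrier G"
  shows "\<exists>u. (\<forall>p. u p \<in> {0..1}) \<and> (\<forall>x\<in>carrier G. e \<le> divergence B u x)"
proof -
  let ?U = "{u :: 'a \<times> 'a \<Rightarrow> real. \<forall>p. u p \<in> {0..1}}"
  define C where "C x = {u. e \<le> divergence B u x}" for x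
  have "?U \<inter> (\<Inter>(C ` carrier G)) \<noteq> {}"
  proof (rule compact_imp_fip[OF compact_unit_cube])
    show "closed T" if "T \<in> C ` carrier G" for T
      using that by (auto simp: C_def intro!: closed_Collect_le continuous_divergence)
    fix F assume "finite F" "F \<subseteq> C ` carrier G"
    then obtain X where X: "X \<subseteq> carrier G" "finite X" "F = C ` X" by (meson finite_subset_image)
    obtain u where "\<forall>p. u p \<in> {0..1}" "\<forall>x\<in>X. e \<le> divergence B u x"
      using flow_on_finite_set[OF iso B X(2,1)] by (elim exE conjE)
    then have "u \<in> ?U \<inter> \<Inter>F" by (auto simp: C_def X(3))
    then show "?U \<inter> \<Inter>F \<noteq> {}" by (rule ex_in_conv[THEN iffD1, OF exI])
  qed
  then obtain u where "u \<in> ?U \<inter> (\<Inter>(C ` carrier G))" by (auto simp only: ex_in_conv[symmetric])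
  then show ?thesis by (intro exI[of _ u]) (simp add: C_def)
qed

text \<open>A divergence is a finite sum of differences between bounded functions and their translates, so an
invariant mean sends it to \<open>0\<close>, and it cannot be at least \<open>e > 0\<close> everywhere.\<close>

lemma amenable_foelner_left:
  assumes am: "amenable G" and B: "finite B" "B \<subseteq> carrier G" and e: "e > 0"
  shows "\<exists>F. finite F \<and> F \<noteq> {} \<and> F \<subseteq> carrier G \<and>
      (\<Sum>b\<in>B. real (card {x\<in>F. b \<otimes> x \<notin> F})) < e * real (card F)"
proof (rule ccontr)
  assume "\<not> ?thesis"
  then have "expanding e B" by (auto simp: expanding_def not_less)
  from flow_everywhere[OF this B] obtain u where u: "\<And>p. u p \<in> {0..1::real}"
    and div: "\<And>x. x \<in> carrier G \<Longrightarrow> e \<le> divergence B u x" by (elim exE conjE) auto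
  let ?\<B> = "bounded_functions G"
  obtain \<mu> where \<mu>: "left_invariant_mean G \<mu>" using amenable_mean[OF am] by (rule exE)
  note add = mean_add[OF \<mu>] and scale = mean_scale[OF \<mu>] and pos = mean_nonneg[OF \<mu>]
    and one = mean_one[OF \<mu>] and inv = mean_invariant[OF \<mu>] and bI = bounded_functionsI[of G]
  have ub: "(\<lambda>x. u (b, x)) \<in> ?\<B>" "(\<lambda>x. u (b, inv b \<otimes> x)) \<in> ?\<B>" "(\<lambda>x. -1 * u (b, inv b \<otimes> x)) \<in> ?\<B>" for b
    using u by (auto intro!: bI[of _ 1])
  have "(\<lambda>x. divergence B' u x) \<in> ?\<B> \<and> \<mu> (\<lambda>x. divergence B' u x) = 0" if "finite B'" "B' \<subseteq> B" for B'
    using that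
  proof (induction B' rule: finite_induct)
    case empty
    have "(\<lambda>x. 0) \<in> ?\<B>" by (rule bI[of _ 0]) simp
    then show ?case using scale[of "\<lambda>x. 0" 0] by (simp add: divergence_def)
  next
    case (insert b B')
    then have b: "b \<in> carrier G" using B by auto
    define w where "w = (\<lambda>x. u (b, x) + -1 * u (b, inv b \<otimes> x))"
    have "w x \<in> {-1..1}" for x using u[of "(b, x)"] u[of "(b, inv b \<otimes> x)"] by (auto simp: w_def)
    then have wB: "w \<in> ?\<B>" by (intro bI[of _ 1]) (auto simp: abs_le_iff minus_le_iff)
    have "\<mu> w = \<mu> (\<lambda>x. u (b, x)) - \<mu> (\<lambda>x. u (b, inv b \<otimes> x))"
      unfolding w_def by (subst add[OF ub(1) ub(3)], subst scale[OF ub(2)]) simp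
    also have "\<dots> = 0" using inv[OF b ub(1)] by simp
    finally have w0: "\<mu> w = 0" .
    have eq: "(\<lambda>x. divergence (insert b B') u x) = (\<lambda>x. w x + divergence B' u x)"
      using insert by (auto simp: divergence_def w_def)
    have IH: "(\<lambda>x. divergence B' u x) \<in> ?\<B>" "\<mu> (\<lambda>x. divergence B' u x) = 0" using insert by auto
    have "(\<lambda>x. w x + divergence B' u x) \<in> ?\<B>"
      using wB IH(1) by (auto intro: bounded_functions_add)
    then show ?case unfolding eq using add[OF wB IH(1)] w0 IH(2) by simp
  qed
  from this[OF B(1) order_refl] have D: "(\<lambda>x. divergence B u x) \<in> ?\<B>" "\<mu> (\<lambda>x. divergence B u x) = 0" by auto
  have c: "(\<lambda>x. 1) \<in> ?\<B>" "(\<lambda>x. - e * 1) \<in> ?\<B>" by (auto intro: bI[of _ 1] bI[of _ "\<bar>e\<bar>"])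
  have "0 \<le> \<mu> (\<lambda>x. divergence B u x + - e * 1)"
    by (rule pos[OF bounded_functions_add[OF D(1) c(2)]]) (use div in simp)
  also have "\<dots> = \<mu> (\<lambda>x. divergence B u x) + - e * 1"
    by (subst add[OF D(1) c(2)]) (simp only: scale[OF c(1)] one)
  finally show False using D(2) e by simp
qed

lemma amenable_foelner:
  assumes am: "amenable G" and B: "finite B" "B \<subseteq> carrier G" and e: "e > 0"
  shows "\<exists>F. finite F \<and> F \<noteq> {} \<and> F \<subseteq> carrier G \<and>
      real (card (F \<union> (\<Union>b\<in>B. (\<lambda>x. x \<otimes> b) ` F))) \<le> (1 + e) * real (card F)"
proof -
  let ?B = "(\<lambda>b. inv b) ` B"
  have "finite ?B" "?B \<subseteq> carrier G" using B by auto
  from amenable_foelner_left[OF am this e] obtain F where F: "finite F" "F \<noteq> {}" "F \<subseteq> carrier G"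
    and small: "(\<Sum>b\<in>?B. real (card {x\<in>F. b \<otimes> x \<notin> F})) < e * real (card F)" by blast
  have injB: "inj_on (\<lambda>b. inv b) B" using B by (intro inj_on_subset[OF inv_inj]) auto
  let ?F = "(\<lambda>x. inv x) ` F"
  have injF: "inj_on (\<lambda>x. inv x) F" using F by (intro inj_on_subset[OF inv_inj]) auto
  have sub: "?F \<union> (\<Union>b\<in>B. (\<lambda>x. x \<otimes> b) ` ?F) \<subseteq> ?F \<union> (\<Union>b\<in>B. (\<lambda>x. inv x \<otimes> b) ` {x\<in>F. inv b \<otimes> x \<notin> F})"
  proof -
    have "inv x \<otimes> b \<in> ?F" if "x \<in> F" "b \<in> B" "inv b \<otimes> x \<in> F" for x b
    proof -
      have "inv x \<otimes> b = inv (inv b \<otimes> x)" using that F B by (subst inv_mult_group) auto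
      then show ?thesis using that by simp
    qed
    then show ?thesis by fastforce
  qed
  have "card (?F \<union> (\<Union>b\<in>B. (\<lambda>x. x \<otimes> b) ` ?F))
      \<le> card (?F \<union> (\<Union>b\<in>B. (\<lambda>x. inv x \<otimes> b) ` {x\<in>F. inv b \<otimes> x \<notin> F}))"
    using F B by (intro card_mono[OF _ sub]) auto
  also have "\<dots> \<le> card ?F + card (\<Union>b\<in>B. (\<lambda>x. inv x \<otimes> b) ` {x\<in>F. inv b \<otimes> x \<notin> F})" by (rule card_Un_le)
  also have "\<dots> \<le> card ?F + (\<Sum>b\<in>B. card ((\<lambda>x. inv x \<otimes> b) ` {x\<in>F. inv b \<otimes> x \<notin> F}))"
    using B by (intro add_left_mono card_UN_le)
  also have "\<dots> \<le> card F + (\<Sum>b\<in>B. card {x\<in>F. inv b \<otimes> x \<notin> F})"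
    using F by (intro add_mono sum_mono card_image_le) auto
  finally have "real (card (?F \<union> (\<Union>b\<in>B. (\<lambda>x. x \<otimes> b) ` ?F))) \<le> real (card F) + (\<Sum>b\<in>B. real (card {x\<in>F. inv b \<otimes> x \<notin> F}))"
    by (simp flip: of_nat_sum of_nat_add)
  also have "(\<Sum>b\<in>B. real (card {x\<in>F. inv b \<otimes> x \<notin> F})) = (\<Sum>b\<in>?B. real (card {x\<in>F. b \<otimes> x \<notin> F}))"
    by (subst sum.reindex[OF injB]) simp
  finally have "real (card (?F \<union> (\<Union>b\<in>B. (\<lambda>x. x \<otimes> b) ` ?F))) \<le> (1 + e) * real (card ?F)"
    using small card_image[OF injF] by (simp add: algebra_simps)
  moreover have "finite ?F" "?F \<noteq> {}" "?F \<subseteq> carrier G" using F by auto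
  ultimately show ?thesis by blast
qed

end

section \<open>The dimension of a cocycle on an amenable subgroup\<close>

context group
begin

text \<open>If \<open>w\<close> is a cocycle on \<open>K\<close> and \<open>f\<close> is a vector, then \<open>\<zeta>(g, b) = f \<bullet> translate G g (w b)\<close> satisfies
\<open>\<zeta>(g, a \<otimes> b) = \<zeta>(g, a) + \<zeta>(g \<otimes> a, b)\<close>. The space consists of the functions with this property,
stored in one column for each \<open>b \<in> K\<close> and multiplied by weights \<open>\<omega> b\<close>, which are needed for square
summability over all \<open>b\<close>.\<close>

definition cocycle_space :: "'a set \<Rightarrow> ('a \<Rightarrow> 'k) \<Rightarrow> ('a \<Rightarrow> real) \<Rightarrow> ('a \<times> 'k) l2 set"
  where "cocycle_space K col \<omega> = {z \<in> supp_in (carrier G \<times> col ` K).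
    \<forall>g\<in>carrier G. \<forall>a\<in>K. \<forall>b\<in>K.
      coef z (g, col (a \<otimes> b)) / \<omega> (a \<otimes> b) = coef z (g, col a) / \<omega> a + coef z (g \<otimes> a, col b) / \<omega> b}"

lemma cocycle_space_invariant:
  fixes col :: "'a \<Rightarrow> 'k"
  assumes K: "subgroup K G"
  shows "invariant_subspace (cocycle_space K col \<omega>)"
proof -
  define h where "h g a b z = coef z (g, col (a \<otimes> b)) / \<omega> (a \<otimes> b) - coef z (g, col a) / \<omega> a - coef z (g \<otimes> a, col b) / \<omega> b"
    for g a b and z :: "('a \<times> 'k) l2"
  define \<F> where "\<F> = (\<lambda>y z. coef z y) ` (- (carrier G \<times> col ` K)) \<union> (\<lambda>(g, a, b). h g a b) ` (carrier G \<times> K \<times> K)"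
  have eq: "cocycle_space K col \<omega> = {z. \<forall>f\<in>\<F>. f z = 0}"
    unfolding cocycle_space_def \<F>_def supp_in_def by (auto simp: h_def ball_Un diff_diff_eq)
  have "bounded_linear (h g a b)" for g a b
    unfolding h_def divide_inverse
    by (intro bounded_linear_sub bounded_linear_mult_left[THEN bounded_linear_compose] bounded_linear_coef)
  then have "closed_subspace (cocycle_space K col \<omega>)"
    unfolding eq by (intro closed_subspace_kernels) (auto simp: \<F>_def bounded_linear_coef)
  moreover have "translate G g z \<in> cocycle_space K col \<omega>" if "g \<in> carrier G" "z \<in> cocycle_space K col \<omega>" for g z
    using that subgroup.subset[OF K]
    by (auto simp: cocycle_space_def translate_in coef_translate m_assoc[symmetric] subset_eq)
  ultimately show ?thesis by (simp add: invariant_subspace_def)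
qed

text \<open>For \<open>x\<close> in a finite subset \<open>F\<close> of \<open>K\<close> and \<open>b \<in> B\<close>, evaluation at \<open>(x, b)\<close> is a difference of the
evaluations at \<open>(\<one>, x \<otimes> b)\<close> and \<open>(\<one>, x)\<close>, up to weights. So the projections of the unit vectors at
\<open>F \<times> B\<close> span a space of dimension at most \<open>card (F \<union> F B)\<close>. Their squared norms sum to \<open>card F\<close>
times the dimension to be estimated, and for Foelner sets the ratio tends to \<open>1\<close>.\<close>

lemma cocycle_space_dim:
  fixes col :: "'a \<Rightarrow> 'k"
  assumes K: "subgroup K G" and am: "amenable (G\<lparr>carrier := K\<rparr>)"
    and col: "inj_on col K" and \<omega>: "\<And>b. b \<in> K \<Longrightarrow> \<omega> b \<noteq> 0"
    and B: "finite B" "B \<subseteq> K"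
  shows "(\<Sum>b\<in>B. (norm (proj (cocycle_space K col \<omega>) (unit_vec (col b))))\<^sup>2) \<le> 1"
proof -
  let ?Z = "cocycle_space K col \<omega>"
  have KG: "K \<subseteq> carrier G" by (rule subgroup.subset[OF K])
  interpret Z: closed_subspace ?Z using cocycle_space_invariant[OF K, of col \<omega>] by (simp add: invariant_subspace_def)
  interpret KG: group "G\<lparr>carrier := K\<rparr>" by (rule subgroup.subgroup_is_group[OF K is_group])
  define t where "t = (\<Sum>b\<in>B. (norm (proj ?Z (unit_vec (col b))))\<^sup>2)"
  have "t \<le> 1 + e" if e: "e > 0" for e :: real
  proof -
    obtain F where F: "finite F" "F \<noteq> {}" "F \<subseteq> K"
      and small: "real (card (F \<union> (\<Union>b\<in>B. (\<lambda>x. x \<otimes> b) ` F))) \<le> (1 + e) * real (card F)"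
      using KG.amenable_foelner[OF am B(1) _ e] B(2) by auto
    let ?FB = "F \<union> (\<Union>b\<in>B. (\<lambda>x. x \<otimes> b) ` F)"
    let ?S = "(\<lambda>y. proj ?Z (unit_vec (col y))) ` ?FB"
    define q where "q = (\<lambda>(x, b). proj ?Z (delta (x, col b)))"
    have fin: "finite ?FB" using F B by auto
    have "(\<Sum>m\<in>F \<times> B. (norm (q m))\<^sup>2) \<le> real (card ?S)"
    proof (rule sum_norm_sq_le_card[where e = "\<lambda>(x, b). delta (x, col b)"])
      show "(case m of (x, b) \<Rightarrow> delta (x, col b)) \<bullet> (case n of (x, b) \<Rightarrow> delta (x, col b)) = (if m = n then 1 else 0)"
        if "m \<in> F \<times> B" "n \<in> F \<times> B" for m n
        using that B(2) inj_onD[OF col] by (auto simp: delta_orthonormal subset_eq simp del: inner_delta split: if_splits)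
      have "span ?S \<subseteq> ?Z" by (rule span_minimal) (auto intro: Z.subspace)
      then show "q m \<bullet> s = (case m of (x, b) \<Rightarrow> delta (x, col b)) \<bullet> s" if "s \<in> span ?S" for m s
        using that by (auto simp: q_def Z.proj_inner subset_eq split: prod.splits simp del: inner_delta)
      show "q m \<in> span ?S" if m: "m \<in> F \<times> B" for m
      proof -
        obtain x b where xb: "m = (x, b)" "x \<in> F" "b \<in> B" using m by auto
        then have K': "x \<in> K" "b \<in> K" "x \<otimes> b \<in> K" using F B subgroup.m_closed[OF K] by auto
        define p where "p y = proj ?Z (unit_vec (col y))" for y
        have "q m = \<omega> b *\<^sub>R ((1 / \<omega> (x \<otimes> b)) *\<^sub>R p (x \<otimes> b) - (1 / \<omega> x) *\<^sub>R p x)"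
          unfolding q_def xb(1) prod.case
        proof (rule Z.proj_unique)
          show "\<omega> b *\<^sub>R ((1 / \<omega> (x \<otimes> b)) *\<^sub>R p (x \<otimes> b) - (1 / \<omega> x) *\<^sub>R p x) \<in> ?Z"
            unfolding p_def by (intro subspace_scale subspace_diff Z.subspace Z.proj_in)
          fix z assume z: "z \<in> ?Z"
          have "coef z (\<one>, col (x \<otimes> b)) / \<omega> (x \<otimes> b) = coef z (\<one>, col x) / \<omega> x + coef z (\<one> \<otimes> x, col b) / \<omega> b"
            using z K' unfolding cocycle_space_def by blast
          then have "coef z (x, col b) = \<omega> b * (coef z (\<one>, col (x \<otimes> b)) / \<omega> (x \<otimes> b) - coef z (\<one>, col x) / \<omega> x)"
            using K' KG \<omega>[OF K'(2)] by (simp add: subset_eq)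
          then show "delta (x, col b) \<bullet> z = (\<omega> b *\<^sub>R ((1 / \<omega> (x \<otimes> b)) *\<^sub>R p (x \<otimes> b) - (1 / \<omega> x) *\<^sub>R p x)) \<bullet> z"
            using z by (simp add: p_def inner_diff_left Z.proj_inner)
        qed
        moreover have "p (x \<otimes> b) \<in> span ?S" "p x \<in> span ?S"
          using xb by (auto simp: p_def intro!: span_base)
        ultimately show ?thesis by (auto intro: span_scale span_diff)
      qed
    qed (use F B in auto)
    also have "\<dots> \<le> real (card ?FB)" using card_image_le[OF fin] by simp
    also have "\<dots> \<le> (1 + e) * real (card F)" by (rule small)
    finally have le: "(\<Sum>m\<in>F \<times> B. (norm (q m))\<^sup>2) \<le> (1 + e) * real (card F)" .
    have "norm (q (x, b)) = norm (proj ?Z (unit_vec (col b)))" if "x \<in> F" for x b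
    proof -
      have x: "x \<in> carrier G" using that F KG by auto
      have "q (x, b) = translate G x (proj ?Z (unit_vec (col b)))"
        using proj_translate[of ?Z x "unit_vec (col b)"] cocycle_space_invariant[OF K, of col \<omega>] x
        by (simp add: q_def translate_delta invariant_subspace_def)
      moreover have "proj ?Z (unit_vec (col b)) \<in> supp_in (carrier G \<times> UNIV)"
        using Z.proj_in[of "unit_vec (col b)"] by (auto simp: cocycle_space_def intro: supp_in_mono)
      ultimately show ?thesis using x by (simp add: translate_norm)
    qed
    then have "(\<Sum>x\<in>F. \<Sum>b\<in>B. (norm (q (x, b)))\<^sup>2) = real (card F) * t"
      by (simp add: t_def)
    then have "(\<Sum>m\<in>F \<times> B. (norm (q m))\<^sup>2) = real (card F) * t"
      by (simp add: sum.cartesian_product)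
    with le have "real (card F) * t \<le> real (card F) * (1 + e)" by (simp add: mult.commute)
    moreover have "0 < real (card F)" using F by (simp add: card_gt_0_iff)
    ultimately show ?thesis by simp
  qed
  then show ?thesis using field_le_epsilon[of t 1] by (auto simp: t_def)
qed

lemma ex_summable_weights:
  fixes w :: "'a \<Rightarrow> 'h::real_normed_vector"
  assumes "countable K"
  shows "\<exists>\<omega>. (\<forall>b. 0 < (\<omega> b :: real)) \<and> (\<lambda>b. (\<omega> b * norm (w b))\<^sup>2) summable_on K"
proof -
  define \<omega> where "\<omega> b = (1/2) ^ to_nat_on K b / (1 + norm (w b))" for b
  have pos: "0 < 1 + norm (w b)" for b using norm_ge_zero[of "w b"] by linarith
  then have "\<forall>b. 0 < \<omega> b" by (simp add: \<omega>_def)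
  moreover have "(\<lambda>b. (\<omega> b * norm (w b))\<^sup>2) summable_on K"
  proof (rule summable_on_comparison_test)
    have "(\<lambda>n. (1/2::real) ^ n) summable_on UNIV"
      by (intro norm_summable_imp_summable_on) (simp add: summable_geometric)
    then have "(\<lambda>n. (1/2::real) ^ n) summable_on to_nat_on K ` K"
      by (rule summable_on_subset_banach) simp
    then show "(\<lambda>b. (1/2::real) ^ to_nat_on K b) summable_on K"
      using summable_on_reindex[OF inj_on_to_nat_on[OF assms], of "\<lambda>n. (1/2::real) ^ n"] by (simp add: o_def)
    show "(\<omega> b * norm (w b))\<^sup>2 \<le> (1/2) ^ to_nat_on K b" for b
    proof -
      have "norm (w b) / (1 + norm (w b)) \<le> 1" using pos[of b] by (simp add: divide_le_eq)
      then have "\<omega> b * norm (w b) \<le> (1/2) ^ to_nat_on K b"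
        using mult_left_mono[of "norm (w b) / (1 + norm (w b))" 1 "(1/2) ^ to_nat_on K b"] by (simp add: \<omega>_def)
      moreover have "0 \<le> \<omega> b * norm (w b)" using pos[of b] by (simp add: \<omega>_def)
      moreover have "(1/2::real) ^ to_nat_on K b \<le> 1" by (simp add: power_le_one)
      ultimately show ?thesis using mult_mono[of "\<omega> b * norm (w b)" "(1/2) ^ to_nat_on K b" "\<omega> b * norm (w b)" 1]
        by (simp add: power2_eq_square)
    qed
  qed auto
  ultimately show ?thesis by blast
qed

text \<open>The orthogonal complement, within the columns \<open>I\<close>, of the invariant subspace generated by \<open>w\<close>.\<close>

definition annihilator :: "'a set \<Rightarrow> 'k set \<Rightarrow> ('a \<Rightarrow> ('a \<times> 'k) l2) \<Rightarrow> ('a \<times> 'k) l2 set"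
  where "annihilator K I w = {f \<in> supp_in (carrier G \<times> I). \<forall>g\<in>carrier G. \<forall>b\<in>K. f \<bullet> translate G g (w b) = 0}"

text \<open>The space \<open>\<Gamma>\<close> is the graph of the closed operator that sends \<open>f\<close> to the weighted coefficients
\<open>\<omega> b * (f \<bullet> translate G g (w b))\<close>. Its domain is dense, as it contains the unit vectors, so \<open>\<Gamma>\<close>
has dimension at least \<open>card I\<close>. Its range lies in a cocycle space, of dimension at most \<open>1\<close>, and its
kernel is the annihilator. The graph is used because the operator itself can be unbounded.\<close>

lemma annihilator_dim:
  fixes w :: "'a \<Rightarrow> ('a \<times> 'k) l2" and col :: "'a \<Rightarrow> 'k"
  assumes K: "subgroup K G" and am: "amenable (G\<lparr>carrier := K\<rparr>)" and cK: "countable K"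
    and col: "inj_on col K" and I: "finite I" "I \<inter> col ` K = {}"
    and w: "\<And>b. b \<in> K \<Longrightarrow> w b \<in> supp_in (carrier G \<times> I)"
    and coc: "\<And>a b. a \<in> K \<Longrightarrow> b \<in> K \<Longrightarrow> w (a \<otimes> b) = w a + translate G a (w b)"
  shows "real (card I) \<le> (\<Sum>i\<in>I. (norm (proj (annihilator K I w) (unit_vec i)))\<^sup>2) + 1"
proof -
  let ?J = "col ` K"
  have KG: "K \<subseteq> carrier G" by (rule subgroup.subset[OF K])
  \<comment> \<open>weights that make the unit vectors of the columns \<open>I\<close> belong to the domain\<close>
  obtain \<omega> where \<omega>: "\<And>b. 0 < \<omega> b" and sum\<omega>: "(\<lambda>b. (\<omega> b * norm (w b))\<^sup>2) summable_on K"
    using ex_summable_weights[OF cK, of w] by (elim exE conjE) auto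
  have \<omega>0: "\<omega> b \<noteq> 0" for b using \<omega>[of b] by simp
  define h where "h g b f = coef f (g, col b) - (f \<bullet> translate G g (w b)) * \<omega> b" for g b f
  define \<F> where "\<F> = (\<lambda>y z. coef z y) ` (- (carrier G \<times> (I \<union> ?J))) \<union> (\<lambda>(g, b). h g b) ` (carrier G \<times> K)"
  define \<Gamma> where "\<Gamma> = {z. \<forall>f\<in>\<F>. f z = 0}"
  have \<Gamma>_iff: "f \<in> \<Gamma> \<longleftrightarrow> f \<in> supp_in (carrier G \<times> (I \<union> ?J)) \<and>
      (\<forall>g\<in>carrier G. \<forall>b\<in>K. coef f (g, col b) = (f \<bullet> translate G g (w b)) * \<omega> b)" for f
    unfolding \<Gamma>_def \<F>_def supp_in_def by (auto simp: h_def ball_Un)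
  have "bounded_linear (h g b)" for g b
    unfolding h_def
    by (intro bounded_linear_sub bounded_linear_mult_left[THEN bounded_linear_compose] bounded_linear_coef bounded_linear_inner_left)
  then have c\<Gamma>: "closed_subspace \<Gamma>"
    unfolding \<Gamma>_def by (intro closed_subspace_kernels) (auto simp: \<F>_def bounded_linear_coef)
  have "translate G g f \<in> \<Gamma>" if "g \<in> carrier G" "f \<in> \<Gamma>" for g f
    using that unfolding \<Gamma>_iff
    by (auto simp: translate_in coef_translate translate_inner translate_translate)
  then have i\<Gamma>: "invariant_subspace \<Gamma>" using c\<Gamma> by (simp add: invariant_subspace_def)
  interpret \<Gamma>: closed_subspace \<Gamma> by (rule c\<Gamma>)
  have s\<Gamma>: "\<Gamma> \<subseteq> supp_in (carrier G \<times> (I \<union> ?J))" by (auto simp: \<Gamma>_iff)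
  let ?Z = "cocycle_space K col \<omega>"
  have iZ: "invariant_subspace ?Z" by (rule cocycle_space_invariant[OF K])
  then interpret Z: closed_subspace ?Z by (simp add: invariant_subspace_def)
  have sZ: "?Z \<subseteq> supp_in (carrier G \<times> ?J)" by (auto simp: cocycle_space_def)
  have cutZ: "cut (carrier G \<times> ?J) f \<in> ?Z" if f: "f \<in> \<Gamma>" for f
  proof -
    have val: "coef f (g, col b) / \<omega> b = f \<bullet> translate G g (w b)" if "g \<in> carrier G" "b \<in> K" for g b
      using f that \<omega>0[of b] unfolding \<Gamma>_iff by simp
    have "f \<bullet> translate G g (w (a \<otimes> b)) = f \<bullet> translate G g (w a) + f \<bullet> translate G (g \<otimes> a) (w b)"
      if "g \<in> carrier G" "a \<in> K" "b \<in> K" for g a b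
      using that KG by (simp add: coc linear_add[OF translate_linear] inner_add_right translate_translate subset_eq)
    then show ?thesis
      using KG subgroup.m_closed[OF K] unfolding cocycle_space_def
      by (auto simp: val subset_eq)
  qed
  have ZB: "(\<Sum>j\<in>X. (norm (proj ?Z (unit_vec j)))\<^sup>2) \<le> 1" if X: "finite X" "X \<subseteq> ?J" for X
  proof -
    obtain B where B: "B \<subseteq> K" "finite B" "X = col ` B" using finite_subset_image[OF X] by auto
    then show ?thesis
      using cocycle_space_dim[OF K am col \<omega>0 B(2,1)] by (simp add: sum.reindex[OF inj_on_subset[OF col]])
  qed
  have sumZ: "(\<lambda>j. (norm (proj ?Z (unit_vec j)))\<^sup>2) summable_on ?J"
    by (rule nonneg_bdd_above_summable_on) (auto intro!: bdd_aboveI[of _ 1] ZB)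
  have infZ: "(\<Sum>\<^sub>\<infinity>j\<in>?J. (norm (proj ?Z (unit_vec j)))\<^sup>2) \<le> 1"
    using sumZ by (rule infsum_le_finite_sums) (rule ZB)
  have sum\<Gamma>: "(\<lambda>j. (norm (proj \<Gamma> (unit_vec j)))\<^sup>2) summable_on ?J"
  proof (rule summable_on_comparison_test[OF sumZ])
    fix j assume j: "j \<in> ?J"
    let ?p = "proj \<Gamma> (unit_vec j)" and ?c = "cut (carrier G \<times> ?J)"
    have "(norm ?p)\<^sup>2 = ?p \<bullet> ?c (unit_vec j)"
      using j by (simp only: \<Gamma>.proj_norm_sq cut_unit_vec)
    also have "\<dots> = ?c ?p \<bullet> proj ?Z (unit_vec j)"
      by (metis Z.proj_inner cut_sym cutZ[OF \<Gamma>.proj_in] inner_commute)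
    also have "\<dots> \<le> norm ?p * norm (proj ?Z (unit_vec j))"
      by (rule order_trans[OF norm_cauchy_schwarz]) (simp add: mult_right_mono cut_norm)
    finally have "norm ?p \<le> norm (proj ?Z (unit_vec j))"
      by (cases "norm ?p = 0") (auto simp: power2_eq_square)
    then show "(norm ?p)\<^sup>2 \<le> (norm (proj ?Z (unit_vec j)))\<^sup>2" by (simp add: power_mono)
  qed simp
  have dense: "u = 0" if u: "u \<in> supp_in (carrier G \<times> I)" and orth: "\<And>f. f \<in> \<Gamma> \<Longrightarrow> u \<bullet> f = 0" for u
  proof -
    have "coef u (x, i) = 0" if x: "x \<in> carrier G" and i: "i \<in> I" for x i
    proof -
      define b where "b k = the_inv_into K col k" for k
      have b: "b (col k) = k" if "k \<in> K" for k using the_inv_into_f_f[OF col that] by (simp add: b_def)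
      have colI: "col k \<notin> I" if "k \<in> K" for k using that I by auto
      define F where "F = (\<lambda>(y, k). if k \<in> ?J \<and> y \<in> carrier G then \<omega> (b k) * coef (w (b k)) (inv y \<otimes> x, i) else 0)"
      have "(\<lambda>p. (F p)\<^sup>2) summable_on UNIV"
      proof (rule square_summableI)
        fix X :: "('a \<times> 'k) set" assume X: "finite X"
        define B where "B = b ` (snd ` X \<inter> ?J)"
        have B: "finite B" "B \<subseteq> K" using X by (auto simp: B_def b)
        define Y where "Y = fst ` X \<inter> carrier G"
        have Y: "finite Y" "Y \<subseteq> carrier G" using X by (auto simp: Y_def)
        have "(\<Sum>p\<in>X. (F p)\<^sup>2) = (\<Sum>p\<in>X \<inter> carrier G \<times> ?J. (F p)\<^sup>2)"
          using X by (intro sum.mono_neutral_right) (auto simp: F_def split: if_splits)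
        also have "\<dots> = (\<Sum>(y, k)\<in>(\<lambda>(y, k). (y, b k)) ` (X \<inter> carrier G \<times> ?J). (\<omega> k * coef (w k) (inv y \<otimes> x, i))\<^sup>2)"
        proof (subst sum.reindex)
          show "inj_on (\<lambda>(y, k). (y, b k)) (X \<inter> carrier G \<times> ?J)"
            by (rule inj_onI) (auto simp: b)
        qed (auto simp: F_def intro!: sum.cong)
        also have "\<dots> \<le> (\<Sum>(y, k)\<in>Y \<times> B. (\<omega> k * coef (w k) (inv y \<otimes> x, i))\<^sup>2)"
          using Y B X by (intro sum_mono2) (force simp: Y_def B_def)+
        also have "\<dots> = (\<Sum>k\<in>B. \<Sum>y\<in>Y. (\<omega> k * coef (w k) (inv y \<otimes> x, i))\<^sup>2)"
          by (simp add: sum.cartesian_product[symmetric]) (rule sum.swap)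
        also have "\<dots> \<le> (\<Sum>k\<in>B. (\<omega> k * norm (w k))\<^sup>2)"
        proof (rule sum_mono)
          fix k assume "k \<in> B"
          have inj: "inj_on (\<lambda>y. (inv y \<otimes> x, i)) Y"
            using Y x by (intro inj_onI) (auto simp: subset_eq)
          have "(\<Sum>y\<in>Y. (coef (w k) (inv y \<otimes> x, i))\<^sup>2) = (\<Sum>p\<in>(\<lambda>y. (inv y \<otimes> x, i)) ` Y. (coef (w k) p)\<^sup>2)"
            by (subst sum.reindex[OF inj]) simp
          also have "\<dots> \<le> (norm (w k))\<^sup>2" using Y by (intro sum_sq_le_norm_l2) simp
          finally show "(\<Sum>y\<in>Y. (\<omega> k * coef (w k) (inv y \<otimes> x, i))\<^sup>2) \<le> (\<omega> k * norm (w k))\<^sup>2"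
            by (simp add: power_mult_distrib mult_left_mono flip: sum_distrib_left)
        qed
        also have "\<dots> \<le> (\<Sum>\<^sub>\<infinity>k\<in>K. (\<omega> k * norm (w k))\<^sup>2)"
          using B by (intro finite_sum_le_infsum sum\<omega>) auto
        finally show "(\<Sum>p\<in>X. (F p)\<^sup>2) \<le> (\<Sum>\<^sub>\<infinity>k\<in>K. (\<omega> k * norm (w k))\<^sup>2)" .
      qed
      from coef_Abs[OF this] have cF: "coef (Abs_l2 F) (y, k) =
          (if k \<in> ?J \<and> y \<in> carrier G then \<omega> (b k) * coef (w (b k)) (inv y \<otimes> x, i) else 0)" for y k
        by (simp add: F_def)
      define f where "f = delta (x, i) + Abs_l2 F"
      have fI: "cut (carrier G \<times> I) f = delta (x, i)"
        using x i colI by (intro l2_eqI) (auto simp: f_def coef_delta cF split: if_splits)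
      have "f \<in> \<Gamma>" unfolding \<Gamma>_iff
      proof (intro conjI ballI)
        show "f \<in> supp_in (carrier G \<times> (I \<union> ?J))"
          using x i by (auto simp: supp_in_def f_def coef_delta cF split: if_splits)
        fix g k assume g: "g \<in> carrier G" and k: "k \<in> K"
        have "f \<bullet> translate G g (w k) = cut (carrier G \<times> I) f \<bullet> translate G g (w k)"
          using translate_in[OF g w[OF k]] by (simp add: cut_sym cut_id)
        also have "\<dots> = coef (w k) (inv g \<otimes> x, i)" using g x by (simp add: fI coef_translate)
        finally show "coef f (g, col k) = (f \<bullet> translate G g (w k)) * \<omega> k"
          using g k i colI[OF k] by (auto simp: f_def coef_delta cF b)
      qed
      then have "u \<bullet> cut (carrier G \<times> I) f = 0" using orth u by (simp add: cut_id flip: cut_sym)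
      then show ?thesis by (simp add: fI)
    qed
    then show ?thesis using u by (intro l2_eqI) (auto simp: supp_in_def)
  qed
  have ann: "\<Gamma> \<inter> supp_in (carrier G \<times> I) = annihilator K I w"
  proof -
    have "coef f (g, col b) = 0" if "f \<in> supp_in (carrier G \<times> I)" "b \<in> K" for f g b
      using that I by (auto simp: supp_in_def)
    then show ?thesis
      using \<omega>0 unfolding annihilator_def by (auto simp: \<Gamma>_iff intro: supp_in_mono)
  qed
  have "real (card I) \<le> (\<Sum>i\<in>I. (norm (proj \<Gamma> (unit_vec i)))\<^sup>2) + (\<Sum>\<^sub>\<infinity>j\<in>?J. (norm (proj \<Gamma> (unit_vec j)))\<^sup>2)"
    by (rule dim_ge_of_dense[OF i\<Gamma> s\<Gamma> I(2,1) dense sum\<Gamma>])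
  also have "\<dots> \<le> (\<Sum>i\<in>I. (norm (proj (annihilator K I w) (unit_vec i)))\<^sup>2) + (\<Sum>\<^sub>\<infinity>j\<in>?J. (norm (proj ?Z (unit_vec j)))\<^sup>2)"
    using dim_kernel_ge[OF i\<Gamma> s\<Gamma> I(2,1) Z.closed_subspace_axioms sZ cutZ sumZ sum\<Gamma>] unfolding ann .
  finally show ?thesis using infZ by linarith
qed

end

section \<open>Equivariant contractions that bound a cocycle\<close>

context group
begin

text \<open>Operators that can be applied to a quasi-cocycle without increasing its defect. For one copy of the
regular representation they are right convolutions.\<close>

definition multiplier :: "'k set \<Rightarrow> (('a \<times> 'k) l2 \<Rightarrow> ('a \<times> 'k) l2) \<Rightarrow> bool"
  where "multiplier A T \<longleftrightarrow> linear T \<and> (\<forall>f. norm (T f) \<le> norm f) \<and>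
    (\<forall>f. T f \<in> supp_in (carrier G \<times> A)) \<and>
    (\<forall>g\<in>carrier G. \<forall>f. T (translate G g f) = translate G g (T f))"

lemma multiplier_cut: "multiplier A (cut (carrier G \<times> A))"
  by (simp add: multiplier_def cut_linear cut_norm translate_cut)

lemma multiplier_compose:
  assumes "multiplier A S" "multiplier A T"
  shows "multiplier A (\<lambda>f. S (T f))"
  using assms linear_compose[of T S] unfolding multiplier_def
  by (auto simp: o_def intro: order_trans)

lemma multiplier_mono: "multiplier A T \<Longrightarrow> A \<subseteq> B \<Longrightarrow> multiplier B T"
  unfolding multiplier_def by (auto intro!: supp_in_mono[of _ "carrier G \<times> A" "carrier G \<times> B"])

text \<open>For \<open>C = 0\<close> these are the cocycles.\<close>

definition quasi_cocycle_on :: "'a set \<Rightarrow> 'k set \<Rightarrow> real \<Rightarrow> ('a \<Rightarrow> ('a \<times> 'k) l2) \<Rightarrow> bool"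
  where "quasi_cocycle_on K A C c \<longleftrightarrow> (\<forall>g\<in>K. c g \<in> supp_in (carrier G \<times> A)) \<and>
    (\<forall>g\<in>K. \<forall>h\<in>K. norm (translate G g (c h) - c (g \<otimes> h) + c g) \<le> C)"

lemma quasi_cocycle_on_multiplier:
  assumes K: "K \<subseteq> carrier G" and c: "quasi_cocycle_on K A C c" and T: "multiplier B T"
  shows "quasi_cocycle_on K B C (\<lambda>g. T (c g))"
proof -
  have "norm (translate G g (T (c h)) - T (c (g \<otimes> h)) + T (c g)) \<le> C" if "g \<in> K" "h \<in> K" for g h
  proof -
    have lin: "linear T" using T by (simp add: multiplier_def)
    have "translate G g (T (c h)) - T (c (g \<otimes> h)) + T (c g) = T (translate G g (c h) - c (g \<otimes> h) + c g)"
      using T K that by (auto simp: multiplier_def linear_add[OF lin] linear_diff[OF lin] subset_eq)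
    then show ?thesis using T c that unfolding multiplier_def quasi_cocycle_on_def by (metis order_trans)
  qed
  then show ?thesis using T by (simp add: quasi_cocycle_on_def multiplier_def)
qed

text \<open>The column \<open>s\<close> carries the additional cocycle \<open>b \<mapsto> \<delta>\<^sub>b - \<delta>\<^sub>1\<close>; the columns \<open>col b\<close> are used for
the cocycle space in the dimension count.\<close>

lemma cocycle_bounded_multiplier:
  fixes c :: "'a \<Rightarrow> ('a \<times> 'k) l2" and col :: "'a \<Rightarrow> 'k"
  assumes K: "subgroup K G" and am: "amenable (G\<lparr>carrier := K\<rparr>)" and cK: "countable K" and infK: "infinite K"
    and col: "inj_on col K" and I: "finite I" "I \<inter> col ` K = {}" and s: "s \<notin> I" "s \<notin> col ` K"
    and c: "quasi_cocycle_on K I 0 c"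
    and v: "v \<in> supp_in (carrier G \<times> I)" and e: "e > 0"
  shows "\<exists>T. multiplier I T \<and> (\<exists>L. \<forall>b\<in>K. norm (T (c b)) \<le> L) \<and> norm (T v - v) < e"
proof -
  have KG: "K \<subseteq> carrier G" by (rule subgroup.subset[OF K])
  have oneK: "\<one> \<in> K" by (rule subgroup.one_closed[OF K])
  have csupp: "c b \<in> supp_in (carrier G \<times> I)" if "b \<in> K" for b using c that by (simp add: quasi_cocycle_on_def)
  have ccoc: "c (a \<otimes> b) = c a + translate G a (c b)" if "a \<in> K" "b \<in> K" for a b
    using c that by (simp add: quasi_cocycle_on_def algebra_simps)
  let ?I = "insert s I"
  define w where "w b = c b + (delta (b, s) - delta (\<one>, s))" for b
  let ?D = "annihilator K ?I w"
  have wsupp: "w b \<in> supp_in (carrier G \<times> ?I)" if "b \<in> K" for b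
    using csupp[OF that] that KG by (auto simp: w_def supp_in_def coef_delta)
  have wcoc: "w (a \<otimes> b) = w a + translate G a (w b)" if "a \<in> K" "b \<in> K" for a b
    using that KG by (simp add: w_def ccoc subset_eq translate_delta linear_add[OF translate_linear] linear_diff[OF translate_linear])
  have D_iff: "f \<in> ?D \<longleftrightarrow> f \<in> supp_in (carrier G \<times> ?I) \<and> (\<forall>g\<in>carrier G. \<forall>b\<in>K. f \<bullet> translate G g (w b) = 0)" for f
    by (simp add: annihilator_def)
  have "?D = {f. \<forall>h\<in>(\<lambda>y z. coef z y) ` (- (carrier G \<times> ?I)) \<union> (\<lambda>(g, b) f. f \<bullet> translate G g (w b)) ` (carrier G \<times> K). h f = 0}"
    unfolding annihilator_def supp_in_def by (auto simp: ball_Un)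
  also have "closed_subspace \<dots>"
    by (rule closed_subspace_kernels) (auto simp: bounded_linear_coef bounded_linear_inner_left)
  finally have cD: "closed_subspace ?D" .
  have "translate G g f \<in> ?D" if "g \<in> carrier G" "f \<in> ?D" for g f
    using that unfolding D_iff by (auto simp: translate_in translate_inner translate_translate)
  then have iD: "invariant_subspace ?D" using cD by (simp add: invariant_subspace_def)
  interpret D: closed_subspace ?D by (rule cD)
  \<comment> \<open>such a vector is constant on the left cosets of \<open>K\<close>\<close>
  have inj: "y = 0" if y: "y \<in> ?D" "y \<in> supp_in (carrier G \<times> {s})" for y
  proof -
    have const: "coef y (g \<otimes> b, s) = coef y (g, s)" if g: "g \<in> carrier G" and b: "b \<in> K" for g b
    proof -
      have bG: "b \<in> carrier G" using b KG by auto
      have "y \<bullet> translate G g (c b) = cut (carrier G \<times> {s}) y \<bullet> translate G g (c b)"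
        using y by (simp add: cut_id)
      also have "\<dots> = y \<bullet> cut (carrier G \<times> {s}) (cut (carrier G \<times> I) (translate G g (c b)))"
        using translate_in[OF g csupp[OF b]] by (simp add: cut_sym cut_id)
      also have "carrier G \<times> {s} \<inter> carrier G \<times> I = {}" using s by auto
      then have "cut (carrier G \<times> {s}) (cut (carrier G \<times> I) (translate G g (c b))) = 0"
        by (intro l2_eqI) auto
      finally have "y \<bullet> translate G g (c b) = 0" by simp
      moreover have "y \<bullet> translate G g (w b) = 0" using y g b by (simp add: D_iff)
      ultimately show ?thesis
        using g bG by (simp add: w_def linear_add[OF translate_linear] linear_diff[OF translate_linear]
            inner_add_right inner_diff_right translate_delta)
    qed
    have "coef y (g, s) = 0" if g: "g \<in> carrier G" for g
    proof (rule l2_infinite_constant)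
      have "inj_on (\<lambda>b. (g \<otimes> b, s)) K" using g KG by (intro inj_onI) (auto simp: subset_eq)
      then show "infinite ((\<lambda>b. (g \<otimes> b, s)) ` K)" using infK by (simp add: finite_image_iff)
      show "coef y p = coef y (g, s)" if "p \<in> (\<lambda>b. (g \<otimes> b, s)) ` K" for p
        using that const[OF g] by auto
    qed
    then have "coef y p = 0" if "p \<in> carrier G \<times> {s}" for p
      using that by auto
    moreover have "coef y p = 0" if "p \<notin> carrier G \<times> {s}" for p
      using y(2) that unfolding supp_in_def by blast
    ultimately have "coef y p = 0" for p by blast
    then show "y = 0" by (intro l2_eqI) simp
  qed
  have dim: "real (card ?I) \<le> (\<Sum>i\<in>?I. (norm (proj ?D (unit_vec i)))\<^sup>2) + 1"
    by (rule annihilator_dim[OF K am cK col _ _ wsupp wcoc]) (use I s in auto)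
  have dense: "u = 0" if u: "u \<in> supp_in (carrier G \<times> I)" "\<And>f. f \<in> ?D \<Longrightarrow> u \<bullet> f = 0" for u
  proof (rule dense_of_dim_ge[OF iD _ s(1) I(1) inj _ u])
    show "?D \<subseteq> supp_in (carrier G \<times> (I \<union> {s}))" by (auto simp: D_iff)
    show "real (card I) \<le> (\<Sum>i\<in>I. (norm (proj ?D (unit_vec i)))\<^sup>2) + (norm (proj ?D (unit_vec s)))\<^sup>2"
      using dim I s by simp
  qed
  let ?c = "cut (carrier G \<times> I)"
  define a where "a = compress (carrier G \<times> I) ?D"
  define E where "E = (\<lambda>v. ?c v - a v)"
  interpret E: positive_contraction E
    unfolding E_def a_def by (rule co_compress_positive_contraction[OF cD])
  have fixE: "proj {x. E x = x} y = 0" for y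
  proof -
    have "E (proj {x. E x = x} y) = proj {x. E x = x} y" using E.fixp.proj_in[of y] by simp
    then show ?thesis unfolding E_def a_def co_compress_fix_iff[OF cD] by (intro dense) auto
  qed
  have "(\<lambda>n. norm ((E ^^ n) v)) \<longlonglongrightarrow> norm (proj {x. E x = x} v)"
    by (intro tendsto_norm E.pow_tendsto)
  then have "(\<lambda>n. norm ((E ^^ n) v)) \<longlonglongrightarrow> 0" by (simp add: fixE)
  from order_tendstoD(2)[OF this e] obtain n where n: "norm ((E ^^ n) v) < e"
    using eventually_sequentially by auto
  \<comment> \<open>on these columns \<open>T = 1 - E\<^sup>n\<close> is a multiple of \<open>a = 1 - E\<close>, which is bounded on the cocycle\<close>
  define T where "T f = ?c f - (E ^^ n) (?c f)" for f
  have Esupp: "(E ^^ k) f \<in> supp_in (carrier G \<times> I)" if "f \<in> supp_in (carrier G \<times> I)" for k f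
  proof (cases k)
    case (Suc j)
    interpret S: closed_subspace "supp_in (carrier G \<times> I)" by (rule closed_subspace_supp_in)
    show ?thesis unfolding Suc funpow.simps o_apply E_def a_def compress_def
      by (intro subspace_diff[OF S.subspace] cut_in)
  qed (use that in simp)
  have Etr: "E (translate G g f) = translate G g (E f)" if "g \<in> carrier G" for g f
  proof -
    have "proj ?D (translate G g y) = translate G g (proj ?D y)" for y
      by (rule proj_translate) (use iD that in \<open>auto simp: invariant_subspace_def\<close>)
    then show ?thesis using that
      by (simp add: E_def a_def compress_def translate_cut linear_diff[OF translate_linear])
  qed
  have Entr: "(E ^^ k) (translate G g f) = translate G g ((E ^^ k) f)" if "g \<in> carrier G" for g f k
    by (induction k) (simp_all add: Etr that)
  have "multiplier I T"
    unfolding multiplier_def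
  proof (intro conjI allI ballI)
    show "linear T" unfolding T_def
      using linear_compose_sub[OF cut_linear linear_compose[OF cut_linear E.pow_linear]] by (simp add: o_def)
    show "norm (T f) \<le> norm f" for f
      unfolding T_def using order_trans[OF E.one_minus_pow_contract cut_norm] .
    interpret S: closed_subspace "supp_in (carrier G \<times> I)" by (rule closed_subspace_supp_in)
    show "T f \<in> supp_in (carrier G \<times> I)" for f
      unfolding T_def by (intro subspace_diff[OF S.subspace] cut_in Esupp)
    show "T (translate G g f) = translate G g (T f)" if "g \<in> carrier G" for g f
      using that by (simp add: T_def translate_cut Entr linear_diff[OF translate_linear])
  qed
  moreover have "norm (T (c b)) \<le> 2 * real n" if b: "b \<in> K" for b
  proof -
    have "proj ?D (w b) = 0"
    proof (rule D.proj_zero)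
      fix z assume z: "z \<in> ?D"
      then have "z \<bullet> translate G \<one> (w b) = 0" using b by (simp add: D_iff)
      moreover have "translate G \<one> (w b) = w b"
        unfolding translate_one by (rule cut_id) (rule supp_in_mono[OF wsupp[OF b]], auto)
      ultimately show "w b \<bullet> z = 0" by (simp add: inner_commute)
    qed
    then have "proj ?D (c b) = - proj ?D (delta (b, s) - delta (\<one>, s))"
      by (simp add: w_def D.proj_add eq_neg_iff_add_eq_0)
    then have "norm (proj ?D (c b)) \<le> norm (delta (b, s) - delta (\<one>, s))"
      using D.proj_norm by simp
    also have "\<dots> \<le> 2" using norm_triangle_ineq4[of "delta (b, s)" "delta (\<one>, s)"] by simp
    finally have a2: "norm (a (c b)) \<le> 2"
      using order_trans[OF cut_norm] csupp[OF b] by (simp add: a_def compress_def cut_id)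
    have "norm (c b - (E ^^ k) (c b)) \<le> 2 * real k" for k
    proof (induction k)
      case (Suc k)
      have eq: "(E ^^ Suc k) (c b) = (E ^^ k) (c b) - (E ^^ k) (a (c b))"
      proof -
        have "E (c b) = c b - a (c b)" using csupp[OF b] by (simp add: E_def cut_id)
        then show ?thesis by (simp only: funpow_Suc_right o_apply linear_diff[OF E.pow_linear])
      qed
      have "norm ((E ^^ k) (a (c b))) \<le> norm (a (c b))"
        by (induction k) (use E.contract order_trans in auto)
      moreover have "norm (c b - (E ^^ Suc k) (c b)) \<le> norm (c b - (E ^^ k) (c b)) + norm ((E ^^ k) (a (c b)))"
        unfolding eq diff_diff_eq2 using norm_triangle_ineq[of "c b - (E ^^ k) (c b)" "(E ^^ k) (a (c b))"]
        by (simp add: algebra_simps)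
      ultimately show ?case using Suc a2 by (simp del: funpow.simps)
    qed simp
    then show ?thesis using csupp[OF b] by (simp add: T_def cut_id)
  qed
  moreover have "norm (T v - v) < e" using n v by (simp add: T_def cut_id)
  ultimately show ?thesis by blast
qed

lemma mean_le:
  assumes \<mu>: "left_invariant_mean G \<mu>" and f: "f \<in> bounded_functions G" "\<And>x. x \<in> carrier G \<Longrightarrow> f x \<le> M"
  shows "\<mu> f \<le> M"
proof -
  have c: "(\<lambda>x. 1) \<in> bounded_functions G" "(\<lambda>x. M * 1) \<in> bounded_functions G" "(\<lambda>x. -1 * f x) \<in> bounded_functions G"
    using f(1) by (auto intro: bounded_functionsI[of G _ "\<bar>M\<bar>"] bounded_functionsI[of G _ 1]
        simp: bounded_functions_def bounded_iff)
  have "0 \<le> \<mu> (\<lambda>x. M * 1 + -1 * f x)"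
    by (rule mean_nonneg[OF \<mu> bounded_functions_add[OF c(2,3)]]) (use f(2) in simp)
  also have "\<dots> = M - \<mu> f"
    by (subst mean_add[OF \<mu> c(2,3)], subst mean_scale[OF \<mu> c(1)], subst mean_scale[OF \<mu> f(1)])
       (simp add: mean_one[OF \<mu>])
  finally show ?thesis by simp
qed

lemma mean_sum:
  assumes \<mu>: "left_invariant_mean G \<mu>" and X: "finite X" and f: "\<And>y. y \<in> X \<Longrightarrow> f y \<in> bounded_functions G"
  shows "(\<lambda>x. \<Sum>y\<in>X. r y * f y x) \<in> bounded_functions G \<and> \<mu> (\<lambda>x. \<Sum>y\<in>X. r y * f y x) = (\<Sum>y\<in>X. r y * \<mu> (f y))"
  using X f
proof (induction X rule: finite_induct)
  case empty
  have "(\<lambda>x. 0) \<in> bounded_functions G" by (rule bounded_functionsI[of G _ 0]) simp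
  then show ?case using mean_scale[OF \<mu>, of "\<lambda>x. 0" 0] by simp
next
  case (insert y X)
  have 1: "(\<lambda>x. r y * f y x) \<in> bounded_functions G"
  proof -
    obtain M where "\<And>x. x \<in> carrier G \<Longrightarrow> \<bar>f y x\<bar> \<le> M"
      using insert.prems[of y] by (auto simp: bounded_functions_def bounded_iff)
    then show ?thesis by (intro bounded_functionsI[of G _ "\<bar>r y\<bar> * M"]) (simp add: abs_mult mult_left_mono)
  qed
  have 2: "(\<lambda>x. \<Sum>y\<in>X. r y * f y x) \<in> bounded_functions G" "\<mu> (\<lambda>x. \<Sum>y\<in>X. r y * f y x) = (\<Sum>y\<in>X. r y * \<mu> (f y))"
    using insert by auto
  show ?case
    using insert.hyps bounded_functions_add[OF 1 2(1)] mean_add[OF \<mu> 1 2(1)] mean_scale[OF \<mu> insert.prems[of y], of "r y"] 2(2)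
    by simp
qed

text \<open>The defect \<open>\<beta>\<close> satisfies \<open>g \<beta>(h, n) - \<beta>(g h, n) + \<beta>(g, h n) - \<beta>(g, h) = 0\<close>. Taking the
coordinatewise mean over \<open>n\<close>, left invariance turns the third term into the mean of \<open>\<beta>(g, n)\<close>. Hence
the mean is a bounded function with the same defect as \<open>c\<close>, and subtracting it leaves a
cocycle.\<close>

lemma quasi_cocycle_near_cocycle:
  fixes c :: "'a \<Rightarrow> ('a \<times> 'k) l2"
  assumes K: "subgroup K G" and am: "amenable (G\<lparr>carrier := K\<rparr>)"
    and c: "quasi_cocycle_on K A C c"
  shows "\<exists>c'. quasi_cocycle_on K A 0 c' \<and> (\<forall>g\<in>K. norm (c g - c' g) \<le> C)"
proof -
  let ?G = "G\<lparr>carrier := K\<rparr>"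
  have KG: "\<And>g. g \<in> K \<Longrightarrow> g \<in> carrier G" using subgroup.subset[OF K] by auto
  interpret KG: group ?G by (rule subgroup.subgroup_is_group[OF K is_group])
  obtain \<mu> where \<mu>: "left_invariant_mean ?G \<mu>" using amenable_mean[OF am] by (rule exE)
  have supp: "c g \<in> supp_in (carrier G \<times> A)" if "g \<in> K" for g using c that by (simp add: quasi_cocycle_on_def)
  define \<beta> where "\<beta> g h = translate G g (c h) - c (g \<otimes> h) + c g" for g h
  have \<beta>C: "norm (\<beta> g h) \<le> C" if "g \<in> K" "h \<in> K" for g h
    using c that by (simp add: quasi_cocycle_on_def \<beta>_def)
  have C0: "0 \<le> C" using \<beta>C[OF subgroup.one_closed[OF K] subgroup.one_closed[OF K]] norm_ge_zero order_trans by blast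
  have bdd: "(\<lambda>h. coef (\<beta> g h) y) \<in> bounded_functions ?G" if g: "g \<in> K" for g y
    by (rule bounded_functionsI[of _ _ C]) (use order_trans[OF abs_coef_le_norm \<beta>C[OF g]] in auto)
  define m where "m g y = \<mu> (\<lambda>h. coef (\<beta> g h) y)" for g y
  \<comment> \<open>the mean of the pairing of \<open>\<beta> g h\<close> with \<open>m g\<close> itself is the sum of the squares\<close>
  have m_bound: "(\<Sum>y\<in>X. (m g y)\<^sup>2) \<le> C\<^sup>2" if X: "finite X" and g: "g \<in> K" for X g
  proof -
    define s where "s = sqrt (\<Sum>y\<in>X. (m g y)\<^sup>2)"
    have s: "0 \<le> s" "s\<^sup>2 = (\<Sum>y\<in>X. (m g y)\<^sup>2)" by (simp_all add: s_def sum_nonneg)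
    have ms: "(\<lambda>h. \<Sum>y\<in>X. m g y * coef (\<beta> g h) y) \<in> bounded_functions ?G"
      "\<mu> (\<lambda>h. \<Sum>y\<in>X. m g y * coef (\<beta> g h) y) = (\<Sum>y\<in>X. m g y * m g y)"
      using KG.mean_sum[OF \<mu> X bdd[OF g], of "m g"] by (simp_all add: m_def)
    have "s\<^sup>2 = \<mu> (\<lambda>h. \<Sum>y\<in>X. m g y * coef (\<beta> g h) y)"
      using ms(2) s(2) by (simp add: power2_eq_square)
    also have "\<dots> \<le> s * C"
    proof (rule KG.mean_le[OF \<mu> ms(1)])
      fix h assume "h \<in> carrier ?G"
      then have h: "h \<in> K" by simp
      have "(\<Sum>y\<in>X. (coef (\<beta> g h) y)\<^sup>2) \<le> C\<^sup>2"
        by (rule order_trans[OF sum_sq_le_norm_l2[OF X] power_mono[OF \<beta>C[OF g h] norm_ge_zero]])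
      then have "sqrt (\<Sum>y\<in>X. (coef (\<beta> g h) y)\<^sup>2) \<le> C" using C0 by (rule real_le_lsqrt[rotated])
      then have "s * sqrt (\<Sum>y\<in>X. (coef (\<beta> g h) y)\<^sup>2) \<le> s * C" using s(1) by (rule mult_left_mono)
      moreover have "(\<Sum>y\<in>X. m g y * coef (\<beta> g h) y) \<le> (\<Sum>y\<in>X. \<bar>m g y\<bar> * \<bar>coef (\<beta> g h) y\<bar>)"
        by (rule sum_mono) (simp flip: abs_mult)
      moreover have "\<dots> \<le> s * sqrt (\<Sum>y\<in>X. (coef (\<beta> g h) y)\<^sup>2)"
        using L2_set_mult_ineq[of "m g" "coef (\<beta> g h)" X] by (simp add: L2_set_def s_def)
      ultimately show "(\<Sum>y\<in>X. m g y * coef (\<beta> g h) y) \<le> s * C" by linarith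
    qed
    finally have "s * s \<le> s * C" by (simp add: power2_eq_square)
    then have "s \<le> C" using s(1) C0 by (cases "s = 0") auto
    then show ?thesis unfolding s(2)[symmetric] using s(1) by (simp add: power_mono)
  qed
  define b where "b g = Abs_l2 (m g)" for g
  have b: "coef (b g) = m g" if "g \<in> K" for g
    unfolding b_def by (rule coef_Abs[OF square_summableI]) (rule m_bound[OF _ that])
  have bC: "norm (b g) \<le> C" if "g \<in> K" for g
    by (rule norm_l2_le) (use m_bound[OF _ that] C0 in \<open>auto simp: b[OF that]\<close>)
  have \<beta>supp: "coef (\<beta> g h) y = 0" if "g \<in> K" "h \<in> K" "y \<notin> carrier G \<times> A" for g h y
    using supp_inD[OF supp[OF that(1)] that(3)] supp_inD[OF supp[OF subgroup.m_closed[OF K that(1,2)]] that(3)]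
      supp_inD[OF translate_in[OF KG[OF that(1)] supp[OF that(2)]] that(3)] by (simp add: \<beta>_def)
  have \<mu>0: "\<mu> f = 0" if "\<And>h. h \<in> K \<Longrightarrow> f h = 0" for f
  proof -
    have f: "f \<in> bounded_functions ?G" "(\<lambda>x. -1 * f x) \<in> bounded_functions ?G"
      using that by (auto intro!: bounded_functionsI[of _ _ 0])
    have "\<mu> f \<le> 0" by (rule KG.mean_le[OF \<mu> f(1)]) (use that in simp)
    moreover have "\<mu> f \<ge> 0" by (rule mean_nonneg[OF \<mu> f(1)]) (use that in simp)
    ultimately show ?thesis by simp
  qed
  have bsupp: "b g \<in> supp_in (carrier G \<times> A)" if "g \<in> K" for g
    unfolding supp_in_def mem_Collect_eq b[OF that] m_def
    by (intro allI impI \<mu>0) (rule \<beta>supp[OF that])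
  define c' where "c' g = c g - b g" for g
  have coc: "translate G g (c' h) - c' (g \<otimes> h) + c' g = 0" if g: "g \<in> K" and h: "h \<in> K" for g h
  proof (rule l2_eqI)
    fix y :: "'a \<times> 'k"
    obtain x k where y: "y = (x, k)" by (cases y)
    have gh: "g \<otimes> h \<in> K" using subgroup.m_closed[OF K g h] .
    have lin: "translate G g (c' h) - c' (g \<otimes> h) + c' g = \<beta> g h - (translate G g (b h) - b (g \<otimes> h) + b g)"
      using KG[OF g] by (simp add: c'_def \<beta>_def linear_diff[OF translate_linear])
    show "coef (translate G g (c' h) - c' (g \<otimes> h) + c' g) y = coef 0 y"
    proof (cases "x \<in> carrier G")
      case True
      have id: "coef (\<beta> g (h \<otimes> n)) y = -1 * coef (\<beta> h n) (inv g \<otimes> x, k) + (coef (\<beta> (g \<otimes> h) n) y + coef (\<beta> g h) y * 1)"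
        if "n \<in> K" for n
        using KG[OF g] KG[OF h] KG[OF that] True
        by (simp add: \<beta>_def y coef_translate inv_mult_group m_assoc)
      have shift: "\<mu> (\<lambda>n. coef (\<beta> g (h \<otimes> n)) y) = m g y"
      proof -
        have ih: "inv h \<in> K" using subgroup.m_inv_closed[OF K h] .
        then have "inv\<^bsub>?G\<^esub> (inv h) = h" using m_inv_consistent[OF K ih] KG[OF h] by simp
        then show ?thesis
          using mean_invariant[OF \<mu>, of "inv h" "\<lambda>n. coef (\<beta> g n) y"] bdd[OF g] ih by (simp add: m_def)
      qed
      have one: "(\<lambda>_. 1) \<in> bounded_functions ?G" by (rule bounded_functionsI[of _ _ 1]) simp
      have B: "(\<lambda>n. -1 * coef (\<beta> h n) (inv g \<otimes> x, k)) \<in> bounded_functions ?G"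
        by (rule bounded_functionsI[of _ _ C]) (use order_trans[OF abs_coef_le_norm \<beta>C[OF h]] in auto)
      have B': "(\<lambda>n. coef (\<beta> g h) y * 1) \<in> bounded_functions ?G"
        by (rule bounded_functionsI[of _ _ "\<bar>coef (\<beta> g h) y\<bar>"]) simp
      note B = B B'
      let ?r = "\<lambda>n. -1 * coef (\<beta> h n) (inv g \<otimes> x, k) + (coef (\<beta> (g \<otimes> h) n) y + coef (\<beta> g h) y * 1)"
      let ?d = "\<lambda>n. -1 * coef (\<beta> g (h \<otimes> n)) y"
      have r: "?r \<in> bounded_functions ?G"
        by (intro bounded_functions_add B bdd gh)
      have d: "(\<lambda>n. coef (\<beta> g (h \<otimes> n)) y) \<in> bounded_functions ?G"
        by (rule bounded_functionsI[of _ _ C], rule order_trans[OF abs_coef_le_norm \<beta>C[OF g]])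
           (use subgroup.m_closed[OF K h] in simp)
      then have d': "?d \<in> bounded_functions ?G"
        using KG.mean_sum[OF \<mu>, of "{()}" "\<lambda>_ n. coef (\<beta> g (h \<otimes> n)) y" "\<lambda>_. -1"] by simp
      have "\<mu> (\<lambda>n. ?r n + ?d n) = 0"
        by (rule \<mu>0) (simp only: id, simp)
      moreover have "\<mu> (\<lambda>n. ?r n + ?d n) = \<mu> ?r + -1 * \<mu> (\<lambda>n. coef (\<beta> g (h \<otimes> n)) y)"
        by (subst mean_add[OF \<mu> r d'], subst mean_scale[OF \<mu> d]) simp
      moreover have "\<mu> ?r = -1 * m h (inv g \<otimes> x, k) + (m (g \<otimes> h) y + coef (\<beta> g h) y * 1)"
        by (subst mean_add[OF \<mu> B(1) bounded_functions_add[OF bdd[OF gh] B(2)]],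
            subst mean_add[OF \<mu> bdd[OF gh] B(2)], subst mean_scale[OF \<mu> bdd[OF h]], subst mean_scale[OF \<mu> one])
           (simp add: m_def mean_one[OF \<mu>])
      ultimately have "m g y = - m h (inv g \<otimes> x, k) + m (g \<otimes> h) y + coef (\<beta> g h) y"
        using shift by simp
      then show ?thesis
        unfolding lin using KG[OF g] True by (simp add: b[OF g] b[OF h] b[OF gh] y coef_translate)
    next
      case False
      then have "y \<notin> carrier G \<times> A" by (simp add: y)
      then show ?thesis
        unfolding lin using KG[OF g] False supp_inD[OF bsupp[OF g]] supp_inD[OF bsupp[OF gh]] \<beta>supp[OF g h]
        by (simp add: y coef_translate)
    qed
  qed
  have "c' g \<in> supp_in (carrier G \<times> A)" if "g \<in> K" for g
  proof -
    interpret S: closed_subspace "supp_in (carrier G \<times> A)" by (rule closed_subspace_supp_in)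
    show ?thesis unfolding c'_def by (rule subspace_diff[OF S.subspace supp[OF that] bsupp[OF that]])
  qed
  then have "quasi_cocycle_on K A 0 c'" unfolding quasi_cocycle_on_def by (simp add: coc)
  moreover have "\<forall>g\<in>K. norm (c g - c' g) \<le> C" by (simp add: c'_def bC)
  ultimately show ?thesis by blast
qed

lemma quasi_cocycle_on_subset:
  "quasi_cocycle_on K A C c \<Longrightarrow> K' \<subseteq> K \<Longrightarrow> quasi_cocycle_on K' A C c"
  unfolding quasi_cocycle_on_def by blast

lemma ex_finite_columns:
  assumes v: "v \<in> supp_in (carrier G \<times> A)" and e: "e > 0"
  shows "\<exists>I. finite I \<and> I \<subseteq> A \<and> norm (cut (carrier G \<times> I) v - v) < e"
proof -
  have pos: "0 < e\<^sup>2 / 2" using e by simp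
  obtain X where X: "finite X" "dist (\<Sum>x\<in>X. (coef v x)\<^sup>2) ((norm v)\<^sup>2) \<le> e\<^sup>2 / 2"
    using has_sum_finite_approximation[OF has_sum_norm_l2[of v] pos] by (elim exE conjE) auto
  define I where "I = snd ` X \<inter> A"
  let ?c = "cut (carrier G \<times> I) v"
  have "(norm (?c - v))\<^sup>2 = (norm v)\<^sup>2 - (norm ?c)\<^sup>2"
    unfolding norm_diff_sq using cut_sym[of "carrier G \<times> I" v ?c] by (simp add: power2_norm_eq_inner cut_sym)
  moreover have "(\<Sum>x\<in>X. (coef v x)\<^sup>2) \<le> (norm ?c)\<^sup>2"
  proof -
    have "coef v x = coef ?c x" if "x \<in> X" for x
      using that supp_inD[OF v, of x] by (cases x) (auto simp: I_def image_iff)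
    then have "(\<Sum>x\<in>X. (coef v x)\<^sup>2) = (\<Sum>x\<in>X. (coef ?c x)\<^sup>2)" by (intro sum.cong) auto
    then show ?thesis using sum_sq_le_norm_l2[OF X(1), of ?c] by simp
  qed
  moreover have "0 < e\<^sup>2" using e by simp
  ultimately have "(norm (?c - v))\<^sup>2 < e\<^sup>2" using X(2) unfolding dist_real_def by linarith
  then have "norm (?c - v) < e" by (rule power2_less_imp_less) (use e in simp)
  moreover have "finite I" "I \<subseteq> A" using X by (auto simp: I_def)
  ultimately show ?thesis by blast
qed

text \<open>Finitely many columns carry \<open>v\<close> up to \<open>e / 2\<close>; the part of the nearby cocycle in these columns is
treated by \<open>cocycle_bounded_multiplier\<close>. If \<open>K\<close> is finite, every function on it is bounded.\<close>

lemma quasi_cocycle_bounded_multiplier: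
  fixes c :: "'a \<Rightarrow> ('a \<times> 'k) l2" and col :: "'a \<Rightarrow> 'k"
  assumes K: "subgroup K G" and am: "amenable (G\<lparr>carrier := K\<rparr>)" and cK: "countable K"
    and col: "inj_on col K" and A: "A \<inter> col ` K = {}" and s: "s \<notin> A" "s \<notin> col ` K"
    and c: "quasi_cocycle_on K A C c"
    and v: "v \<in> supp_in (carrier G \<times> A)" and e: "e > 0"
  shows "\<exists>T. multiplier A T \<and> (\<exists>L. \<forall>b\<in>K. norm (T (c b)) \<le> L) \<and> norm (T v - v) < e"
proof (cases "finite K")
  case True
  let ?T = "cut (carrier G \<times> A)"
  have "norm (?T (c b)) \<le> (\<Sum>b\<in>K. norm (c b))" if "b \<in> K" for b
    using True that by (intro order_trans[OF cut_norm] member_le_sum) auto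
  then have "\<exists>L. \<forall>b\<in>K. norm (?T (c b)) \<le> L" by blast
  moreover have "norm (?T v - v) < e" using v e by (simp add: cut_id)
  ultimately show ?thesis using multiplier_cut by blast
next
  case False
  obtain c' where c': "quasi_cocycle_on K A 0 c'" "\<And>g. g \<in> K \<Longrightarrow> norm (c g - c' g) \<le> C"
    using quasi_cocycle_near_cocycle[OF K am c] by (elim exE conjE) auto
  obtain I where I: "finite I" "I \<subseteq> A" "norm (cut (carrier G \<times> I) v - v) < e / 2"
    using ex_finite_columns[OF v, of "e / 2"] e by auto
  let ?c = "cut (carrier G \<times> I)"
  have q: "quasi_cocycle_on K I 0 (\<lambda>g. ?c (c' g))"
    by (rule quasi_cocycle_on_multiplier[OF subgroup.subset[OF K] c'(1) multiplier_cut])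
  have "\<exists>T. multiplier I T \<and> (\<exists>L. \<forall>b\<in>K. norm (T (?c (c' b))) \<le> L) \<and> norm (T (?c v) - ?c v) < e / 2"
    by (rule cocycle_bounded_multiplier[OF K am cK False col I(1) _ _ s(2) q]) (use A s I e in auto)
  then obtain T L where T: "multiplier I T" "\<And>b. b \<in> K \<Longrightarrow> norm (T (?c (c' b))) \<le> L" "norm (T (?c v) - ?c v) < e / 2"
    by (elim exE conjE) auto
  define S where "S = (\<lambda>f. T (?c f))"
  have S: "multiplier I S" unfolding S_def by (rule multiplier_compose[OF T(1) multiplier_cut])
  have "norm (S (c b)) \<le> L + C" if b: "b \<in> K" for b
  proof -
    have "S (c b) = S (c' b) + S (c b - c' b)"
      using S by (simp add: multiplier_def linear_diff)
    then have "norm (S (c b)) \<le> norm (S (c' b)) + norm (S (c b - c' b))"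
      by (metis norm_triangle_ineq)
    also have "norm (S (c b - c' b)) \<le> C"
      using S c'(2)[OF b] order_trans unfolding multiplier_def by blast
    finally show ?thesis using T(2)[OF b] by (simp add: S_def)
  qed
  then have "\<exists>L. \<forall>b\<in>K. norm (S (c b)) \<le> L" by blast
  moreover have "norm (S v - v) < e"
    using norm_triangle_ineq[of "T (?c v) - ?c v" "?c v - v"] T(3) I(3) by (simp add: S_def)
  ultimately show ?thesis using multiplier_mono[OF S I(2)] by blast
qed

text \<open>A multiplier for a further subgroup is chosen for the quasi-cocycle \<open>T \<circ> c\<close> and composed with \<open>T\<close>;
boundedness on the earlier subgroups survives because multipliers are contractions.\<close>

lemma common_bounded_multiplier:
  fixes c :: "'a \<Rightarrow> ('a \<times> 'k) l2" and col :: "'a \<Rightarrow> 'k"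
  assumes cG: "countable (carrier G)"
    and col: "inj_on col (carrier G)" and A: "A \<inter> col ` carrier G = {}" and s: "s \<notin> A" "s \<notin> col ` carrier G"
    and c: "quasi_cocycle_on (carrier G) A C c"
    and v: "v \<in> supp_in (carrier G \<times> A)"
    and fin: "finite \<K>" and \<K>: "\<And>K. K \<in> \<K> \<Longrightarrow> subgroup K G \<and> amenable (G\<lparr>carrier := K\<rparr>)"
    and e: "e > 0"
  shows "\<exists>T. multiplier A T \<and> (\<forall>K\<in>\<K>. \<exists>L. \<forall>b\<in>K. norm (T (c b)) \<le> L) \<and> norm (T v - v) < e"
  using fin \<K> e
proof (induction \<K> arbitrary: e rule: finite_induct)
  case empty
  have "norm (cut (carrier G \<times> A) v - v) < e" using v empty by (simp add: cut_id)
  then show ?case using multiplier_cut by blast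
next
  case (insert K \<K>)
  have "\<exists>T. multiplier A T \<and> (\<forall>K\<in>\<K>. \<exists>L. \<forall>b\<in>K. norm (T (c b)) \<le> L) \<and> norm (T v - v) < e / 2"
    using insert.prems by (intro insert.IH) auto
  then obtain T where T: "multiplier A T" "\<forall>K\<in>\<K>. \<exists>L. \<forall>b\<in>K. norm (T (c b)) \<le> L" "norm (T v - v) < e / 2"
    by (elim exE conjE)
  have K: "subgroup K G" "amenable (G\<lparr>carrier := K\<rparr>)" using insert.prems by auto
  have KG: "K \<subseteq> carrier G" by (rule subgroup.subset[OF K(1)])
  have q: "quasi_cocycle_on K A C (\<lambda>g. T (c g))"
    by (rule quasi_cocycle_on_subset[OF quasi_cocycle_on_multiplier[OF order_refl c T(1)] KG])
  have "\<exists>S. multiplier A S \<and> (\<exists>L. \<forall>b\<in>K. norm (S (T (c b))) \<le> L) \<and> norm (S (T v) - T v) < e / 2"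
    by (rule quasi_cocycle_bounded_multiplier[OF K countable_subset[OF KG cG] inj_on_subset[OF col KG] _ s(1) _ q])
       (use A s KG T insert.prems in \<open>auto simp: multiplier_def\<close>)
  then obtain S where S: "multiplier A S" "\<exists>L. \<forall>b\<in>K. norm (S (T (c b))) \<le> L" "norm (S (T v) - T v) < e / 2"
    by blast
  have "\<exists>L. \<forall>b\<in>K'. norm (S (T (c b))) \<le> L" if "K' \<in> \<K>" for K'
  proof -
    obtain L where L: "\<And>b. b \<in> K' \<Longrightarrow> norm (T (c b)) \<le> L" using T(2) \<open>K' \<in> \<K>\<close> by blast
    have "norm (S f) \<le> norm f" for f using S(1) by (simp add: multiplier_def)
    from order_trans[OF this L] show ?thesis by blast
  qed
  moreover have "norm (S (T v) - v) < e"
    using norm_triangle_ineq[of "S (T v) - T v" "T v - v"] T(3) S(3) by simp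
  ultimately show ?case
    using multiplier_compose[OF S(1) T(1)] S(2) by (intro exI[of _ "\<lambda>f. S (T f)"]) auto
qed

lemma quasi_cocycle_bounded_products:
  fixes c :: "'a \<Rightarrow> ('a \<times> 'k) l2"
  assumes c: "quasi_cocycle_on (carrier G) A C c" and X: "X \<subseteq> carrier G" "\<And>x. x \<in> X \<Longrightarrow> norm (c x) \<le> L"
    and xs: "set xs \<subseteq> X"
  shows "norm (c (foldr (\<otimes>) xs \<one>)) \<le> norm (c \<one>) + real (length xs) * (L + C)"
  using xs
proof (induction xs)
  case (Cons x xs)
  let ?h = "foldr (\<otimes>) xs \<one>"
  have h: "?h \<in> carrier G" using Cons.prems X(1) by (induction xs) auto
  have x: "x \<in> X" "x \<in> carrier G" using Cons.prems X by auto
  have "norm (translate G x (c ?h) - c (x \<otimes> ?h) + c x) \<le> C"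
    using c x h by (simp add: quasi_cocycle_on_def)
  moreover have "norm (translate G x (c ?h)) = norm (c ?h)"
    using c x h by (intro translate_norm) (auto simp: quasi_cocycle_on_def intro: supp_in_mono)
  moreover have "norm (c (x \<otimes> ?h)) \<le> norm (translate G x (c ?h) - c (x \<otimes> ?h) + c x) + norm (translate G x (c ?h)) + norm (c x)"
    using norm_triangle_ineq4[of "translate G x (c ?h) + c x" "translate G x (c ?h) - c (x \<otimes> ?h) + c x"]
      norm_triangle_ineq[of "translate G x (c ?h)" "c x"] by simp
  ultimately show ?case using Cons X(2)[OF x(1)] by (simp add: algebra_simps)
qed simp

section \<open>Bounded quasi-cocycles\<close>

text \<open>Let \<open>R\<close> be the infimum of the bounds of all \<open>\<beta> \<xi> = b + (coboundary of \<xi>)\<close>, and let \<open>b0 = \<beta> \<xi>0\<close> have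
a bound within \<open>C\<close> of \<open>R\<close>. Let \<open>\<eta>\<close> be an approximate circumcentre of the values of \<open>b0\<close>. The
affine map \<open>v \<mapsto> b0 h + h v\<close> moves this set of values by at most \<open>C\<close>, so it maps \<open>\<eta>\<close> to another
approximate circumcentre. Two approximate circumcentres are close, because their midpoint does better
than both; their distance is at most of the order of the square root of \<open>C (R + C)\<close>. But this
distance is the norm of \<open>\<beta> (\<xi>0 + \<eta>) h\<close>, which gives an inequality for \<open>R\<close> that bounds it by a
multiple of \<open>C\<close>.\<close>

lemma bounded_quasi_cocycle_near_coboundary:
  fixes b :: "'a \<Rightarrow> ('a \<times> 'k) l2"
  assumes M: "subgroup M G" and b: "quasi_cocycle_on M A C b" and C: "C > 0"
    and bdd: "\<And>h. h \<in> M \<Longrightarrow> norm (b h) \<le> L"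
  shows "\<exists>\<xi>\<in>supp_in (carrier G \<times> A). \<forall>h\<in>M. norm (b h + translate G h \<xi> - \<xi>) \<le> 18 * C"
proof -
  let ?V = "supp_in (carrier G \<times> A)" and ?\<tau> = "translate G"
  interpret V: closed_subspace ?V by (rule closed_subspace_supp_in)
  have MG: "\<And>g. g \<in> M \<Longrightarrow> g \<in> carrier G" using subgroup.subset[OF M] by auto
  have \<tau>V: "?\<tau> h \<xi> \<in> ?V" if "h \<in> M" "\<xi> \<in> ?V" for h \<xi> using that MG by (intro translate_in)
  have \<tau>n: "norm (?\<tau> h \<xi>) = norm \<xi>" if "h \<in> M" "\<xi> \<in> ?V" for h \<xi>
    using that MG by (intro translate_norm) (auto intro: supp_in_mono)
  have bV: "b h \<in> ?V" if "h \<in> M" for h using b that by (simp add: quasi_cocycle_on_def)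
  define \<beta> where "\<beta> \<xi> h = b h + ?\<tau> h \<xi> - \<xi>" for \<xi> h
  have \<beta>V: "\<beta> \<xi> h \<in> ?V" if "\<xi> \<in> ?V" "h \<in> M" for \<xi> h
    unfolding \<beta>_def using that by (intro subspace_add[OF V.subspace] subspace_diff[OF V.subspace] bV \<tau>V)
  have \<beta>q: "norm (?\<tau> g (\<beta> \<xi> h) - \<beta> \<xi> (g \<otimes> h) + \<beta> \<xi> g) \<le> C" if "g \<in> M" "h \<in> M" for \<xi> g h
  proof -
    have "?\<tau> g (\<beta> \<xi> h) - \<beta> \<xi> (g \<otimes> h) + \<beta> \<xi> g = ?\<tau> g (b h) - b (g \<otimes> h) + b g"
      using MG[OF that(1)] MG[OF that(2)]
      by (simp add: \<beta>_def linear_add[OF translate_linear] linear_diff[OF translate_linear] translate_translate)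
    then show ?thesis using b that by (simp add: quasi_cocycle_on_def)
  qed
  define \<R> where "\<R> = {r. \<exists>\<xi>\<in>?V. \<forall>h\<in>M. norm (\<beta> \<xi> h) \<le> r}"
  have one: "\<one> \<in> M" by (rule subgroup.one_closed[OF M])
  have \<R>0: "bdd_below \<R>"
    by (rule bdd_belowI[of _ 0]) (use one norm_ge_zero order_trans in \<open>unfold \<R>_def, blast\<close>)
  have zeroV: "0 \<in> ?V" by (rule subspace_0[OF V.subspace])
  have "norm (\<beta> 0 h) \<le> L" if "h \<in> M" for h
    using bdd[OF that] MG[OF that] by (simp add: \<beta>_def linear_0[OF translate_linear])
  then have \<R>ne: "\<R> \<noteq> {}" using zeroV unfolding \<R>_def by blast
  define R where "R = Inf \<R>"
  have "Inf \<R> < R + C" using C by (simp add: R_def)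
  from cInf_lessD[OF \<R>ne this] obtain R0 \<xi>0 where R0: "R0 < R + C" "\<xi>0 \<in> ?V" "\<And>h. h \<in> M \<Longrightarrow> norm (\<beta> \<xi>0 h) \<le> R0"
    unfolding \<R>_def by auto
  define b0 where "b0 = \<beta> \<xi>0"
  define \<C> where "\<C> = {r. \<exists>\<eta>\<in>?V. \<forall>g\<in>M. norm (b0 g - \<eta>) \<le> r}"
  have \<C>0: "\<And>r. r \<in> \<C> \<Longrightarrow> 0 \<le> r" using one norm_ge_zero order_trans unfolding \<C>_def by blast
  then have \<C>bdd: "bdd_below \<C>" by (rule bdd_belowI)
  have R0C: "R0 \<in> \<C>" unfolding \<C>_def using R0(3) zeroV by (auto simp: b0_def intro!: bexI[of _ 0])
  define r where "r = Inf \<C>"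
  have r0: "0 \<le> r" unfolding r_def by (rule cInf_greatest) (use R0C \<C>0 in auto)
  have rR0: "r \<le> R0" unfolding r_def by (rule cInf_lower[OF R0C \<C>bdd])
  have "Inf \<C> < r + C" using C by (simp add: r_def)
  moreover have "\<C> \<noteq> {}" using R0C by blast
  ultimately obtain r1 where "r1 \<in> \<C>" "r1 < r + C" using cInf_lessD by blast
  then obtain \<eta> where r1: "r1 < r + C" "\<eta> \<in> ?V" "\<And>g. g \<in> M \<Longrightarrow> norm (b0 g - \<eta>) \<le> r1"
    unfolding \<C>_def by blast
  have r10: "0 \<le> r1" using r1(3)[OF one] norm_ge_zero order_trans by blast
  have move: "(norm (b0 h + ?\<tau> h \<eta> - \<eta>))\<^sup>2 \<le> 16 * C * (R + 2 * C)" if h: "h \<in> M" for h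
  proof -
    define \<rho> where "\<rho> = b0 h + ?\<tau> h \<eta>"
    have \<rho>V: "\<rho> \<in> ?V" unfolding \<rho>_def b0_def by (intro subspace_add[OF V.subspace] \<beta>V R0 h \<tau>V r1)
    have far: "norm (b0 g - \<rho>) \<le> r1 + C" if g: "g \<in> M" for g
    proof -
      define k where "k = inv h \<otimes> g"
      have k: "k \<in> M" "h \<otimes> k = g"
        using subgroup.m_closed[OF M subgroup.m_inv_closed[OF M h] g] MG[OF g] MG[OF h]
        by (auto simp: k_def m_assoc[symmetric])
      have n1: "norm (?\<tau> h (b0 k) - b0 g + b0 h) \<le> C" using \<beta>q[OF h k(1), of \<xi>0] k(2) by (simp add: b0_def)
      have n2: "norm (?\<tau> h (b0 k - \<eta>)) \<le> r1"
        using \<tau>n[OF h subspace_diff[OF V.subspace \<beta>V[OF R0(2) k(1)] r1(2)]] r1(3)[OF k(1)] by (simp add: b0_def)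
      have eq: "b0 g - \<rho> = ?\<tau> h (b0 k - \<eta>) - (?\<tau> h (b0 k) - b0 g + b0 h)"
        using MG[OF h] by (simp add: \<rho>_def linear_diff[OF translate_linear])
      show ?thesis unfolding eq
        using n1 n2 norm_triangle_ineq4[of "?\<tau> h (b0 k - \<eta>)" "?\<tau> h (b0 k) - b0 g + b0 h"] by linarith
    qed
    define m where "m = (1/2) *\<^sub>R (\<eta> + \<rho>)"
    have mV: "m \<in> ?V" unfolding m_def by (intro subspace_scale[OF V.subspace] subspace_add[OF V.subspace] r1 \<rho>V)
    define q where "q = (r1 + C)\<^sup>2 - (norm (\<eta> - \<rho>))\<^sup>2 / 4"
    have near: "(norm (b0 g - m))\<^sup>2 \<le> q" if g: "g \<in> M" for g
    proof -
      have "(norm (b0 g - \<eta>))\<^sup>2 \<le> (r1 + C)\<^sup>2" using r1(3)[OF g] C by (intro power_mono) auto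
      moreover have "(norm (b0 g - \<rho>))\<^sup>2 \<le> (r1 + C)\<^sup>2" using far[OF g] by (intro power_mono) auto
      ultimately show ?thesis using parallelogram_midpoint[of \<eta> \<rho> "b0 g"]
        unfolding q_def m_def by argo
    qed
    have q0: "0 \<le> q" using near[OF one] zero_le_power2 order_trans by blast
    have "norm (b0 g - m) \<le> sqrt q" if "g \<in> M" for g using near[OF that] by (rule real_le_rsqrt)
    then have "sqrt q \<in> \<C>" using mV unfolding \<C>_def by blast
    then have "r \<le> sqrt q" unfolding r_def by (rule cInf_lower[OF _ \<C>bdd])
    then have "r\<^sup>2 \<le> q" using power_mono[of r "sqrt q" 2] r0 q0 by simp
    then have "(norm (\<eta> - \<rho>))\<^sup>2 \<le> 4 * ((r1 + C)\<^sup>2 - r\<^sup>2)" by (simp add: q_def)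
    also have "(r1 + C)\<^sup>2 \<le> (r + 2 * C)\<^sup>2" using r1(1) r10 C by (intro power_mono) auto
    then have "4 * ((r1 + C)\<^sup>2 - r\<^sup>2) \<le> 16 * C * (r + C)" by (simp add: power2_eq_square algebra_simps)
    also have "\<dots> \<le> 16 * C * (R + 2 * C)" using C rR0 R0(1) by (intro mult_left_mono) auto
    finally show ?thesis by (simp add: \<rho>_def norm_minus_commute)
  qed
  define \<xi> where "\<xi> = \<xi>0 + \<eta>"
  have \<xi>V: "\<xi> \<in> ?V" unfolding \<xi>_def by (intro subspace_add[OF V.subspace] R0 r1)
  have \<beta>\<xi>: "\<beta> \<xi> h = b0 h + ?\<tau> h \<eta> - \<eta>" if "h \<in> M" for h
    using MG[OF that] by (simp add: \<beta>_def b0_def \<xi>_def linear_add[OF translate_linear])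
  define t where "t = 16 * C * (R + 2 * C)"
  have R_nonneg: "0 \<le> R" unfolding R_def
    by (rule cInf_greatest[OF \<R>ne]) (use one norm_ge_zero order_trans in \<open>unfold \<R>_def, blast\<close>)
  have t0: "0 \<le> t" using C R_nonneg by (simp add: t_def)
  have bnd: "norm (\<beta> \<xi> h) \<le> sqrt t" if "h \<in> M" for h
    using move[OF that] unfolding \<beta>\<xi>[OF that] t_def by (rule real_le_rsqrt)
  then have "sqrt t \<in> \<R>" using \<xi>V unfolding \<R>_def by blast
  then have "R \<le> sqrt t" unfolding R_def by (rule cInf_lower[OF _ \<R>0])
  then have RR: "R * R \<le> 16 * C * R + 32 * (C * C)"
    using power_mono[of R "sqrt t" 2] R_nonneg t0 by (simp add: t_def power2_eq_square algebra_simps)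
  \<comment> \<open>the number \<open>18\<close> satisfies \<open>18 * 18 > 16 * 18 + 32\<close>\<close>
  have R18: "R \<le> 18 * C"
  proof (rule ccontr)
    assume "\<not> R \<le> 18 * C"
    then have "18 * C * R < R * R" "C * (18 * C) < C * R"
      using C by (auto intro!: mult_strict_right_mono mult_strict_left_mono)
    moreover have "0 < C * C" using C by simp
    ultimately show False using RR by (simp add: algebra_simps)
  qed
  have "0 \<le> C * C" by simp
  then have "t \<le> (18 * C)\<^sup>2"
    using mult_left_mono[OF R18, of "16 * C"] C by (simp add: t_def power2_eq_square algebra_simps) 
  then have "sqrt t \<le> 18 * C" using C by (intro real_le_lsqrt) auto
  then have "\<forall>h\<in>M. norm (b h + ?\<tau> h \<xi> - \<xi>) \<le> 18 * C" using bnd unfolding \<beta>_def by force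
  then show ?thesis using \<xi>V by blast
qed

end

section \<open>Transport of a Hilbert space along an injection\<close>

text \<open>Property (T) is stated for spaces of functions on \<open>'b \<times> nat\<close>, where \<open>'b\<close> is the type of the elements of
\<open>H\<close>. A Hilbert space of another type is moved there along any injection of its carrier.\<close>

definition transport :: "('v \<Rightarrow> 'w) \<Rightarrow> 'v hilbert \<Rightarrow> 'w hilbert"
  where "transport \<iota> V = (let \<kappa> = inv_into (carrier V) \<iota> in
    \<lparr>carrier = \<iota> ` carrier V, mult = undefined, one = undefined,
     zero = \<iota> \<zero>\<^bsub>V\<^esub>,
     add = (\<lambda>x y. \<iota> (\<kappa> x \<oplus>\<^bsub>V\<^esub> \<kappa> y)),
     smult = (\<lambda>a x. \<iota> (a \<odot>\<^bsub>V\<^esub> \<kappa> x)),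
     ip = (\<lambda>x y. ip V (\<kappa> x) (\<kappa> y))\<rparr>)"

context hilbert_space
begin

context
  fixes \<iota> :: "'v \<Rightarrow> 'w"
  assumes inj: "inj_on \<iota> (carrier V)"
begin

lemma transport_simps:
  "carrier (transport \<iota> V) = \<iota> ` carrier V"
  "\<zero>\<^bsub>transport \<iota> V\<^esub> = \<iota> \<zero>\<^bsub>V\<^esub>"
  "x \<in> carrier V \<Longrightarrow> y \<in> carrier V \<Longrightarrow> \<iota> x \<oplus>\<^bsub>transport \<iota> V\<^esub> \<iota> y = \<iota> (x \<oplus>\<^bsub>V\<^esub> y)"
  "x \<in> carrier V \<Longrightarrow> r \<odot>\<^bsub>transport \<iota> V\<^esub> \<iota> x = \<iota> (r \<odot>\<^bsub>V\<^esub> x)"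
  "x \<in> carrier V \<Longrightarrow> y \<in> carrier V \<Longrightarrow> ip (transport \<iota> V) (\<iota> x) (\<iota> y) = ip V x y"
  "x \<in> carrier V \<Longrightarrow> hnorm (transport \<iota> V) (\<iota> x) = hnorm V x"
  using inj by (auto simp: transport_def Let_def hnorm_def)

lemma transport_abelian_group: "abelian_group (transport \<iota> V)"
proof (rule abelian_groupI)
  fix x assume "x \<in> carrier (transport \<iota> V)"
  then obtain x' where "x = \<iota> x'" "x' \<in> carrier V" by (auto simp: transport_simps)
  then show "\<exists>y\<in>carrier (transport \<iota> V). y \<oplus>\<^bsub>transport \<iota> V\<^esub> x = \<zero>\<^bsub>transport \<iota> V\<^esub>"
    by (intro bexI[of _ "\<iota> (\<ominus>\<^bsub>V\<^esub> x')"]) (auto simp: transport_simps M.l_neg)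
qed (auto simp: transport_simps M.a_ac)

lemma transport_module: "module complex_ring (transport \<iota> V)"
proof (rule moduleI[OF cring_complex_ring transport_abelian_group])
  show "(a \<oplus>\<^bsub>complex_ring\<^esub> b) \<odot>\<^bsub>transport \<iota> V\<^esub> x = a \<odot>\<^bsub>transport \<iota> V\<^esub> x \<oplus>\<^bsub>transport \<iota> V\<^esub> b \<odot>\<^bsub>transport \<iota> V\<^esub> x"
    if "x \<in> carrier (transport \<iota> V)" for a b x
    using that smult_l_distr[of a b] by (auto simp: transport_simps)
  show "a \<odot>\<^bsub>transport \<iota> V\<^esub> (x \<oplus>\<^bsub>transport \<iota> V\<^esub> y) = a \<odot>\<^bsub>transport \<iota> V\<^esub> x \<oplus>\<^bsub>transport \<iota> V\<^esub> a \<odot>\<^bsub>transport \<iota> V\<^esub> y"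
    if "x \<in> carrier (transport \<iota> V)" "y \<in> carrier (transport \<iota> V)" for a x y
    using that smult_r_distr[of a] by (auto simp: transport_simps)
  show "(a \<otimes>\<^bsub>complex_ring\<^esub> b) \<odot>\<^bsub>transport \<iota> V\<^esub> x = a \<odot>\<^bsub>transport \<iota> V\<^esub> (b \<odot>\<^bsub>transport \<iota> V\<^esub> x)"
    if "x \<in> carrier (transport \<iota> V)" for a b x
    using that smult_assoc1[of a b] by (auto simp: transport_simps)
  show "\<one>\<^bsub>complex_ring\<^esub> \<odot>\<^bsub>transport \<iota> V\<^esub> x = x" if "x \<in> carrier (transport \<iota> V)" for x
    using that smult_one by (auto simp: transport_simps)
qed (auto simp: transport_simps)

lemma transport_minus:
  assumes "x \<in> carrier V" "y \<in> carrier V"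
  shows "\<iota> x \<ominus>\<^bsub>transport \<iota> V\<^esub> \<iota> y = \<iota> (x \<ominus>\<^bsub>V\<^esub> y)"
proof -
  interpret W: abelian_group "transport \<iota> V" by (rule transport_abelian_group)
  have "\<ominus>\<^bsub>transport \<iota> V\<^esub> \<iota> y = \<iota> (\<ominus>\<^bsub>V\<^esub> y)"
    using assms by (intro W.minus_equality) (auto simp: transport_simps M.l_neg)
  then show ?thesis using assms by (simp add: a_minus_def transport_simps)
qed

lemma hilbert_space_transport: "hilbert_space (transport \<iota> V)"
proof (intro hilbert_space.intro hilbert_space_axioms.intro transport_module)
  fix s :: "nat \<Rightarrow> 'w"
  assume s: "\<And>n. s n \<in> carrier (transport \<iota> V)"
    and C: "\<And>e. 0 < e \<Longrightarrow> \<exists>N. \<forall>m\<ge>N. \<forall>n\<ge>N. hnorm (transport \<iota> V) (s m \<ominus>\<^bsub>transport \<iota> V\<^esub> s n) < e"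
  have "\<exists>t. \<forall>n. s n = \<iota> (t n) \<and> t n \<in> carrier V"
    using s by (intro choice) (auto simp: transport_simps)
  then obtain t where t: "\<And>n. s n = \<iota> (t n)" "\<And>n. t n \<in> carrier V" by blast
  have "\<exists>l\<in>carrier V. (\<lambda>n. hnorm V (t n \<ominus>\<^bsub>V\<^esub> l)) \<longlonglongrightarrow> 0"
    using C by (intro complete) (auto simp: t transport_minus transport_simps)
  then obtain l where "l \<in> carrier V" "(\<lambda>n. hnorm V (t n \<ominus>\<^bsub>V\<^esub> l)) \<longlonglongrightarrow> 0" by blast
  then show "\<exists>l\<in>carrier (transport \<iota> V). (\<lambda>n. hnorm (transport \<iota> V) (s n \<ominus>\<^bsub>transport \<iota> V\<^esub> l)) \<longlonglongrightarrow> 0"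
    by (intro bexI[of _ "\<iota> l"]) (auto simp: t transport_minus transport_simps)
next
  fix x y assume xy: "x \<in> carrier (transport \<iota> V)" "y \<in> carrier (transport \<iota> V)"
  then show "ip (transport \<iota> V) x y = cnj (ip (transport \<iota> V) y x)"
    by (auto simp: transport_simps intro: ip_commute)
qed (auto simp: transport_simps ip_add_right ip_smult_right intro!: ip_pos)

end

end

section \<open>Real coordinates for the sum of copies of the regular representation\<close>

lemma (in hilbert_space) hnorm_copies_sq:
  assumes "f \<in> carrier (hilbert_copies I V)"
  shows "(hnorm (hilbert_copies I V) f)\<^sup>2 = (\<Sum>\<^sub>\<infinity>i\<in>I. (hnorm V (f i))\<^sup>2)"
proof -
  interpret K: hilbert_space "hilbert_copies I V" by (rule hilbert_space_copies)
  have "ip (hilbert_copies I V) f f = (\<Sum>\<^sub>\<infinity>i\<in>I. complex_of_real ((hnorm V (f i))\<^sup>2))"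
    unfolding copies_simps by (intro infsum_cong ip_self) (use assms in \<open>auto simp: copies_simps\<close>)
  also have "\<dots> = of_real (\<Sum>\<^sub>\<infinity>i\<in>I. (hnorm V (f i))\<^sup>2)"
    using assms by (intro infsumI has_sum_of_real has_sum_infsum) (simp add: copies_simps)
  finally show ?thesis using K.hnorm_sq[OF assms] by simp
qed

text \<open>The columns \<open>Inl (n, True)\<close> and \<open>Inl (n, False)\<close> hold the real and the imaginary part of the \<open>n\<close>-th
copy of the regular representation. The column \<open>Inr None\<close> serves the cocycle \<open>b \<mapsto> \<delta>\<^sub>b - \<delta>\<^sub>1\<close>, and
the columns \<open>Inr (Some b)\<close> serve the cocycle space.\<close>

type_synonym 'a column = "(nat \<times> bool) + 'a option"

definition to_complex :: "('a \<times> 'a column) l2 \<Rightarrow> nat \<Rightarrow> 'a \<Rightarrow> complex"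
  where "to_complex f n x = Complex (coef f (x, Inl (n, True))) (coef f (x, Inl (n, False)))"

abbreviation real_vectors :: "('a, 'm) monoid_scheme \<Rightarrow> ('a \<times> 'a column) l2 set"
  where "real_vectors G \<equiv> supp_in (carrier G \<times> range Inl)"

lemma ell2_infinite_sum_iff:
  "F \<in> carrier (ell2_infinite_sum G) \<longleftrightarrow> (\<forall>n x. x \<notin> carrier G \<longrightarrow> F n x = 0) \<and>
     (\<lambda>(n, x). (cmod (F n x))\<^sup>2) summable_on (UNIV \<times> carrier G)"
  and hnorm_ell2_infinite_sum:
  "F \<in> carrier (ell2_infinite_sum G) \<Longrightarrow>
     (hnorm (ell2_infinite_sum G) F)\<^sup>2 = (\<Sum>\<^sub>\<infinity>(n, x)\<in>UNIV \<times> carrier G. (cmod (F n x))\<^sup>2)"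
proof -
  interpret C: hilbert_space complex_line by (rule hilbert_space_complex_line)
  interpret L: hilbert_space "ell2 (carrier G)" by (rule hilbert_space_ell2)
  have in_L: "f \<in> carrier (ell2 (carrier G)) \<longleftrightarrow>
      (\<forall>x. x \<notin> carrier G \<longrightarrow> f x = 0) \<and> (\<lambda>x. (cmod (f x))\<^sup>2) summable_on carrier G" for f
    by (auto simp: ell2_def copies_simps hnorm_complex_line) (auto simp: complex_line_def)
  have nL: "(hnorm (ell2 (carrier G)) f)\<^sup>2 = (\<Sum>\<^sub>\<infinity>x\<in>carrier G. (cmod (f x))\<^sup>2)"
    if "f \<in> carrier (ell2 (carrier G))" for f
    using C.hnorm_copies_sq[of f "carrier G"] that by (simp add: ell2_def hnorm_complex_line)
  have sig: "(\<lambda>(n, x). (cmod (F n x))\<^sup>2) summable_on (UNIV \<times> carrier G) \<longleftrightarrow>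
      (\<forall>n. (\<lambda>x. (cmod (F n x))\<^sup>2) summable_on carrier G) \<and> (\<lambda>n. \<Sum>\<^sub>\<infinity>x\<in>carrier G. (cmod (F n x))\<^sup>2) summable_on UNIV"
    using Infinite_Sum.abs_summable_on_Sigma_iff[where f = "\<lambda>(n, x). (cmod (F n x))\<^sup>2" and A = UNIV and B = "\<lambda>_. carrier G"]
    by (simp add: case_prod_unfold infsum_nonneg)
  have "F \<in> carrier (ell2_infinite_sum G) \<longleftrightarrow>
      (\<forall>n. F n \<in> carrier (ell2 (carrier G))) \<and> (\<lambda>n. (hnorm (ell2 (carrier G)) (F n))\<^sup>2) summable_on UNIV"
    by (simp add: ell2_infinite_sum_def copies_simps(1))
  also have "\<dots> \<longleftrightarrow> (\<forall>n. F n \<in> carrier (ell2 (carrier G))) \<and> (\<lambda>n. \<Sum>\<^sub>\<infinity>x\<in>carrier G. (cmod (F n x))\<^sup>2) summable_on UNIV"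
    using nL by (intro conj_cong refl summable_on_cong) auto
  also have "\<dots> \<longleftrightarrow> (\<forall>n x. x \<notin> carrier G \<longrightarrow> F n x = 0) \<and>
     (\<lambda>(n, x). (cmod (F n x))\<^sup>2) summable_on (UNIV \<times> carrier G)"
    unfolding in_L sig by blast
  finally show iff: "F \<in> carrier (ell2_infinite_sum G) \<longleftrightarrow> (\<forall>n x. x \<notin> carrier G \<longrightarrow> F n x = 0) \<and>
     (\<lambda>(n, x). (cmod (F n x))\<^sup>2) summable_on (UNIV \<times> carrier G)" .
  assume F: "F \<in> carrier (ell2_infinite_sum G)"
  then have Fn: "F n \<in> carrier (ell2 (carrier G))" for n
    by (auto simp: ell2_infinite_sum_def copies_simps)
  have "(hnorm (ell2_infinite_sum G) F)\<^sup>2 = (\<Sum>\<^sub>\<infinity>n. \<Sum>\<^sub>\<infinity>x\<in>carrier G. (cmod (F n x))\<^sup>2)"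
    using L.hnorm_copies_sq[of F UNIV] F nL[OF Fn] by (simp add: ell2_infinite_sum_def)
  also have "\<dots> = (\<Sum>\<^sub>\<infinity>(n, x)\<in>UNIV \<times> carrier G. (cmod (F n x))\<^sup>2)"
    using F by (intro infsum_Sigma'_banach) (simp add: iff)
  finally show "(hnorm (ell2_infinite_sum G) F)\<^sup>2 = (\<Sum>\<^sub>\<infinity>(n, x)\<in>UNIV \<times> carrier G. (cmod (F n x))\<^sup>2)" .
qed

lemma has_sum_to_complex:
  assumes f: "f \<in> real_vectors G"
  shows "((\<lambda>(n, x). (cmod (to_complex f n x))\<^sup>2) has_sum (norm f)\<^sup>2) (UNIV \<times> carrier G)"
proof -
  let ?g = "\<lambda>((n, x), \<beta>). (coef f (x, Inl (n, \<beta>)))\<^sup>2"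
  have "((\<lambda>y. (coef f y)\<^sup>2) has_sum (norm f)\<^sup>2) (carrier G \<times> range Inl)"
    by (rule has_sum_cong_neutral[where S = UNIV, THEN iffD1, OF _ _ _ has_sum_norm_l2])
       (use supp_inD[OF f] in auto)
  then have "(?g has_sum (norm f)\<^sup>2) ((UNIV \<times> carrier G) \<times> UNIV)"
    by (subst has_sum_reindex_bij_witness[where i = "\<lambda>(x, k). ((fst (projl k), x), snd (projl k))"
          and j = "\<lambda>((n, x), \<beta>). (x, Inl (n, \<beta>))" and T = "carrier G \<times> range Inl" and h = "\<lambda>y. (coef f y)\<^sup>2"]) auto
  then show ?thesis
  proof (rule has_sum_SigmaD)
    fix p :: "nat \<times> 'a"
    obtain n x where p: "p = (n, x)" by (cases p)
    show "((\<lambda>\<beta>. ?g (p, \<beta>)) has_sum (case p of (n, x) \<Rightarrow> (cmod (to_complex f n x))\<^sup>2)) UNIV"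
      by (rule has_sum_finiteI) (auto simp: p to_complex_def cmod_power2 UNIV_bool)
  qed
qed

lemma to_complex_in: "f \<in> real_vectors G \<Longrightarrow> to_complex f \<in> carrier (ell2_infinite_sum G)"
  using has_sum_to_complex[of f G] supp_inD[of f "carrier G \<times> range Inl"]
  by (auto simp: ell2_infinite_sum_iff to_complex_def has_sum_iff complex_eq_iff)

lemma hnorm_to_complex:
  assumes "f \<in> real_vectors G"
  shows "hnorm (ell2_infinite_sum G) (to_complex f) = norm f"
proof -
  interpret hilbert_space "ell2_infinite_sum G" by (rule hilbert_space_ell2_infinite_sum)
  have "(hnorm (ell2_infinite_sum G) (to_complex f))\<^sup>2 = (norm f)\<^sup>2"
    using has_sum_to_complex[OF assms] by (simp add: hnorm_ell2_infinite_sum to_complex_in assms has_sum_iff)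
  then show ?thesis using to_complex_in[OF assms] by simp
qed

lemma ex_real_vector:
  assumes F: "F \<in> carrier (ell2_infinite_sum G)"
  shows "\<exists>f\<in>real_vectors G. to_complex f = F"
proof -
  define u where "u = (\<lambda>((n, x), \<beta>). if \<beta> then Re (F n x) else Im (F n x))"
  define f where "f = (\<lambda>(x, k :: 'a column). if x \<in> carrier G \<and> k \<in> range Inl
      then u ((fst (projl k), x), snd (projl k)) else 0)"
  have F0: "\<And>n x. x \<notin> carrier G \<Longrightarrow> F n x = 0"
    and Fs: "(\<lambda>(n, x). (cmod (F n x))\<^sup>2) summable_on (UNIV \<times> carrier G)"
    using F by (auto simp: ell2_infinite_sum_iff)
  have "(\<lambda>p. norm ((u p)\<^sup>2)) summable_on (UNIV \<times> carrier G) \<times> UNIV"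
  proof (rule Infinite_Sum.abs_summable_on_Sigma_iff[THEN iffD2], intro conjI ballI)
    have "(\<Sum>\<^sub>\<infinity>\<beta>. norm ((u (p, \<beta>))\<^sup>2)) = (case p of (n, x) \<Rightarrow> (cmod (F n x))\<^sup>2)" for p
      by (cases p) (auto simp: u_def cmod_power2 UNIV_bool)
    then show "(\<lambda>p. norm (\<Sum>\<^sub>\<infinity>\<beta>. norm ((u (p, \<beta>))\<^sup>2))) summable_on UNIV \<times> carrier G"
      using Fs by (simp add: case_prod_unfold)
  qed simp
  then have "(\<lambda>p. (u p)\<^sup>2) summable_on (UNIV \<times> carrier G) \<times> UNIV" by (rule abs_summable_summable)
  then have "(\<lambda>y. (f y)\<^sup>2) summable_on (carrier G \<times> range Inl)"
    by (subst summable_on_reindex_bij_witness[where j = "\<lambda>(x, k). ((fst (projl k), x), snd (projl k))"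
          and i = "\<lambda>((n, x), \<beta>). (x, Inl (n, \<beta>))" and T = "(UNIV \<times> carrier G) \<times> UNIV" and h = "\<lambda>p. (u p)\<^sup>2"])
       (auto simp: f_def)
  then have "(\<lambda>y. (f y)\<^sup>2) summable_on UNIV"
    by (rule summable_on_cong_neutral[THEN iffD1, rotated 3]) (auto simp: f_def split: if_splits)
  from coef_Abs[OF this] have cf: "coef (Abs_l2 f) (x, k) = (if x \<in> carrier G \<and> k \<in> range Inl
      then u ((fst (projl k), x), snd (projl k)) else 0)" for x k
    by (simp add: f_def)
  have "Abs_l2 f \<in> real_vectors G" by (auto simp: supp_in_def cf split: if_splits)
  moreover have "to_complex (Abs_l2 f) = F"
    using F0 by (intro ext) (auto simp: to_complex_def cf u_def complex_eq_iff)
  ultimately show ?thesis by blast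
qed

lemma ell2_infinite_sum_minus:
  assumes "F \<in> carrier (ell2_infinite_sum G)" "F' \<in> carrier (ell2_infinite_sum G)"
  shows "F \<ominus>\<^bsub>ell2_infinite_sum G\<^esub> F' = (\<lambda>n x. F n x - F' n x)"
proof -
  interpret hilbert_space "ell2_infinite_sum G" by (rule hilbert_space_ell2_infinite_sum)
  show ?thesis unfolding minus_eq'[OF assms]
    by (simp add: ell2_infinite_sum_def ell2_def copies_simps complex_line_def)
qed

lemma to_complex_diff: "to_complex (f - f') n x = to_complex f n x - to_complex f' n x"
  by (simp add: to_complex_def complex_eq_iff)

lemma to_complex_add: "to_complex (f + f') n x = to_complex f n x + to_complex f' n x"
  by (simp add: to_complex_def complex_eq_iff)

lemma (in group) to_complex_translate:
  "g \<in> carrier G \<Longrightarrow> to_complex (translate G g f) = left_regular_infinite_sum G g (to_complex f)"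
  by (intro ext) (simp add: to_complex_def left_regular_infinite_sum_def left_regular_def coef_translate complex_eq_iff)

lemma (in group) quasi_cocycle_real:
  assumes c: "quasi_cocycle G (ell2_infinite_sum G) (left_regular_infinite_sum G) c"
  shows "\<exists>c' C. (\<forall>g\<in>carrier G. c' g \<in> real_vectors G \<and> to_complex (c' g) = c g) \<and> quasi_cocycle_on (carrier G) (range Inl) C c'"
proof -
  let ?V = "ell2_infinite_sum G" and ?R = "real_vectors G"
  interpret S: closed_subspace ?R by (rule closed_subspace_supp_in)
  have "\<forall>g\<in>carrier G. \<exists>f. f \<in> ?R \<and> to_complex f = c g"
  proof
    fix g assume "g \<in> carrier G"
    then have "c g \<in> carrier ?V" using c by (auto simp: quasi_cocycle_def)
    from ex_real_vector[OF this] show "\<exists>f. f \<in> ?R \<and> to_complex f = c g" by blast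
  qed
  then obtain c' where c': "\<And>g. g \<in> carrier G \<Longrightarrow> c' g \<in> ?R \<and> to_complex (c' g) = c g"
    by (rule bchoice[THEN exE]) auto
  obtain C where C: "\<And>g h. g \<in> carrier G \<Longrightarrow> h \<in> carrier G \<Longrightarrow>
      hnorm ?V (left_regular_infinite_sum G g (c h) \<ominus>\<^bsub>?V\<^esub> c (g \<otimes> h) \<oplus>\<^bsub>?V\<^esub> c g) \<le> C"
    using c unfolding quasi_cocycle_def by blast
  have "norm (translate G g (c' h) - c' (g \<otimes> h) + c' g) \<le> C" if g: "g \<in> carrier G" and h: "h \<in> carrier G" for g h
  proof -
    have R: "translate G g (c' h) \<in> ?R" "c' (g \<otimes> h) \<in> ?R" "c' g \<in> ?R"
      using c' g h by (auto intro: translate_in)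
    then have "translate G g (c' h) - c' (g \<otimes> h) + c' g \<in> ?R"
      by (intro subspace_add[OF S.subspace] subspace_diff[OF S.subspace])
    then have "norm (translate G g (c' h) - c' (g \<otimes> h) + c' g) = hnorm ?V (to_complex (translate G g (c' h) - c' (g \<otimes> h) + c' g))"
      by (simp add: hnorm_to_complex)
    also have "to_complex (translate G g (c' h) - c' (g \<otimes> h) + c' g)
        = left_regular_infinite_sum G g (c h) \<ominus>\<^bsub>?V\<^esub> c (g \<otimes> h) \<oplus>\<^bsub>?V\<^esub> c g"
    proof -
      have "to_complex (translate G g (c' h)) \<ominus>\<^bsub>?V\<^esub> to_complex (c' (g \<otimes> h)) =
          (\<lambda>n x. to_complex (translate G g (c' h)) n x - to_complex (c' (g \<otimes> h)) n x)"
        using R by (intro ell2_infinite_sum_minus to_complex_in)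
      then have "to_complex (translate G g (c' h) - c' (g \<otimes> h) + c' g)
          = (to_complex (translate G g (c' h)) \<ominus>\<^bsub>?V\<^esub> to_complex (c' (g \<otimes> h))) \<oplus>\<^bsub>?V\<^esub> to_complex (c' g)"
        by (simp add: fun_eq_iff to_complex_add to_complex_diff ell2_infinite_sum_def ell2_def copies_simps(2-) complex_line_def)
      then show ?thesis using c' g h by (simp add: to_complex_translate)
    qed
    finally show ?thesis using C[OF g h] by simp
  qed
  then have "quasi_cocycle_on (carrier G) (range Inl) C c'" using c' by (simp add: quasi_cocycle_on_def)
  with c' show ?thesis by blast
qed

section \<open>Property (T) and the finiteness theorem\<close>

lemma amenable_hom_image:
  assumes G: "group G" and H: "group H" and \<phi>: "\<phi> \<in> hom H G" and am: "amenable H"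
  shows "amenable (G\<lparr>carrier := \<phi> ` carrier H\<rparr>)"
proof -
  interpret group_hom H G \<phi> using G H \<phi> by (simp add: group_hom_def group_hom_axioms_def)
  let ?K = "G\<lparr>carrier := \<phi> ` carrier H\<rparr>"
  have K: "subgroup (\<phi> ` carrier H) G" by (rule img_is_subgroup)
  obtain \<mu> where \<mu>: "left_invariant_mean H \<mu>" using amenable_mean[OF am] by (rule exE)
  have bdd: "(\<lambda>y. f (\<phi> y)) \<in> bounded_functions H" if "f \<in> bounded_functions ?K" for f
    using that by (simp add: bounded_functions_def image_image)
  have cong: "\<mu> f = \<mu> f'" if f: "f \<in> bounded_functions H" and eq: "\<And>x. x \<in> carrier H \<Longrightarrow> f' x = f x" for f f'
  proof -
    have f': "f' \<in> bounded_functions H" using f eq by (simp add: bounded_functions_def)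
    \<comment> \<open>by positivity, a mean only depends on the values on the carrier\<close>
    have le: "\<mu> u \<le> \<mu> v" if u: "u \<in> bounded_functions H" and v: "v \<in> bounded_functions H"
      and uv: "\<And>x. x \<in> carrier H \<Longrightarrow> u x = v x" for u v
    proof -
      have u': "(\<lambda>x. -1 * u x) \<in> bounded_functions H"
        using u by (auto simp: bounded_functions_def bounded_iff)
      have "0 \<le> \<mu> (\<lambda>x. v x + -1 * u x)"
        by (rule mean_nonneg[OF \<mu> bounded_functions_add[OF v u']]) (simp add: uv)
      then show ?thesis using mean_add[OF \<mu> v u'] mean_scale[OF \<mu> u, of "-1"] by simp
    qed
    show ?thesis using le[OF f f'] le[OF f' f] eq by auto
  qed
  have "left_invariant_mean ?K (\<lambda>f. \<mu> (\<lambda>y. f (\<phi> y)))"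
    unfolding left_invariant_mean_def
  proof (intro conjI ballI allI impI)
    fix g f assume "g \<in> carrier ?K" and f: "f \<in> bounded_functions ?K"
    then obtain a where a: "a \<in> carrier H" "g = \<phi> a" by auto
    have gK: "g \<in> \<phi> ` carrier H" using a by simp
    have "\<mu> (\<lambda>y. f (inv\<^bsub>?K\<^esub> g \<otimes>\<^bsub>?K\<^esub> \<phi> y)) = \<mu> (\<lambda>y. f (\<phi> (inv\<^bsub>H\<^esub> a \<otimes>\<^bsub>H\<^esub> y)))"
    proof (rule cong[symmetric])
      show "(\<lambda>y. f (\<phi> (inv\<^bsub>H\<^esub> a \<otimes>\<^bsub>H\<^esub> y))) \<in> bounded_functions H"
      proof -
        obtain B where B: "\<And>x. x \<in> carrier H \<Longrightarrow> \<bar>f (\<phi> x)\<bar> \<le> B"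
          using bdd[OF f] by (auto simp: bounded_functions_def bounded_iff)
        show ?thesis by (rule bounded_functionsI[of _ _ B], rule B) (use a in simp)
      qed
      show "f (inv\<^bsub>?K\<^esub> g \<otimes>\<^bsub>?K\<^esub> \<phi> x) = f (\<phi> (inv\<^bsub>H\<^esub> a \<otimes>\<^bsub>H\<^esub> x))" if "x \<in> carrier H" for x
        using a that H.m_inv_consistent[OF K gK] by simp
    qed
    also have "\<dots> = \<mu> (\<lambda>y. f (\<phi> y))" using mean_invariant[OF \<mu> a(1) bdd[OF f]] .
    finally show "\<mu> (\<lambda>y. f (inv\<^bsub>?K\<^esub> g \<otimes>\<^bsub>?K\<^esub> \<phi> y)) = \<mu> (\<lambda>y. f (\<phi> y))" .
  next
    show "0 \<le> \<mu> (\<lambda>y. f (\<phi> y))" if "f \<in> bounded_functions ?K" "\<forall>x\<in>carrier ?K. 0 \<le> f x" for f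
      by (rule mean_nonneg[OF \<mu> bdd[OF that(1)]]) (use that(2) in simp)
  qed (simp_all add: mean_add[OF \<mu>] mean_scale[OF \<mu>] mean_one[OF \<mu>] bdd)
  then show ?thesis
    using subgroup.subgroup_is_group[OF K G] by (auto simp: amenable_iff_mean)
qed

text \<open>The sum of copies of the regular representation has no nonzero vector invariant under the infinite group
\<open>\<phi>(H)\<close>: such a vector takes each of its values infinitely often. So property (T) excludes almost
invariant vectors. As \<open>G\<close> is countable, a family of functions on \<open>G\<close> indexed by \<open>nat\<close> can be coded by
a function of one natural number, which supplies the injection for \<open>transport\<close>.\<close>

lemma kazhdan_inequality:
  fixes G :: "('a, 'm) monoid_scheme" and H :: "('b, 'n) monoid_scheme"
  assumes G: "group G" and cG: "countable (carrier G)" and H: "group H" and \<phi>: "\<phi> \<in> hom H G"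
    and T: "kazhdan_property_T H" and inf: "infinite (\<phi> ` carrier H)"
  shows "\<exists>Q \<epsilon>. finite Q \<and> Q \<subseteq> carrier H \<and> 0 < \<epsilon> \<and>
    (\<forall>\<xi>\<in>real_vectors G. \<xi> \<noteq> 0 \<longrightarrow> (\<exists>q\<in>Q. \<epsilon> * norm \<xi> \<le> norm (translate G (\<phi> q) \<xi> - \<xi>)))"
proof -
  interpret group_hom H G \<phi> using G H \<phi> by (simp add: group_hom_def group_hom_axioms_def)
  let ?V = "ell2_infinite_sum G" and ?\<pi> = "left_regular_infinite_sum G"
  interpret V: hilbert_space ?V by (rule hilbert_space_ell2_infinite_sum)
  interpret S: closed_subspace "real_vectors G" by (rule closed_subspace_supp_in)
  define \<iota> :: "(nat \<Rightarrow> 'a \<Rightarrow> complex) \<Rightarrow> 'b \<times> nat \<Rightarrow> complex"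
    where "\<iota> F = (\<lambda>(_, k). F (fst (prod_decode k)) (from_nat_into (carrier G) (snd (prod_decode k))))" for F
  have inj: "inj_on \<iota> (carrier ?V)"
  proof (rule inj_onI)
    fix F F' assume F: "F \<in> carrier ?V" "F' \<in> carrier ?V" and eq: "\<iota> F = \<iota> F'"
    show "F = F'"
    proof (intro ext)
      fix n x
      show "F n x = F' n x"
      proof (cases "x \<in> carrier G")
        case True
        then obtain m where "from_nat_into (carrier G) m = x" using from_nat_into_surj[OF cG] by blast
        then show ?thesis using fun_cong[OF eq, of "(undefined, prod_encode (n, m))"] by (simp add: \<iota>_def)
      qed (use F in \<open>simp add: ell2_infinite_sum_iff\<close>)
    qed
  qed
  let ?W = "transport \<iota> ?V"
  define \<kappa> where "\<kappa> = inv_into (carrier ?V) \<iota>"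
  have \<kappa>\<iota>: "\<kappa> (\<iota> F) = F" if "F \<in> carrier ?V" for F using inj that by (simp add: \<kappa>_def)
  define \<rho> where "\<rho> h w = \<iota> (?\<pi> (\<phi> h) (\<kappa> w))" for h w
  have \<rho>\<iota>: "\<rho> h (\<iota> F) = \<iota> (?\<pi> (\<phi> h) F)" if "F \<in> carrier ?V" for h F using that by (simp add: \<rho>_def \<kappa>\<iota>)
  have rep: "unitary_rep G ?V ?\<pi>" by (rule unitary_rep_left_regular_infinite_sum[OF G])
  have u: "unitary_op ?V (?\<pi> g)" if "g \<in> carrier G" for g using rep that by (simp add: unitary_rep_def)
  have \<pi>V: "?\<pi> g F \<in> carrier ?V" if "g \<in> carrier G" "F \<in> carrier ?V" for g F
    using u[OF that(1)] that(2) by (auto simp: unitary_op_def bij_betw_def)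
  have repW: "unitary_rep H ?W \<rho>"
    unfolding unitary_rep_def
  proof (intro conjI ballI)
    fix h assume h: "h \<in> carrier H"
    then have g: "\<phi> h \<in> carrier G" by simp
    have bij: "bij_betw (?\<pi> (\<phi> h)) (carrier ?V) (carrier ?V)" using u[OF g] by (simp add: unitary_op_def)
    have b\<iota>: "bij_betw \<iota> (carrier ?V) (carrier ?W)"
      using inj by (simp add: bij_betw_def V.transport_simps[OF inj])
    have "bij_betw (\<iota> \<circ> ?\<pi> (\<phi> h) \<circ> \<kappa>) (carrier ?W) (carrier ?W)"
      unfolding \<kappa>_def by (intro bij_betw_trans[OF bij_betw_inv_into[OF b\<iota>]] bij_betw_trans[OF bij b\<iota>, unfolded comp_assoc])
    then have "bij_betw (\<rho> h) (carrier ?W) (carrier ?W)" by (simp add: \<rho>_def comp_def cong: bij_betw_cong)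
    then show "unitary_op ?W (\<rho> h)"
      using u[OF g] unfolding unitary_op_def
      by (auto simp: V.transport_simps[OF inj] \<rho>\<iota> \<pi>V[OF g])
    show "\<rho> (h \<otimes>\<^bsub>H\<^esub> h') w = \<rho> h (\<rho> h' w)" if "h' \<in> carrier H" "w \<in> carrier ?W" for h' w
      using that h rep by (auto simp: V.transport_simps[OF inj] \<rho>\<iota> \<pi>V unitary_rep_def)
  qed
  have hW: "hilbert_space ?W" by (rule V.hilbert_space_transport[OF inj])
  obtain Q \<epsilon> where Q: "finite Q" "Q \<subseteq> carrier H" "0 < \<epsilon>"
    and kaz: "\<And>(W :: ('b \<times> nat \<Rightarrow> complex) hilbert) \<pi>. hilbert_space W \<Longrightarrow> unitary_rep H W \<pi> \<Longrightarrow>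
        \<exists>\<xi>\<in>carrier W. \<xi> \<noteq> \<zero>\<^bsub>W\<^esub> \<and> (\<forall>q\<in>Q. hnorm W (\<pi> q \<xi> \<ominus>\<^bsub>W\<^esub> \<xi>) < \<epsilon> * hnorm W \<xi>) \<Longrightarrow>
        \<exists>\<eta>\<in>carrier W. \<eta> \<noteq> \<zero>\<^bsub>W\<^esub> \<and> (\<forall>g\<in>carrier H. \<pi> g \<eta> = \<eta>)"
    using T unfolding kazhdan_property_T_def by blast
  have "\<exists>q\<in>Q. \<epsilon> * norm \<xi> \<le> norm (translate G (\<phi> q) \<xi> - \<xi>)" if \<xi>: "\<xi> \<in> real_vectors G" "\<xi> \<noteq> 0" for \<xi>
  proof (rule ccontr)
    assume "\<not> ?thesis"
    then have small: "norm (translate G (\<phi> q) \<xi> - \<xi>) < \<epsilon> * norm \<xi>" if "q \<in> Q" for q using that by (auto simp: not_le)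
    let ?F = "to_complex \<xi>"
    have F: "?F \<in> carrier ?V" by (rule to_complex_in[OF \<xi>(1)])
    have "hnorm ?W (\<iota> ?F) = norm \<xi>" using F \<xi> by (simp add: V.transport_simps[OF inj] hnorm_to_complex)
    moreover have "hnorm ?W (\<rho> q (\<iota> ?F) \<ominus>\<^bsub>?W\<^esub> \<iota> ?F) = norm (translate G (\<phi> q) \<xi> - \<xi>)" if "q \<in> Q" for q
    proof -
      have g: "\<phi> q \<in> carrier G" using that Q by auto
      have tr: "translate G (\<phi> q) \<xi> \<in> real_vectors G" using g \<xi> by (intro H.translate_in)
      have "?\<pi> (\<phi> q) ?F \<ominus>\<^bsub>?V\<^esub> ?F = to_complex (translate G (\<phi> q) \<xi> - \<xi>)"
        using ell2_infinite_sum_minus[OF \<pi>V[OF g F] F] g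
        by (simp add: fun_eq_iff to_complex_diff H.to_complex_translate)
      then show ?thesis
        using F g \<pi>V[OF g F] subspace_diff[OF S.subspace tr \<xi>(1)]
          to_complex_in[OF subspace_diff[OF S.subspace tr \<xi>(1)]]
        by (simp add: \<rho>\<iota> V.transport_minus[OF inj] V.transport_simps[OF inj] hnorm_to_complex)
    qed
    moreover have "\<iota> ?F \<noteq> \<zero>\<^bsub>?W\<^esub>"
    proof
      assume "\<iota> ?F = \<zero>\<^bsub>?W\<^esub>"
      then have "?F = \<zero>\<^bsub>?V\<^esub>" using inj F by (simp add: V.transport_simps[OF inj] inj_on_def)
      then have "norm \<xi> = 0" using hnorm_to_complex[OF \<xi>(1)] by (simp add: hnorm_def)
      then show False using \<xi> by simp
    qed
    ultimately have "\<exists>\<zeta>\<in>carrier ?W. \<zeta> \<noteq> \<zero>\<^bsub>?W\<^esub> \<and> (\<forall>q\<in>Q. hnorm ?W (\<rho> q \<zeta> \<ominus>\<^bsub>?W\<^esub> \<zeta>) < \<epsilon> * hnorm ?W \<zeta>)"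
      using F small by (intro bexI[of _ "\<iota> ?F"]) (auto simp: V.transport_simps[OF inj])
    from kaz[OF hW repW this] obtain \<eta> where \<eta>: "\<eta> \<in> carrier ?W" "\<eta> \<noteq> \<zero>\<^bsub>?W\<^esub>" "\<And>g. g \<in> carrier H \<Longrightarrow> \<rho> g \<eta> = \<eta>"
      by blast
    then obtain E where E: "E \<in> carrier ?V" "\<eta> = \<iota> E" by (auto simp: V.transport_simps[OF inj])
    have fixE: "?\<pi> (\<phi> h) E = E" if "h \<in> carrier H" for h
      using \<eta>(3)[OF that] E \<pi>V[OF hom_closed[OF that] E(1)] inj by (simp add: \<rho>\<iota> inj_on_def)
    obtain f where f: "f \<in> real_vectors G" "to_complex f = E" using ex_real_vector[OF E(1)] by blast
    define part where "part \<beta> z = (if \<beta> then Re z else Im z)" for \<beta> z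
    have coefs: "coef f (y, Inl (n, \<beta>)) = part \<beta> (E n y)" for n y \<beta>
      by (simp add: f(2)[symmetric] to_complex_def part_def)
    have "E n x = 0" for n x
    proof (cases "x \<in> carrier G")
      case True
      let ?Y = "(\<lambda>g. inv\<^bsub>G\<^esub> g \<otimes>\<^bsub>G\<^esub> x) ` (\<phi> ` carrier H)"
      have "inj_on (\<lambda>g. inv\<^bsub>G\<^esub> g \<otimes>\<^bsub>G\<^esub> x) (\<phi> ` carrier H)"
      proof (rule inj_on_subset)
        show "inj_on (\<lambda>g. inv\<^bsub>G\<^esub> g \<otimes>\<^bsub>G\<^esub> x) (carrier G)" using True by (intro inj_onI) auto
      qed auto
      then have infY: "infinite ?Y" using inf finite_image_iff by blast
      have const: "E n y = E n x" if y: "y \<in> ?Y" for y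
      proof -
        obtain h where "h \<in> carrier H" "y = inv\<^bsub>G\<^esub> (\<phi> h) \<otimes>\<^bsub>G\<^esub> x" using y by auto
        then show ?thesis
          using True fun_cong[OF fun_cong[OF fixE[of h]], of n x] by (simp add: left_regular_infinite_sum_def left_regular_def)
      qed
      have "part \<beta> (E n x) = 0" for \<beta>
      proof (rule l2_infinite_constant)
        show "infinite ((\<lambda>y. (y, Inl (n, \<beta>) :: 'a column)) ` ?Y)"
          using infY by (simp add: finite_image_iff inj_on_def)
        show "coef f p = part \<beta> (E n x)" if "p \<in> (\<lambda>y. (y, Inl (n, \<beta>))) ` ?Y" for p
        proof -
          from that obtain y where y: "p = (y, Inl (n, \<beta>))" "y \<in> ?Y" by (rule imageE)
          then show ?thesis by (simp only: y(1) coefs const[OF y(2)])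
        qed
      qed
      from this[of True] this[of False] show ?thesis by (simp add: part_def complex_eq_iff)
    qed (use E in \<open>simp add: ell2_infinite_sum_iff\<close>)
    then have "E = \<zero>\<^bsub>?V\<^esub>"
      by (intro ext) (simp add: ell2_infinite_sum_def ell2_def copies_simps(2) complex_line_def)
    then show False using \<eta>(2) E by (simp add: V.transport_simps[OF inj])
  qed
  with Q show ?thesis by blast
qed

theorem corollary4p5:
  fixes G :: "('a, 'm) monoid_scheme" and H :: "('b, 'n) monoid_scheme"
    and c :: "'a \<Rightarrow> nat \<Rightarrow> 'a \<Rightarrow> complex" and \<A> :: "'b set set" and \<phi> :: "'b \<Rightarrow> 'a"
  assumes "group G" and "countable (carrier G)"
    and "quasi_cocycle G (ell2_infinite_sum G) (left_regular_infinite_sum G) c"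
    and "proper_cocycle G (ell2_infinite_sum G) c"
    and "group H"
    and "finite \<A>" and "\<And>A. A \<in> \<A> \<Longrightarrow> subgroup A H \<and> amenable (H\<lparr>carrier := A\<rparr>)"
    and "boundedly_generated H (\<Union>\<A>)"
    and "kazhdan_property_T H"
    and "\<phi> \<in> hom H G"
  shows "finite (\<phi> ` carrier H)"
proof (rule ccontr)
  assume inf: "infinite (\<phi> ` carrier H)"
  interpret group_hom H G \<phi> using assms by (simp add: group_hom_def group_hom_axioms_def)
  let ?A = "range Inl :: 'a column set" and ?M = "\<phi> ` carrier H"
  define col :: "'a \<Rightarrow> 'a column" where "col b = Inr (Some b)" for b
  define s :: "'a column" where "s = Inr None"
  have col: "inj_on col (carrier G)" "?A \<inter> col ` carrier G = {}" "s \<notin> ?A" "s \<notin> col ` carrier G"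
    by (auto simp: col_def s_def inj_on_def)
  have M: "subgroup ?M G" by (rule img_is_subgroup)
  have MG: "\<And>g. g \<in> ?M \<Longrightarrow> g \<in> carrier G" using subgroup.subset[OF M] by auto
  obtain c' C0 where c': "\<And>g. g \<in> carrier G \<Longrightarrow> c' g \<in> real_vectors G \<and> to_complex (c' g) = c g"
    and q0: "quasi_cocycle_on (carrier G) ?A C0 c'"
    using H.quasi_cocycle_real[OF assms(3)] by blast
  \<comment> \<open>the circumcentre argument needs a positive bound of the defect\<close>
  define C where "C = \<bar>C0\<bar> + 1"
  have C: "C > 0" by (simp add: C_def)
  have q: "quasi_cocycle_on (carrier G) ?A C c'"
    using q0 unfolding quasi_cocycle_on_def C_def by force
  obtain Q \<epsilon> where Q: "finite Q" "Q \<subseteq> carrier H" "0 < \<epsilon>"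
    and gap: "\<And>\<xi>. \<xi> \<in> real_vectors G \<Longrightarrow> \<xi> \<noteq> 0 \<Longrightarrow> \<exists>q\<in>Q. \<epsilon> * norm \<xi> \<le> norm (translate G (\<phi> q) \<xi> - \<xi>)"
    using kazhdan_inequality[OF assms(1,2,5,10,9) inf] by blast
  define D where "D = (\<Sum>q\<in>Q. norm (c' (\<phi> q)))"
  have D0: "D \<ge> 0" by (simp add: D_def sum_nonneg)
  have D: "norm (c' (\<phi> q)) \<le> D" if "q \<in> Q" for q
    unfolding D_def by (rule member_le_sum) (use that Q in auto)
  define \<K> where "\<K> = (\<lambda>A. \<phi> ` A) ` \<A>"
  have \<K>: "subgroup K G \<and> amenable (G\<lparr>carrier := K\<rparr>)" if K: "K \<in> \<K>" for K
  proof -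
    obtain A where A: "A \<in> \<A>" "K = \<phi> ` A" using K by (auto simp: \<K>_def)
    have sA: "subgroup A H" "amenable (H\<lparr>carrier := A\<rparr>)" using assms(7)[OF A(1)] by auto
    have "\<phi> \<in> hom (H\<lparr>carrier := A\<rparr>) G"
      using assms(10) subgroup.subset[OF sA(1)] by (auto simp: hom_def subset_eq)
    from amenable_hom_image[OF assms(1) subgroup.subgroup_is_group[OF sA(1) assms(5)] this sA(2)]
    show ?thesis using A subgroup_img_is_subgroup[OF sA(1)] by simp
  qed
  have fin\<K>: "finite \<K>" using assms(6) by (simp add: \<K>_def)
  obtain k where k: "\<And>h. h \<in> carrier H \<Longrightarrow> \<exists>xs. length xs < k \<and>
      set xs \<subseteq> \<Union>\<A> \<union> (\<lambda>x. inv\<^bsub>H\<^esub> x) ` \<Union>\<A> \<and> h = foldr (\<otimes>\<^bsub>H\<^esub>) xs \<one>\<^bsub>H\<^esub>"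
    using assms(8) unfolding boundedly_generated_def by blast
  have word: "\<exists>ys. length ys < k \<and> set ys \<subseteq> \<Union>\<K> \<and> \<phi> h = foldr (\<otimes>\<^bsub>G\<^esub>) ys \<one>\<^bsub>G\<^esub>" if h: "h \<in> carrier H" for h
  proof -
    obtain xs where xs: "length xs < k" "set xs \<subseteq> \<Union>\<A> \<union> (\<lambda>x. inv\<^bsub>H\<^esub> x) ` \<Union>\<A>" "h = foldr (\<otimes>\<^bsub>H\<^esub>) xs \<one>\<^bsub>H\<^esub>"
      using k[OF h] by blast
    have "\<Union>\<A> \<union> (\<lambda>x. inv\<^bsub>H\<^esub> x) ` \<Union>\<A> \<subseteq> \<Union>\<A>"
      using assms(7) subgroup.m_inv_closed by fastforce
    from order_trans[OF xs(2) this] have xsA: "set xs \<subseteq> \<Union>\<A>" .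
    have "\<Union>\<A> \<subseteq> carrier H" using subgroup.subset[OF conjunct1[OF assms(7)]] by blast
    with xsA have xsH: "set xs \<subseteq> carrier H" by (rule order_trans)
    have "foldr (\<otimes>\<^bsub>H\<^esub>) xs \<one>\<^bsub>H\<^esub> \<in> carrier H \<and> \<phi> (foldr (\<otimes>\<^bsub>H\<^esub>) xs \<one>\<^bsub>H\<^esub>) = foldr (\<otimes>\<^bsub>G\<^esub>) (map \<phi> xs) \<one>\<^bsub>G\<^esub>"
      using xsH by (induction xs) auto
    moreover have "set (map \<phi> xs) \<subseteq> \<Union>\<K>" using xsA by (auto simp: \<K>_def)
    ultimately show ?thesis using xs by (intro exI[of _ "map \<phi> xs"]) simp
  qed
  \<comment> \<open>this bound on \<open>\<phi>(H)\<close> only involves \<open>C\<close>, \<open>\<epsilon>\<close> and the values of \<open>c\<close> on \<open>\<phi>(Q)\<close>\<close>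
  define L where "L = 18 * C + 2 * ((18 * C + D) / \<epsilon>)"
  have main: "norm (T (c' g)) \<le> L" if T: "H.multiplier ?A T" and b: "\<forall>K\<in>\<K>. \<exists>L. \<forall>b\<in>K. norm (T (c' b)) \<le> L" and g: "g \<in> ?M" for T g
  proof -
    let ?b = "\<lambda>g. T (c' g)"
    have qT: "H.quasi_cocycle_on (carrier G) ?A C ?b"
      by (rule H.quasi_cocycle_on_multiplier[OF order_refl q T])
    obtain B where B: "\<And>K x. K \<in> \<K> \<Longrightarrow> x \<in> K \<Longrightarrow> norm (?b x) \<le> B K" using b by metis
    \<comment> \<open>a bound for \<open>T \<circ> c\<close> on the generating set, which may depend on \<open>T\<close>\<close>
    define B' where "B' = (\<Sum>K\<in>\<K>. \<bar>B K\<bar>)"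
    have B': "norm (?b x) \<le> B'" if x: "x \<in> \<Union>\<K>" for x
    proof -
      obtain K where K: "K \<in> \<K>" "x \<in> K" using x by blast
      have "\<bar>B K\<bar> \<le> B'" unfolding B'_def by (rule member_le_sum) (use K fin\<K> in auto)
      then show ?thesis using B[OF K] by linarith
    qed
    have B'0: "0 \<le> B'" by (simp add: B'_def sum_nonneg)
    have bdd: "norm (?b h) \<le> norm (?b \<one>\<^bsub>G\<^esub>) + real k * (B' + C)" if h: "h \<in> ?M" for h
    proof -
      obtain y where y: "h = \<phi> y" "y \<in> carrier H" using h by (rule imageE)
      obtain ys where ys: "length ys < k" "set ys \<subseteq> \<Union>\<K>" "h = foldr (\<otimes>\<^bsub>G\<^esub>) ys \<one>\<^bsub>G\<^esub>"
        using word[OF y(2)] unfolding y(1) by blast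
      have "\<Union>\<K> \<subseteq> carrier G" using subgroup.subset[OF conjunct1[OF \<K>]] by blast
      then have "norm (?b h) \<le> norm (?b \<one>\<^bsub>G\<^esub>) + real (length ys) * (B' + C)"
        unfolding ys(3) by (rule H.quasi_cocycle_bounded_products[OF qT _ B' ys(2)])
      also have "\<dots> \<le> norm (?b \<one>\<^bsub>G\<^esub>) + real k * (B' + C)"
        using ys(1) B'0 C by (intro add_left_mono mult_right_mono) auto
      finally show ?thesis .
    qed
    obtain \<xi> where \<xi>: "\<xi> \<in> real_vectors G" "\<And>h. h \<in> ?M \<Longrightarrow> norm (?b h + translate G h \<xi> - \<xi>) \<le> 18 * C"
      using H.bounded_quasi_cocycle_near_coboundary[OF M H.quasi_cocycle_on_subset[OF qT subgroup.subset[OF M]] C bdd] by blast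
    have \<xi>n: "norm \<xi> \<le> (18 * C + D) / \<epsilon>"
    proof (cases "\<xi> = 0")
      case True
      then show ?thesis using C D0 Q by simp
    next
      case False
      obtain q where q: "q \<in> Q" "\<epsilon> * norm \<xi> \<le> norm (translate G (\<phi> q) \<xi> - \<xi>)" using gap[OF \<xi>(1) False] by blast
      have "norm (?b (\<phi> q)) \<le> D"
      proof -
        have "norm (T f) \<le> norm f" for f using T by (simp add: H.multiplier_def)
        from order_trans[OF this D[OF q(1)]] show ?thesis .
      qed
      moreover have "norm (?b (\<phi> q) + translate G (\<phi> q) \<xi> - \<xi>) \<le> 18 * C" using \<xi>(2) q Q by auto
      moreover have "norm (translate G (\<phi> q) \<xi> - \<xi>) \<le> norm (?b (\<phi> q) + translate G (\<phi> q) \<xi> - \<xi>) + norm (?b (\<phi> q))"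
        using norm_triangle_ineq4[of "?b (\<phi> q) + translate G (\<phi> q) \<xi> - \<xi>" "?b (\<phi> q)"] by simp
      ultimately have "\<epsilon> * norm \<xi> \<le> 18 * C + D" using q(2) by linarith
      then show ?thesis using Q(3) by (simp add: pos_le_divide_eq mult.commute)
    qed
    have "norm (translate G g \<xi>) = norm \<xi>"
      using MG[OF g] \<xi>(1) by (intro H.translate_norm) (auto intro: supp_in_mono)
    moreover have "norm (?b g) \<le> norm (?b g + translate G g \<xi> - \<xi>) + norm (translate G g \<xi>) + norm \<xi>"
      using norm_triangle_ineq4[of "?b g + translate G g \<xi> - \<xi>" "translate G g \<xi> - \<xi>"]
        norm_triangle_ineq4[of "translate G g \<xi>" \<xi>] by simp
    ultimately show ?thesis using \<xi>(2)[OF g] \<xi>n unfolding L_def by linarith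
  qed
  have "norm (c' g) \<le> L + 1" if g: "g \<in> ?M" for g
  proof -
    have "\<exists>T. H.multiplier ?A T \<and> (\<forall>K\<in>\<K>. \<exists>L. \<forall>b\<in>K. norm (T (c' b)) \<le> L) \<and> norm (T (c' g) - c' g) < 1"
      by (rule H.common_bounded_multiplier[OF assms(2) col q _ fin\<K> \<K>]) (use c' MG[OF g] in auto)
    then obtain T where T: "H.multiplier ?A T" "\<forall>K\<in>\<K>. \<exists>L. \<forall>b\<in>K. norm (T (c' b)) \<le> L" "norm (T (c' g) - c' g) < 1"
      by blast
    show ?thesis
      using main[OF T(1,2) g] T(3) norm_triangle_ineq4[of "T (c' g)" "T (c' g) - c' g"] by simp
  qed
  moreover have "hnorm (ell2_infinite_sum G) (c g) = norm (c' g)" if "g \<in> carrier G" for g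
    using hnorm_to_complex[of "c' g" G] c'[OF that] by simp
  ultimately have "?M \<subseteq> {g \<in> carrier G. hnorm (ell2_infinite_sum G) (c g) \<le> L + 1}"
    using MG by auto
  moreover have "L + 1 > 0" using C D0 Q(3) by (simp add: L_def add_pos_nonneg)
  then have "finite {g \<in> carrier G. hnorm (ell2_infinite_sum G) (c g) \<le> L + 1}"
    using assms(4) unfolding proper_cocycle_def by blast
  ultimately show False using inf finite_subset by blast
qed

end
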